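(* Let $d<\infty$ be a positive integer, $r_1,\dots,r_d\le\infty$, and $\mathcal{X}=\{(i_1,\dots,i_d)^T: i_j=1,2,\dots,r_j,\ j=1,\dots,d\}$ with the order $\boldsymbol{x}_1\preceq\boldsymbol{x}_2$ iff $x_{1,j}\le x_{2,j}$ for all $j=1,\dots,d$. Let $Z_1,Z_2,\dots,Z_n$ be i.i.d. random variables with values in $\mathcal{X}$ and probability mass function $\boldsymbol{p}$ that is $d$-monotone decreasing, i.e. $p_{\boldsymbol{x}_1}\ge p_{\boldsymbol{x}_2}$ whenever $\boldsymbol{x}_1\preceq\boldsymbol{x}_2$. Let $\hat{p}_{n,\boldsymbol{x}}=\frac1n\sum_{j=1}^n1\{Z_j=\boldsymbol{x}\}$ be the empirical estimator and let $$\hat{\boldsymbol{p}}_n^{*}=\underset{\xi\in\mathcal{F}^{an}}{\mathrm{argmin}}\sum_{\boldsymbol{x}\in\mathcal{X}}(\xi_{\boldsymbol{x}}-\hat{p}_{n,\boldsymbol{x}})^2,$$ where $\mathcal{F}^{an}$ is the set of $d$-monotone decreasing functions in $l_2=l_2(\mathcal{X})$ ($\hat{\boldsymbol{p}}_n^{*}$ is the maximum likelihood estimator of $\boldsymbol{p}$ under the $d$-monotone decreasing constraint). Then $$n^{1/2}(\hat{\boldsymbol{p}}_n^{*}-\boldsymbol{p})\stackrel{d}{\to}\varphi(\boldsymbol{Y}_{\boldsymbol{0},C})\quad\text{in }l_2,$$ where $\boldsymbol{Y}_{\boldsymbol{0},C}$ is a Gaussian process in $l_2$ with mean zero and covariance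 operator $C$ given by $\langle C\boldsymbol{e}_{\boldsymbol{i}},\boldsymbol{e}_{\boldsymbol{i}'}\rangle=p_{\boldsymbol{i}}\delta_{\boldsymbol{i},\boldsymbol{i}'}-p_{\boldsymbol{i}}p_{\boldsymbol{i}'}$ ($\boldsymbol{e}_{\boldsymbol{i}}$ being the standard orthonormal basis of $l_2$, $\delta$ the Kronecker delta), and $\varphi:l_2\to l_2$ maps $\boldsymbol{\theta}$ to the concatenation of the separate (unweighted) isotonic regressions, with respect to $\preceq$, of the restrictions of $\boldsymbol{\theta}$ to the comparable level sets of $\boldsymbol{p}$.
   Context: Two elements $x,y$ are comparable if $x\preceq y$ or $y\preceq x$. A function $f$ on $A\subseteq\mathcal{X}$ is isotonic if $x,y\in A$, $x\preceq y$ imply $f(x)\le f(y)$. The unweighted isotonic regression of a square summable $\theta$ over $A\subseteq\mathcal{X}$ is the (unique) minimizer of $\sum_{x\in A}(f(x)-\theta(x))^2$ over square summable isotonic functions $f$ on $A$. If some $r_j=\infty$, the corresponding coordinate runs over all positive integers; if all $r_j$ are finite, $l_2(\mathcal{X})$ is the finite dimensional Euclidean space $\mathbb{R}^{\mathcal{X}}$. Comparable level sets of $\boldsymbol{p}$: take the level sets $\{x\in\mathcal{X}:p_x=c\}$ and partition each of them into the connected components of the graph whose vertices are the elements of the level set and whose edges join comparable elements. These components partition $\mathcal{X}$. Operator $\varphi$: $\varphi(\boldsymbol{\theta})_x$ is the value at $x$ of the isotonic regression, over the comparable level set containing $x$, of the restriction of $\boldsymbol{\theta}$ to that set.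
   Formalization: The regressions in φ are taken over functions decreasing in ⪯ (isotonic for the reversed order), not increasing; with increasing ones the claim fails, e.g. for d=1, r=2, p uniform, where the first coordinate of the limit is max(G,0), not min(G,0). *)

theory Defs
  imports "HOL-Probability.Probability"
begin

section \<open>The Hilbert space of real square summable families\<close>

typedef 'a l2 = "{f :: 'a \<Rightarrow> real. (\<lambda>x. (f x)\<^sup>2) summable_on UNIV}"
  morphisms l2_fun Abs_l2
  by (rule exI[of _ "\<lambda>_. 0"]) simp

lemma l2_fun_square_summable: "(\<lambda>x. (l2_fun f x)\<^sup>2) summable_on UNIV"
  using l2_fun[of f] by simp

lemma square_summable_imp_mult_summable:
  fixes f g :: "'a \<Rightarrow> real"
  assumes "(\<lambda>x. (f x)\<^sup>2) summable_on A" and "(\<lambda>x. (g x)\<^sup>2) summable_on A"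
  shows "(\<lambda>x. f x * g x) summable_on A"
proof -
  have "(\<lambda>x. (f x)\<^sup>2 + (g x)\<^sup>2) summable_on A"
    by (intro summable_on_add assms)
  moreover have "norm (f x * g x) \<le> (f x)\<^sup>2 + (g x)\<^sup>2" for x
  proof -
    have "2 * \<bar>f x\<bar> * \<bar>g x\<bar> \<le> \<bar>f x\<bar>\<^sup>2 + \<bar>g x\<bar>\<^sup>2"
      by (rule sum_squares_bound)
    moreover have "0 \<le> \<bar>f x\<bar> * \<bar>g x\<bar>"
      by simp
    ultimately show ?thesis
      unfolding real_norm_def abs_mult power2_abs by linarith
  qed
  ultimately have "(\<lambda>x. norm (f x * g x)) summable_on A"
    by (rule summable_on_comparison_test) auto
  then show ?thesis
    by (rule abs_summable_summable)
qed

lemma l2_fun_mult_summable: "(\<lambda>x. l2_fun f x * l2_fun g x) summable_on UNIV"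
  by (intro square_summable_imp_mult_summable l2_fun_square_summable)

lemma square_summable_add:
  fixes f g :: "'a \<Rightarrow> real"
  assumes "(\<lambda>x. (f x)\<^sup>2) summable_on A" and "(\<lambda>x. (g x)\<^sup>2) summable_on A"
  shows "(\<lambda>x. (f x + g x)\<^sup>2) summable_on A"
proof -
  have "(\<lambda>x. (f x)\<^sup>2 + (g x)\<^sup>2 + 2 * (f x * g x)) summable_on A"
    by (intro summable_on_add assms summable_on_cmult_right
        square_summable_imp_mult_summable)
  then show ?thesis
    by (simp add: power2_sum mult.assoc)
qed

lemma square_summable_scale:
  fixes f :: "'a \<Rightarrow> real"
  assumes "(\<lambda>x. (f x)\<^sup>2) summable_on A"
  shows "(\<lambda>x. (c * f x)\<^sup>2) summable_on A"
  using summable_on_cmult_right[OF assms, of "c\<^sup>2"] by (simp add: power_mult_distrib)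

instantiation l2 :: (type) real_inner
begin

definition "0 = Abs_l2 (\<lambda>_. 0)"
definition "f + g = Abs_l2 (\<lambda>x. l2_fun f x + l2_fun g x)"
definition "- f = Abs_l2 (\<lambda>x. - l2_fun f x)"
definition "f - g = Abs_l2 (\<lambda>x. l2_fun f x - l2_fun g x)"
definition "c *\<^sub>R f = Abs_l2 (\<lambda>x. c * l2_fun f x)"
definition "f \<bullet> g = (\<Sum>\<^sub>\<infinity>x. l2_fun f x * l2_fun g x)"
definition "norm (f :: 'a l2) = sqrt (f \<bullet> f)"
definition "sgn (f :: 'a l2) = inverse (norm f) *\<^sub>R f"
definition "dist (f :: 'a l2) g = norm (f - g)"
definition "(uniformity :: ('a l2 \<times> 'a l2) filter) = (INF e\<in>{0<..}. principal {(x, y). dist x y < e})"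
definition "open (U :: 'a l2 set) \<longleftrightarrow> (\<forall>x\<in>U. \<forall>\<^sub>F (x', y) in uniformity. x' = x \<longrightarrow> y \<in> U)"

lemma l2_fun_zero: "l2_fun 0 = (\<lambda>_. 0)"
  unfolding zero_l2_def by (rule Abs_l2_inverse) simp

lemma l2_fun_add: "l2_fun (f + g) = (\<lambda>x. l2_fun f x + l2_fun g x)"
  unfolding plus_l2_def
  by (rule Abs_l2_inverse) (simp add: square_summable_add l2_fun_square_summable)

lemma l2_fun_scaleR: "l2_fun (c *\<^sub>R f) = (\<lambda>x. c * l2_fun f x)"
  unfolding scaleR_l2_def
  by (rule Abs_l2_inverse) (simp add: square_summable_scale l2_fun_square_summable)

lemma l2_fun_uminus: "l2_fun (- f) = (\<lambda>x. - l2_fun f x)"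
  unfolding uminus_l2_def
  by (rule Abs_l2_inverse) (simp add: l2_fun_square_summable)

lemma l2_fun_diff: "l2_fun (f - g) = (\<lambda>x. l2_fun f x - l2_fun g x)"
  unfolding minus_l2_def
  using square_summable_add[OF l2_fun_square_summable[of f] l2_fun_square_summable[of "- g"]]
  by (intro Abs_l2_inverse) (simp add: l2_fun_uminus)

instance
proof
  fix f g h :: "'a l2" and a b :: real
  note simps = l2_fun_zero l2_fun_add l2_fun_scaleR l2_fun_uminus l2_fun_diff
    l2_fun_inject[symmetric] fun_eq_iff
  show "f + g + h = f + (g + h)" "f + g = g + f" "0 + f = f" "- f + f = 0" "f - g = f + - g"
    by (simp_all add: simps)
  show "a *\<^sub>R (f + g) = a *\<^sub>R f + a *\<^sub>R g" "(a + b) *\<^sub>R f = a *\<^sub>R f + b *\<^sub>R f"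
    "a *\<^sub>R b *\<^sub>R f = (a * b) *\<^sub>R f" "1 *\<^sub>R f = f"
    by (simp_all add: simps algebra_simps)
  show "dist f g = norm (f - g)" "sgn f = inverse (norm f) *\<^sub>R f" "norm f = sqrt (f \<bullet> f)"
    by (simp_all add: dist_l2_def sgn_l2_def norm_l2_def)
  show "f \<bullet> g = g \<bullet> f"
    by (simp add: inner_l2_def mult.commute)
  show "(f + g) \<bullet> h = f \<bullet> h + g \<bullet> h"
    by (simp add: inner_l2_def l2_fun_add distrib_right infsum_add l2_fun_mult_summable)
  show "(a *\<^sub>R f) \<bullet> g = a * (f \<bullet> g)"
    by (simp add: inner_l2_def l2_fun_scaleR mult.assoc infsum_cmult_right')
  show "0 \<le> f \<bullet> f"
    by (simp add: inner_l2_def infsum_nonneg)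
  show "f \<bullet> f = 0 \<longleftrightarrow> f = 0"
  proof
    assume eq: "f \<bullet> f = 0"
    have "l2_fun f x * l2_fun f x = 0" for x
      using eq nonneg_infsum_le_0D[of "\<lambda>x. l2_fun f x * l2_fun f x" UNIV x]
      by (simp add: inner_l2_def l2_fun_mult_summable)
    then show "f = 0"
      by (simp add: simps)
  qed (simp add: inner_l2_def l2_fun_zero)
qed (rule uniformity_l2_def open_l2_def)+

end

text \<open>For an index set \<open>A\<close> that is not a whole type, \<open>l\<^sub>2(A)\<close> is the closed subspace of the
  families that vanish outside \<open>A\<close>; it carries the subspace topology and the trace of the
  Borel sets.\<close>

definition l2_on :: "'a set \<Rightarrow> 'a l2 set"
  where "l2_on A = {f. \<forall>x. x \<notin> A \<longrightarrow> l2_fun f x = 0}"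

text \<open>Meaningful only if \<open>f\<close> is square summable on \<open>A\<close>.\<close>

definition to_l2 :: "'a set \<Rightarrow> ('a \<Rightarrow> real) \<Rightarrow> 'a l2"
  where "to_l2 A f = Abs_l2 (\<lambda>x. if x \<in> A then f x else 0)"

definition l2_basis :: "'a \<Rightarrow> 'a l2"
  where "l2_basis i = Abs_l2 (\<lambda>x. if x = i then 1 else 0)"


section \<open>Random elements of a subspace\<close>

definition converges_in_distribution ::
    "'v::topological_space set \<Rightarrow> 'w measure \<Rightarrow> (nat \<Rightarrow> 'w \<Rightarrow> 'v) \<Rightarrow> 'b measure \<Rightarrow> ('b \<Rightarrow> 'v) \<Rightarrow> bool"
  where "converges_in_distribution S M X N Y \<longleftrightarrow>
    (\<forall>n. X n \<in> measurable M (restrict_space borel S)) \<and>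
    Y \<in> measurable N (restrict_space borel S) \<and>
    (\<forall>f :: 'v \<Rightarrow> real. continuous_on S f \<and> bounded (f ` S) \<longrightarrow>
      (\<lambda>n. \<integral>\<omega>. f (X n \<omega>) \<partial>M) \<longlonglongrightarrow> (\<integral>\<omega>. f (Y \<omega>) \<partial>N))"

text \<open>Degenerate normal laws are included: the covariance operator may have a kernel.\<close>

definition gaussian_law :: "real measure \<Rightarrow> bool"
  where "gaussian_law \<mu> \<longleftrightarrow>
    (\<exists>m. \<mu> = return borel m) \<or>
    (\<exists>m \<sigma>. 0 < \<sigma> \<and> \<mu> = density lborel (\<lambda>x. ennreal (normal_density m \<sigma> x)))"

definition gaussian_process :: "'v::real_inner set \<Rightarrow> 'b measure \<Rightarrow> ('b \<Rightarrow> 'v) \<Rightarrow> bool"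
  where "gaussian_process S N Y \<longleftrightarrow>
    prob_space N \<and> Y \<in> measurable N (restrict_space borel S) \<and>
    (\<forall>h\<in>S. gaussian_law (distr N borel (\<lambda>\<omega>. Y \<omega> \<bullet> h)))"

definition has_mean :: "'v::real_inner set \<Rightarrow> 'b measure \<Rightarrow> ('b \<Rightarrow> 'v) \<Rightarrow> 'v \<Rightarrow> bool"
  where "has_mean S N Y m \<longleftrightarrow> m \<in> S \<and>
    (\<forall>h\<in>S. integrable N (\<lambda>\<omega>. Y \<omega> \<bullet> h) \<and> (\<integral>\<omega>. Y \<omega> \<bullet> h \<partial>N) = m \<bullet> h)"

definition has_covariance_operator ::
    "'v::real_inner set \<Rightarrow> 'b measure \<Rightarrow> ('b \<Rightarrow> 'v) \<Rightarrow> ('v \<Rightarrow> 'v) \<Rightarrow> bool"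
  where "has_covariance_operator S N Y C \<longleftrightarrow> (\<exists>m. has_mean S N Y m \<and>
    (\<forall>h\<in>S. \<forall>h'\<in>S. integrable N (\<lambda>\<omega>. ((Y \<omega> - m) \<bullet> h) * ((Y \<omega> - m) \<bullet> h')) \<and>
      (\<integral>\<omega>. ((Y \<omega> - m) \<bullet> h) * ((Y \<omega> - m) \<bullet> h') \<partial>N) = C h \<bullet> h'))"


section \<open>Isotonic regression and comparable level sets\<close>

text \<open>The order is a parameter \<open>le\<close>, so that decreasing functions are the isotonic functions
  for the converse order.  The minimiser exists and is unique for square summable \<open>\<theta>\<close>.\<close>

definition isotonic_regression ::
    "('a \<Rightarrow> 'a \<Rightarrow> bool) \<Rightarrow> 'a set \<Rightarrow> ('a \<Rightarrow> real) \<Rightarrow> 'a l2"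
  where "isotonic_regression le A \<theta> =
    arg_min_on (\<lambda>f. \<Sum>\<^sub>\<infinity>x\<in>A. (l2_fun f x - \<theta> x)\<^sup>2)
      {f \<in> l2_on A. monotone_on A le (\<le>) (l2_fun f)}"

definition comparable :: "('a \<Rightarrow> 'a \<Rightarrow> bool) \<Rightarrow> 'a \<Rightarrow> 'a \<Rightarrow> bool"
  where "comparable le x y \<longleftrightarrow> le x y \<or> le y x"

definition level_set :: "'a set \<Rightarrow> ('a \<Rightarrow> real) \<Rightarrow> real \<Rightarrow> 'a set"
  where "level_set A p c = {x \<in> A. p x = c}"

definition comparable_component :: "('a \<Rightarrow> 'a \<Rightarrow> bool) \<Rightarrow> 'a set \<Rightarrow> 'a \<Rightarrow> 'a set"
  where "comparable_component le L x =
    {y. (x, y) \<in> {(u, v). u \<in> L \<and> v \<in> L \<and> comparable le u v}\<^sup>*}"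

definition comparable_level_set ::
    "('a \<Rightarrow> 'a \<Rightarrow> bool) \<Rightarrow> 'a set \<Rightarrow> ('a \<Rightarrow> real) \<Rightarrow> 'a \<Rightarrow> 'a set"
  where "comparable_level_set le A p x = comparable_component le (level_set A p (p x)) x"

definition level_set_regression ::
    "('a \<Rightarrow> 'a \<Rightarrow> bool) \<Rightarrow> 'a set \<Rightarrow> ('a \<Rightarrow> real) \<Rightarrow> 'a l2 \<Rightarrow> 'a l2"
  where "level_set_regression le A p \<theta> =
    to_l2 A (\<lambda>x. l2_fun (isotonic_regression le (comparable_level_set le A p x) (l2_fun \<theta>)) x)"


section \<open>Decreasing probability mass functions on a grid\<close>

definition grid :: "('d::finite \<Rightarrow> enat) \<Rightarrow> (nat ^ 'd) set"
  where "grid r = {x. \<forall>j. 1 \<le> x $ j \<and> enat (x $ j) \<le> r j}"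

definition empirical_pmf :: "(nat \<Rightarrow> 'w \<Rightarrow> 'a) \<Rightarrow> nat \<Rightarrow> 'w \<Rightarrow> 'a \<Rightarrow> real"
  where "empirical_pmf Z n \<omega> x = (1 / real n) * (\<Sum>j=1..n. if Z j \<omega> = x then 1 else 0)"

definition decreasing_l2 :: "'a::order set \<Rightarrow> 'a l2 set"
  where "decreasing_l2 A = {\<xi> \<in> l2_on A. monotone_on A (\<le>) (\<ge>) (l2_fun \<xi>)}"

definition decreasing_estimator ::
    "'a::order set \<Rightarrow> (nat \<Rightarrow> 'w \<Rightarrow> 'a) \<Rightarrow> nat \<Rightarrow> 'w \<Rightarrow> 'a l2"
  where "decreasing_estimator A Z n \<omega> =
    arg_min_on (\<lambda>\<xi>. \<Sum>\<^sub>\<infinity>x\<in>A. (l2_fun \<xi> x - empirical_pmf Z n \<omega> x)\<^sup>2) (decreasing_l2 A)"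

end

theory Submission
  imports Defs
begin

text \<open>
  Write \<open>F\<close> for the cone of decreasing functions in \<open>l\<^sub>2\<close>, \<open>W\<^sub>n\<close> for the scaled fluctuation of the
  empirical distribution around \<open>p\<close>, and \<open>K\<close> for the cone of functions that decrease along every
  comparable pair on which \<open>p\<close> is constant.  The estimator is the projection onto \<open>F\<close>, so its scaled
  error is the projection of \<open>W\<^sub>n\<close> onto the rescaled cone \<open>F\<^sub>n = \<surd>n (F - p)\<close>, and \<open>\<phi>\<close> is the
  projection onto \<open>K\<close>.  The sets \<open>F\<^sub>n\<close> lie in \<open>K\<close> and exhaust it up to closure on the functions
  supported in \<open>{p > 0}\<close>: a truncation to the finite set \<open>{p \<ge> \<epsilon>}\<close> of an element of \<open>K\<close> lies in \<open>F\<^sub>n\<close>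
  for large \<open>n\<close>, because the positive gaps of \<open>p\<close> below that set are bounded away from zero.  Hence
  the projections onto \<open>F\<^sub>n\<close> converge pointwise to \<open>\<phi>\<close>; as they are all 1-Lipschitz, weak
  convergence of \<open>W\<^sub>n\<close> is preserved in the limit.

  Weak convergence of \<open>W\<^sub>n\<close> itself is tested on bounded Lipschitz functions.  The second moments of the
  coordinates are dominated by \<open>p\<close>, which reduces it to finitely many coordinates, where the
  one-dimensional central limit theorem controls all trigonometric polynomials; these suffice by
  Stone--Weierstrass, after a large cube has been wrapped onto a torus.
\<close>

section \<open>The space of square summable families\<close>

text \<open>The limit theorem speaks about every Gaussian process with the prescribed mean and
  covariance, so a separate construction has to show that one exists. It is explicit: a triangular
  factor of the covariance makes each coordinate a finite combination of independent standard
  normals, and variances bounded by \<open>p\<close> give square summability. The obstacle in the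
  main line is that the rescaled cones move with \<open>n\<close> and that the projections onto them
  converge only pointwise. Their common Lipschitz constant repairs this: tail suprema of the
  differences of test functions are again Lipschitz, hence test functions themselves. The
  restriction to {p > 0} is forced by the truncation: superlevel sets of \<open>p\<close> at
  positive heights are finite and respect all level constraints, while on the possibly infinite zero
  level a finite truncation need not stay in \<open>K\<close>. It costs nothing, since the
  fluctuation and the limit vanish almost surely off {p > 0}. Cosines of linear functionals are
  chosen because a product of cosines is a sum of cosines, so that one-dimensional limit laws
  suffice.\<close>

declare l2_fun_zero [simp] l2_fun_add [simp] l2_fun_diff [simp] l2_fun_uminus [simp]
  l2_fun_scaleR [simp]

lemma l2_eqI: "(\<And>x. l2_fun f x = l2_fun g x) \<Longrightarrow> f = g"
  by (simp add: l2_fun_inject[symmetric] fun_eq_iff)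

lemma norm_l2_square: "(norm f)\<^sup>2 = (\<Sum>\<^sub>\<infinity>x. (l2_fun f x)\<^sup>2)"
  unfolding power2_norm_eq_inner inner_l2_def by (simp add: power2_eq_square)

lemma sum_square_le_norm_l2:
  "finite D \<Longrightarrow> (\<Sum>x\<in>D. (l2_fun f x)\<^sup>2) \<le> (norm f)\<^sup>2"
  unfolding norm_l2_square by (rule finite_sum_le_infsum[OF l2_fun_square_summable]) auto

lemma abs_l2_fun_le_norm: "\<bar>l2_fun f x\<bar> \<le> norm f"
  using sum_square_le_norm_l2[of "{x}" f] by (simp add: abs_le_square_iff[of _ "norm f", simplified])

lemma norm_l2_le:
  assumes "\<And>D. finite D \<Longrightarrow> (\<Sum>x\<in>D. (l2_fun f x)\<^sup>2) \<le> B\<^sup>2" and "0 \<le> B"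
  shows "norm f \<le> B"
proof -
  have "(norm f)\<^sup>2 \<le> B\<^sup>2"
    unfolding norm_l2_square
    by (rule infsum_le_finite_sums[OF l2_fun_square_summable]) (use assms in auto)
  then show ?thesis
    using assms(2) by (rule power2_le_imp_le)
qed

lemma norm_l2_mono:
  assumes "\<And>x. \<bar>l2_fun f x\<bar> \<le> \<bar>l2_fun g x\<bar>"
  shows "norm f \<le> norm g"
proof (rule norm_l2_le)
  fix D :: "'a set" assume "finite D"
  have "(\<Sum>x\<in>D. (l2_fun f x)\<^sup>2) \<le> (\<Sum>x\<in>D. (l2_fun g x)\<^sup>2)"
    by (rule sum_mono) (use assms in \<open>simp add: abs_le_square_iff\<close>)
  also have "\<dots> \<le> (norm g)\<^sup>2"
    by (rule sum_square_le_norm_l2) fact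
  finally show "(\<Sum>x\<in>D. (l2_fun f x)\<^sup>2) \<le> (norm g)\<^sup>2" .
qed simp

lemma bounded_linear_l2_fun: "bounded_linear (\<lambda>f. l2_fun f x)"
  by (rule bounded_linear_intro[where K = 1]) (simp_all add: abs_l2_fun_le_norm)

lemmas continuous_on_l2_fun = bounded_linear.continuous_on[OF bounded_linear_l2_fun]

lemma square_summable_onI:
  fixes f :: "'a \<Rightarrow> real"
  assumes "\<And>D. finite D \<Longrightarrow> D \<subseteq> A \<Longrightarrow> (\<Sum>x\<in>D. (f x)\<^sup>2) \<le> B"
  shows "(\<lambda>x. (f x)\<^sup>2) summable_on A"
  by (rule nonneg_bdd_above_summable_on) (auto intro!: bdd_aboveI[of _ B] assms)

lemma l2_fun_Abs: "(\<lambda>x. (f x)\<^sup>2) summable_on UNIV \<Longrightarrow> l2_fun (Abs_l2 f) = f"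
  by (rule Abs_l2_inverse) simp

text \<open>Completeness feeds the projection theorem. The coordinatewise limit \<open>l\<close> is
  not yet known to be square summable, so the estimates are made on finite partial sums, where the
  limit can be taken termwise.\<close>

instance l2 :: (type) complete_space
proof
  fix X :: "nat \<Rightarrow> 'a l2" assume X: "Cauchy X"
  have "Cauchy (\<lambda>n. l2_fun (X n) x)" for x
    by (rule bounded_linear.Cauchy[OF bounded_linear_l2_fun X])
  then have "\<exists>l. (\<lambda>n. l2_fun (X n) x) \<longlonglongrightarrow> l" for x
    using Cauchy_convergent convergent_def by blast
  then obtain l where l: "\<And>x. (\<lambda>n. l2_fun (X n) x) \<longlonglongrightarrow> l x"
    by metis
  have near: "\<exists>N. \<forall>n\<ge>N. \<forall>D. finite D \<longrightarrow> (\<Sum>x\<in>D. (l2_fun (X n) x - l x)\<^sup>2) \<le> e\<^sup>2" if e: "0 < e" for e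
  proof -
    obtain N where N: "\<And>m n. m \<ge> N \<Longrightarrow> n \<ge> N \<Longrightarrow> norm (X m - X n) < e"
      using CauchyD[OF X e] by blast
    have "(\<Sum>x\<in>D. (l2_fun (X n) x - l x)\<^sup>2) \<le> e\<^sup>2" if n: "n \<ge> N" and D: "finite D" for n D
    proof (rule LIMSEQ_le_const2)
      show "(\<lambda>m. \<Sum>x\<in>D. (l2_fun (X n) x - l2_fun (X m) x)\<^sup>2) \<longlonglongrightarrow> (\<Sum>x\<in>D. (l2_fun (X n) x - l x)\<^sup>2)"
        by (intro tendsto_intros l)
      have "(\<Sum>x\<in>D. (l2_fun (X n) x - l2_fun (X m) x)\<^sup>2) \<le> e\<^sup>2" if "m \<ge> N" for m
      proof -
        have "(\<Sum>x\<in>D. (l2_fun (X n) x - l2_fun (X m) x)\<^sup>2) \<le> (norm (X n - X m))\<^sup>2"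
          using sum_square_le_norm_l2[OF D, of "X n - X m"] by simp
        also have "\<dots> \<le> e\<^sup>2"
          using N[OF n that] by (intro power_mono) auto
        finally show ?thesis .
      qed
      then show "\<exists>N. \<forall>m\<ge>N. (\<Sum>x\<in>D. (l2_fun (X n) x - l2_fun (X m) x)\<^sup>2) \<le> e\<^sup>2"
        by blast
    qed
    then show ?thesis by blast
  qed
  obtain N where N: "\<And>n D. n \<ge> N \<Longrightarrow> finite D \<Longrightarrow> (\<Sum>x\<in>D. (l2_fun (X n) x - l x)\<^sup>2) \<le> 1"
    using near[of 1] by auto
  have "(\<lambda>x. (l2_fun (X N) x - l x)\<^sup>2) summable_on UNIV"
    by (rule square_summable_onI[where B = 1]) (use N[of N] in auto)
  then have *: "l2_fun (Abs_l2 (\<lambda>x. l2_fun (X N) x - l x)) = (\<lambda>x. l2_fun (X N) x - l x)"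
    by (rule l2_fun_Abs)
  \<comment> \<open>So far only the difference of \<open>X N\<close> and \<open>l\<close> is known
    to be square summable, so the limit is recovered by subtracting it from
    \<open>X N\<close>.\<close>
  define L where "L = X N - Abs_l2 (\<lambda>x. l2_fun (X N) x - l x)"
  have L: "l2_fun L = l"
    by (simp add: L_def *)
  have "X \<longlonglongrightarrow> L"
  proof (rule LIMSEQ_I)
    fix e :: real assume e: "0 < e"
    obtain N where N: "\<And>n D. n \<ge> N \<Longrightarrow> finite D \<Longrightarrow> (\<Sum>x\<in>D. (l2_fun (X n) x - l x)\<^sup>2) \<le> (e/2)\<^sup>2"
      using near[of "e/2"] e by auto
    have "norm (X n - L) \<le> e/2" if "n \<ge> N" for n
      by (rule norm_l2_le) (use N[OF that] e in \<open>auto simp: L\<close>)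
    then show "\<exists>N. \<forall>n\<ge>N. norm (X n - L) < e"
      using e by (intro exI[of _ N]) (auto intro: le_less_trans[of _ "e/2"])
  qed
  then show "convergent X"
    by (auto simp: convergent_def)
qed

section \<open>Coordinate restrictions, basis vectors and finite-dimensional approximation\<close>

lemma l2_fun_to_l2:
  assumes "(\<lambda>x. (f x)\<^sup>2) summable_on A"
  shows "l2_fun (to_l2 A f) = (\<lambda>x. if x \<in> A then f x else 0)"
proof -
  have "(\<lambda>x. (if x \<in> A then f x else 0)\<^sup>2) summable_on UNIV"
    using assms by (subst summable_on_cong_neutral[where T = A and g = "\<lambda>x. (f x)\<^sup>2"]) auto
  then show ?thesis
    unfolding to_l2_def by (rule l2_fun_Abs)
qed

lemma l2_fun_basis [simp]: "l2_fun (l2_basis i) x = (if x = i then 1 else 0)"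
proof -
  have "(\<lambda>x. (if x = i then 1 else 0 :: real)\<^sup>2) summable_on UNIV"
    by (subst summable_on_cong_neutral[where T = "{i}" and g = "\<lambda>_. 1"]) auto
  then have "l2_fun (l2_basis i) = (\<lambda>x. if x = i then 1 else 0)"
    unfolding l2_basis_def by (rule l2_fun_Abs)
  then show ?thesis by simp
qed

lemma inner_l2_basis [simp]: "f \<bullet> l2_basis i = l2_fun f i"
proof -
  have "f \<bullet> l2_basis i = (\<Sum>\<^sub>\<infinity>x\<in>{i}. l2_fun f x)"
    unfolding inner_l2_def by (rule infsum_cong_neutral) auto
  then show ?thesis by simp
qed

lemma norm_l2_basis [simp]: "norm (l2_basis i) = 1"
  by (simp add: norm_eq_sqrt_inner)

definition l2_restrict :: "'a set \<Rightarrow> 'a l2 \<Rightarrow> 'a l2"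
  where "l2_restrict A f = to_l2 A (l2_fun f)"

lemma l2_fun_restrict [simp]: "l2_fun (l2_restrict A f) x = (if x \<in> A then l2_fun f x else 0)"
  unfolding l2_restrict_def
  by (subst l2_fun_to_l2) (auto intro: summable_on_subset_banach[OF l2_fun_square_summable])

lemma norm_l2_restrict_le: "norm (l2_restrict A f) \<le> norm f"
  by (rule norm_l2_mono) auto

lemma bounded_linear_l2_restrict: "bounded_linear (l2_restrict A)"
  by (rule bounded_linear_intro[where K = 1]) (auto intro!: l2_eqI simp: norm_l2_restrict_le)

lemma l2_restrict_diff: "l2_restrict A (f - g) = l2_restrict A f - l2_restrict A g"
  by (rule l2_eqI) auto

lemma dist_l2_restrict_le: "dist (l2_restrict A f) (l2_restrict A g) \<le> dist f g"
  by (simp add: dist_norm norm_l2_restrict_le flip: l2_restrict_diff)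

lemma norm_l2_restrict_Compl:
  "(norm f)\<^sup>2 = (norm (l2_restrict A f))\<^sup>2 + (norm (l2_restrict (- A) f))\<^sup>2"
proof -
  have "l2_restrict A f \<bullet> l2_restrict (- A) f = 0"
    unfolding inner_l2_def by (rule infsum_0) simp
  moreover have "f = l2_restrict A f + l2_restrict (- A) f"
    by (rule l2_eqI) auto
  ultimately show ?thesis
    by (metis norm_add_Pythagorean orthogonal_def)
qed

lemma norm_l2_restrict_finite:
  assumes "finite D"
  shows "(norm (l2_restrict D f))\<^sup>2 = (\<Sum>x\<in>D. (l2_fun f x)\<^sup>2)"
proof -
  have "(norm (l2_restrict D f))\<^sup>2 = (\<Sum>\<^sub>\<infinity>x\<in>D. (l2_fun f x)\<^sup>2)"
    unfolding norm_l2_square by (rule infsum_cong_neutral) auto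
  then show ?thesis using assms by simp
qed

lemma l2_fun_sum: "l2_fun (\<Sum>x\<in>E. g x) y = (\<Sum>x\<in>E. l2_fun (g x) y)"
  by (induction E rule: infinite_finite_induct) auto

lemma l2_fun_sum_basis:
  "finite D \<Longrightarrow> l2_fun (\<Sum>x\<in>D. c x *\<^sub>R l2_basis x) y = (if y \<in> D then c y else 0)"
  by (simp add: l2_fun_sum if_distrib cong: if_cong)

lemma l2_restrict_eq_sum:
  "finite D \<Longrightarrow> l2_restrict D f = (\<Sum>x\<in>D. l2_fun f x *\<^sub>R l2_basis x)"
  by (rule l2_eqI) (simp add: l2_fun_sum_basis)

text \<open>All supersets of \<open>D\<close> are covered, infinite ones included:
  \<open>truncation_approx\<close> applies this to a superlevel set joined with the complement of
  the support.\<close>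

lemma l2_restrict_approx:
  assumes "0 < e"
  shows "\<exists>D. finite D \<and> (\<forall>A. D \<subseteq> A \<longrightarrow> norm (f - l2_restrict A f) < e)"
proof -
  have "((\<lambda>x. (l2_fun f x)\<^sup>2) has_sum (norm f)\<^sup>2) UNIV"
    unfolding norm_l2_square by (rule has_sum_infsum[OF l2_fun_square_summable])
  then have "eventually (\<lambda>D. dist (\<Sum>x\<in>D. (l2_fun f x)\<^sup>2) ((norm f)\<^sup>2) < e\<^sup>2) (finite_subsets_at_top UNIV)"
    unfolding has_sum_def using assms by (intro tendstoD) auto
  then obtain D where D: "finite D" "dist (\<Sum>x\<in>D. (l2_fun f x)\<^sup>2) ((norm f)\<^sup>2) < e\<^sup>2"
    unfolding eventually_finite_subsets_at_top by blast
  have "norm (f - l2_restrict A f) < e" if "D \<subseteq> A" for A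
  proof -
    have "norm (f - l2_restrict A f) \<le> norm (l2_restrict (- D) f)"
      by (rule norm_l2_mono) (use that in auto)
    moreover have "(norm (l2_restrict (- D) f))\<^sup>2 < e\<^sup>2"
      using norm_l2_restrict_Compl[of f D] norm_l2_restrict_finite[OF D(1), of f] D(2)
      by (auto simp: dist_real_def)
    ultimately show ?thesis
      using assms by (meson le_less_trans less_imp_le power2_less_imp_less)
  qed
  with D(1) show ?thesis by blast
qed

lemma mem_l2_on_iff: "f \<in> l2_on A \<longleftrightarrow> l2_restrict A f = f"
  by (auto simp: l2_on_def l2_fun_inject[symmetric] fun_eq_iff)

lemma l2_restrict_in_l2_on: "B \<subseteq> A \<Longrightarrow> l2_restrict B f \<in> l2_on A"
  by (auto simp: l2_on_def)

lemma closed_l2_on: "closed (l2_on A)"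
proof -
  have "l2_on A = (\<Inter>x\<in>-A. {f. l2_fun f x = 0})"
    by (auto simp: l2_on_def)
  then show ?thesis
    by (auto intro!: closed_INT closed_Collect_eq continuous_on_l2_fun continuous_intros)
qed

text \<open>Rewrites both least squares objectives as squared distances, so that their minimisers
  become metric projections.\<close>

lemma infsum_diff_square_eq_dist:
  assumes "(\<lambda>x. (\<theta> x)\<^sup>2) summable_on A" and "f \<in> l2_on A"
  shows "(\<Sum>\<^sub>\<infinity>x\<in>A. (l2_fun f x - \<theta> x)\<^sup>2) = (dist (to_l2 A \<theta>) f)\<^sup>2"
proof -
  have "(dist (to_l2 A \<theta>) f)\<^sup>2 = (\<Sum>\<^sub>\<infinity>x\<in>A. (l2_fun f x - \<theta> x)\<^sup>2)"
    unfolding dist_norm norm_l2_square l2_fun_diff l2_fun_to_l2[OF assms(1)]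
    by (rule infsum_cong_neutral) (use assms(2) in \<open>auto simp: l2_on_def power2_commute\<close>)
  then show ?thesis by simp
qed

text \<open>A sequence of finite sets instead of the net of all finite sets, so that sequential
  tools such as dominated convergence apply.\<close>

definition initial_part :: "nat \<Rightarrow> 'a::countable set"
  where "initial_part k = {x. to_nat x < k}"

lemma finite_initial_part [simp]: "finite (initial_part k)"
proof -
  have "finite (to_nat -` {..<k} :: 'a set)"
    by (rule finite_vimageI) auto
  then show ?thesis
    by (auto simp: initial_part_def vimage_def lessThan_def)
qed

lemma finite_subset_initial_part:
  assumes "finite D"
  shows "eventually (\<lambda>k. D \<subseteq> initial_part k) sequentially"
proof -
  obtain m where "\<And>x. x \<in> D \<Longrightarrow> to_nat x < m"
    using finite_nat_set_iff_bounded[of "to_nat ` D"] assms by auto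
  then show ?thesis
    by (intro eventually_sequentiallyI[of m]) (force simp: initial_part_def)
qed

lemma tendsto_l2_restrict_initial_part:
  fixes f :: "'a::countable l2"
  shows "(\<lambda>k. l2_restrict (initial_part k) f) \<longlonglongrightarrow> f"
proof (rule tendstoI)
  fix e :: real assume "0 < e"
  from l2_restrict_approx[OF this, of f] obtain D
    where "finite D" and D: "\<And>A. D \<subseteq> A \<Longrightarrow> norm (f - l2_restrict A f) < e"
    by blast
  from finite_subset_initial_part[OF \<open>finite D\<close>]
  show "eventually (\<lambda>k. dist (l2_restrict (initial_part k) f) f < e) sequentially"
    by eventually_elim (use D in \<open>auto simp: dist_norm norm_minus_commute\<close>)
qed

text \<open>Finite rational combinations of basis vectors are dense, and the balls of radius
  \<open>1 / Suc n\<close> around them form a base. The instance makes sums and inner products of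
  measurable \<open>l2\<close>-valued maps measurable.\<close>

instance l2 :: (countable) second_countable_topology
proof
  define c :: "('a \<times> rat) list \<Rightarrow> 'a l2"
    where "c = (\<lambda>xs. \<Sum>(x, q)\<leftarrow>xs. of_rat q *\<^sub>R l2_basis x)"
  have dense: "\<exists>xs. dist (c xs) f < e" if e: "0 < e" for f e
  proof -
    obtain D where "finite D" and D: "norm (f - l2_restrict D f) < e / 2"
      using l2_restrict_approx[of "e/2" f] e by auto
    \<comment> \<open>The summand 1 keeps \<open>d\<close> positive for empty \<open>D\<close> and
      makes \<open>card D * d\<close> strictly smaller than \<open>e / 2\<close>.\<close>
    define d where "d = e / (2 * (card D + 1))"
    have d: "0 < d" "card D * d < e / 2"
      using e by (auto simp: d_def field_simps)
    have "\<exists>q. \<bar>l2_fun f x - of_rat q\<bar> < d" for x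
      using of_rat_dense[of "l2_fun f x - d" "l2_fun f x + d"] d(1)
      by (auto simp: abs_less_iff) (smt (verit))
    then obtain q where q: "\<And>x. \<bar>l2_fun f x - of_rat (q x)\<bar> < d"
      by metis
    obtain ys where ys: "set ys = D" "distinct ys"
      using finite_distinct_list[OF \<open>finite D\<close>] by blast
    define xs where "xs = map (\<lambda>x. (x, q x)) ys"
    have c: "c xs = (\<Sum>x\<in>D. of_rat (q x) *\<^sub>R l2_basis x)"
      unfolding c_def xs_def map_map o_def split using ys
      by (simp add: sum_list_distinct_conv_sum_set)
    have "norm (l2_restrict D f - c xs)
        = norm (\<Sum>x\<in>D. (l2_fun f x - of_rat (q x)) *\<^sub>R (l2_basis x :: 'a l2))"
      unfolding c l2_restrict_eq_sum[OF \<open>finite D\<close>]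
      by (simp add: sum_subtractf scaleR_left_diff_distrib)
    also have "\<dots> \<le> (\<Sum>x\<in>D. d)"
      by (rule sum_norm_le) (use q in \<open>auto intro: less_imp_le\<close>)
    also have "\<dots> < e / 2"
      using d(2) by simp
    finally have "norm (f - c xs) < e"
      using D norm_triangle_ineq[of "f - l2_restrict D f" "l2_restrict D f - c xs"] by simp
    then show ?thesis
      by (auto simp: dist_norm norm_minus_commute)
  qed
  define B where "B = (\<lambda>(xs, n). ball (c xs) (1 / real (Suc n))) ` UNIV"
  have "topological_basis B"
  proof (rule topological_basisI)
    fix U :: "'a l2 set" and f assume "open U" "f \<in> U"
    then obtain e where e: "0 < e" "ball f e \<subseteq> U"
      using open_contains_ball by blast
    obtain n where n: "1 / real (Suc n) < e / 2"
      using nat_approx_posE[of "e/2"] e(1) by auto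
    obtain xs where xs: "dist (c xs) f < 1 / real (Suc n)"
      using dense[of "1 / real (Suc n)" f] by auto
    have "ball (c xs) (1 / real (Suc n)) \<subseteq> U"
    proof
      fix g assume "g \<in> ball (c xs) (1 / real (Suc n))"
      then have "dist f g < e"
        using xs n dist_triangle[of f g "c xs"] by (auto simp: dist_commute)
      then show "g \<in> U" using e(2) by auto
    qed
    moreover have "ball (c xs) (1 / real (Suc n)) \<in> B"
      unfolding B_def by (rule image_eqI[of _ _ "(xs, n)"]) auto
    ultimately show "\<exists>B'\<in>B. f \<in> B' \<and> B' \<subseteq> U"
      using xs by (intro bexI[of _ "ball (c xs) (1 / real (Suc n))"]) auto
  qed (auto simp: B_def)
  then show "\<exists>B::'a l2 set set. countable B \<and> open = generate_topology B"
    using topological_basis_imp_subbasis by (intro exI[of _ B]) (auto simp: B_def)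
qed

section \<open>Borel measurability and compact cubes in the sequence space\<close>

lemma measurable_l2_fun [measurable]: "(\<lambda>f. l2_fun f x) \<in> borel_measurable borel"
  by (intro borel_measurable_continuous_onI continuous_on_l2_fun continuous_on_id)

lemma measurable_l2_restrict [measurable]:
  "l2_restrict A \<in> measurable borel borel"
  by (intro borel_measurable_continuous_onI linear_continuous_on bounded_linear_l2_restrict)

text \<open>\<open>X\<close> is the pointwise limit of its restrictions to the finite initial parts,
  and these are finite sums of measurable coordinates.\<close>

lemma measurable_l2I:
  fixes X :: "'w \<Rightarrow> 'a::countable l2"
  assumes [measurable]: "\<And>x. (\<lambda>\<omega>. l2_fun (X \<omega>) x) \<in> borel_measurable M"
  shows "X \<in> borel_measurable M"
proof (rule borel_measurable_LIMSEQ_metric)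
  show "(\<lambda>\<omega>. l2_restrict (initial_part k) (X \<omega>)) \<in> borel_measurable M" for k
    by (simp add: l2_restrict_eq_sum)
  show "(\<lambda>k. l2_restrict (initial_part k) (X \<omega>)) \<longlonglongrightarrow> X \<omega>" for \<omega>
    by (rule tendsto_l2_restrict_initial_part)
qed

text \<open>The compact set for Stone--Weierstrass. Closed bounded sets of \<open>l2\<close> are not
  compact in general, so the cube is built one coordinate at a time as a continuous image of an
  interval times a smaller cube.\<close>

lemma compact_l2_cube:
  assumes "finite D"
  shows "compact {f \<in> l2_on D. \<forall>x. \<bar>l2_fun f x\<bar> \<le> 1}"
  using assms
proof induction
  case empty
  have "{f \<in> l2_on {}. \<forall>x. \<bar>l2_fun f x\<bar> \<le> 1} = {0 :: 'a l2}"
    by (auto simp: l2_on_def intro!: l2_eqI)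
  then show ?case by simp
next
  case (insert a D)
  let ?S = "{f \<in> l2_on D. \<forall>x. \<bar>l2_fun f x\<bar> \<le> 1}"
  have "{f \<in> l2_on (insert a D). \<forall>x. \<bar>l2_fun f x\<bar> \<le> 1}
      = (\<lambda>(c, f). c *\<^sub>R l2_basis a + f) ` ({-1..1} \<times> ?S)" (is "?L = ?R")
  proof
    show "?L \<subseteq> ?R"
    proof
      fix f assume f: "f \<in> ?L"
      show "f \<in> ?R"
      proof (rule image_eqI[of _ _ "(l2_fun f a, l2_restrict D f)"])
        have "l2_fun f x = 0" if "x \<notin> insert a D" for x
          using f that by (auto simp: l2_on_def)
        then have "l2_fun f x = l2_fun (l2_fun f a *\<^sub>R l2_basis a + l2_restrict D f) x" for x
          using insert.hyps by (cases "x = a"; cases "x \<in> D") auto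
        then show "f = (case (l2_fun f a, l2_restrict D f) of (c, f) \<Rightarrow> c *\<^sub>R l2_basis a + f)"
          by (simp add: l2_eqI)
        have "\<bar>l2_fun f a\<bar> \<le> 1" "\<forall>x. \<bar>l2_fun f x\<bar> \<le> 1"
          using f by auto
        then show "(l2_fun f a, l2_restrict D f) \<in> {-1..1} \<times> ?S"
          by (simp add: l2_restrict_in_l2_on abs_le_iff)
      qed
    qed
    show "?R \<subseteq> ?L"
    proof
      fix g assume "g \<in> ?R"
      then obtain c f where g: "g = c *\<^sub>R l2_basis a + f" and c: "\<bar>c\<bar> \<le> 1"
        and f: "\<And>x. x \<notin> D \<Longrightarrow> l2_fun f x = 0" "\<And>x. \<bar>l2_fun f x\<bar> \<le> 1"
        by (auto simp: l2_on_def abs_le_iff)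
      show "g \<in> ?L"
        using insert.hyps f c by (auto simp: g l2_on_def)
    qed
  qed
  moreover have "compact ?R"
    by (intro compact_continuous_image compact_Times insert.IH)
      (auto intro!: continuous_intros simp: split_beta)
  ultimately show ?case by simp
qed

section \<open>Projections onto closed convex sets\<close>

definition proj_on :: "'v::real_inner set \<Rightarrow> 'v \<Rightarrow> 'v"
  where "proj_on S a = (SOME x. x \<in> S \<and> (\<forall>y\<in>S. dist a x \<le> dist a y))"

lemma ex_closest_point_complete:
  fixes S :: "'v::{real_inner, complete_space} set"
  assumes "convex S" "closed S" "S \<noteq> {}"
  shows "\<exists>x\<in>S. \<forall>y\<in>S. dist a x \<le> dist a y"
proof -
  define d where "d = (INF y\<in>S. dist a y)"
  have bdd: "bdd_below (dist a ` S)"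
    by (intro bdd_belowI[of _ 0]) auto
  have d: "d \<le> dist a y" if "y \<in> S" for y
    unfolding d_def by (rule cINF_lower[OF bdd that])
  have "0 \<le> d"
    unfolding d_def by (rule cINF_greatest) (use assms in auto)
  have "\<exists>y\<in>S. dist a y < d + 1 / real (Suc n)" for n
    using cINF_less_iff[OF assms(3) bdd, of "d + 1 / real (Suc n)"] by (simp add: d_def)
  then obtain y where y: "\<And>n. y n \<in> S" "\<And>n. dist a (y n) < d + 1 / real (Suc n)"
    by metis
  \<comment> \<open>The parallelogram law around \<open>a\<close>, where the midpoint of
    \<open>u\<close> and \<open>v\<close> lies in \<open>S\<close> by convexity and so has distance
    at least \<open>d\<close>.\<close>
  have gap: "(dist u v)\<^sup>2 \<le> 2 * ((dist a u)\<^sup>2 - d\<^sup>2) + 2 * ((dist a v)\<^sup>2 - d\<^sup>2)"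
    if "u \<in> S" "v \<in> S" for u v
  proof -
    have "(1/2) *\<^sub>R u + (1/2) *\<^sub>R v \<in> S"
      by (rule convexD[OF assms(1) that]) auto
    then have "d\<^sup>2 \<le> (dist a ((1/2) *\<^sub>R u + (1/2) *\<^sub>R v))\<^sup>2"
      using \<open>0 \<le> d\<close> by (intro power_mono d)
    moreover have "(dist u v)\<^sup>2 = 2 * (dist a u)\<^sup>2 + 2 * (dist a v)\<^sup>2
        - 4 * (dist a ((1/2) *\<^sub>R u + (1/2) *\<^sub>R v))\<^sup>2"
      unfolding dist_norm power2_norm_eq_inner
      by (simp add: algebra_simps inner_commute)
    ultimately show ?thesis by simp
  qed
  have "(\<lambda>n. d + 1 / real (Suc n)) \<longlonglongrightarrow> d + 0"
    by (intro tendsto_intros LIMSEQ_inverse_real_of_nat[unfolded inverse_eq_divide])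
  then have lim: "(\<lambda>n. d + 1 / real (Suc n)) \<longlonglongrightarrow> d"
    by simp
  have da: "(\<lambda>n. dist a (y n)) \<longlonglongrightarrow> d"
    by (rule tendsto_sandwich[OF _ _ tendsto_const lim])
      (use d[OF y(1)] y(2) in \<open>auto intro!: always_eventually intro: less_imp_le\<close>)
  have "Cauchy y"
  proof (rule metric_CauchyI)
    fix e :: real assume e: "0 < e"
    have "(\<lambda>n. 2 * ((dist a (y n))\<^sup>2 - d\<^sup>2)) \<longlonglongrightarrow> 2 * (d\<^sup>2 - d\<^sup>2)"
      by (intro tendsto_intros da)
    then have "eventually (\<lambda>n. 2 * ((dist a (y n))\<^sup>2 - d\<^sup>2) < e\<^sup>2 / 2) sequentially"
      using e by (intro order_tendstoD) auto
    then obtain N where N: "\<And>n. n \<ge> N \<Longrightarrow> 2 * ((dist a (y n))\<^sup>2 - d\<^sup>2) < e\<^sup>2 / 2"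
      unfolding eventually_sequentially by blast
    have "dist (y m) (y n) < e" if "m \<ge> N" "n \<ge> N" for m n
    proof -
      have "(dist (y m) (y n))\<^sup>2 < e\<^sup>2"
        using gap[OF y(1) y(1), of m n] N[OF that(1)] N[OF that(2)] by simp
      then show ?thesis using e by (simp add: power2_less_imp_less)
    qed
    then show "\<exists>N. \<forall>m\<ge>N. \<forall>n\<ge>N. dist (y m) (y n) < e" by blast
  qed
  then obtain x where x: "y \<longlonglongrightarrow> x"
    using Cauchy_convergent convergent_def by blast
  have "x \<in> S"
    using closed_sequentially[OF assms(2)] y(1) x by blast
  moreover have "dist a x = d"
    using LIMSEQ_unique[OF tendsto_dist[OF tendsto_const x] da] .
  ultimately show ?thesis using d by auto
qed

context
  fixes S :: "'v::{real_inner, complete_space} set"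
  assumes S: "convex S" "closed S" "S \<noteq> {}"
begin

lemma proj_on_in: "proj_on S a \<in> S"
  and dist_proj_on_le: "y \<in> S \<Longrightarrow> dist a (proj_on S a) \<le> dist a y"
  unfolding proj_on_def
  using someI_ex[of "\<lambda>x. x \<in> S \<and> (\<forall>y\<in>S. dist a x \<le> dist a y)"]
    ex_closest_point_complete[OF S, of a]
  by blast+

lemma proj_on_eqI: "x \<in> S \<Longrightarrow> (\<And>y. y \<in> S \<Longrightarrow> dist a x \<le> dist a y) \<Longrightarrow> proj_on S a = x"
  by (rule any_closest_point_unique[OF S(1,2), of _ _ a])
    (auto simp: proj_on_in dist_proj_on_le)

lemma proj_on_dot: "y \<in> S \<Longrightarrow> (a - proj_on S a) \<bullet> (y - proj_on S a) \<le> 0"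
  by (rule any_closest_point_dot[OF S(1,2)]) (auto simp: proj_on_in dist_proj_on_le)

text \<open>The angle at the projection is obtuse, so Pythagoras holds as an inequality. It turns
  near-minimality of a distance into closeness to the projection.\<close>

lemma dist_proj_on_square_le:
  assumes "y \<in> S"
  shows "(dist y (proj_on S a))\<^sup>2 \<le> (dist a y)\<^sup>2 - (dist a (proj_on S a))\<^sup>2"
  using proj_on_dot[OF assms, of a] unfolding dist_norm power2_norm_eq_inner
  by (simp add: algebra_simps inner_commute)

text \<open>Each projection is tested in the variational inequality of the other; adding the two and
  applying Cauchy--Schwarz gives the bound.\<close>

lemma proj_on_lipschitz: "dist (proj_on S a) (proj_on S b) \<le> dist a b"
proof -
  define u where "u = proj_on S a - proj_on S b"
  have "(a - proj_on S a) \<bullet> u \<ge> 0" "(b - proj_on S b) \<bullet> u \<le> 0"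
    using proj_on_dot[OF proj_on_in, of a b] proj_on_dot[OF proj_on_in, of b a]
    by (auto simp: u_def algebra_simps)
  then have "u \<bullet> u \<le> (a - b) \<bullet> u"
    by (simp add: u_def algebra_simps)
  also have "\<dots> \<le> norm (a - b) * norm u"
    by (rule norm_cauchy_schwarz)
  finally have "norm u * norm u \<le> norm (a - b) * norm u"
    by (simp flip: power2_norm_eq_inner add: power2_eq_square)
  then show ?thesis
    by (cases "u = 0") (auto simp: dist_norm u_def mult_le_cancel_right)
qed

text \<open>\<open>arg_min_on\<close> is a choice operator, so minimality alone does not identify
  its value; uniqueness of the closest point does.\<close>

lemma arg_min_on_eq_proj_on:
  assumes "\<And>f. f \<in> S \<Longrightarrow> F f = (dist a f)\<^sup>2"
  shows "arg_min_on F S = proj_on S a"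
proof -
  have "is_arg_min F (\<lambda>x. x \<in> S) x \<longleftrightarrow> x = proj_on S a" for x
  proof
    assume x: "is_arg_min F (\<lambda>x. x \<in> S) x"
    then have "dist a x \<le> dist a y" if "y \<in> S" for y
      using that assms by (force simp: is_arg_min_def not_less intro: power2_le_imp_le)
    then show "x = proj_on S a"
      using x proj_on_eqI[of x a] by (auto simp: is_arg_min_def)
  next
    assume x: "x = proj_on S a"
    have "F x \<le> F y" if "y \<in> S" for y
      using dist_proj_on_le[OF that, of a] assms[OF that] assms[OF proj_on_in, of a]
      by (simp add: x power_mono)
    then show "is_arg_min F (\<lambda>x. x \<in> S) x"
      by (auto simp: is_arg_min_def x proj_on_in not_less)
  qed
  then show ?thesis
    by (simp add: arg_min_on_def arg_min_def)
qed

end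

section \<open>Weak convergence tested on bounded Lipschitz functions\<close>

text \<open>Test functions live on the whole space and form a class that is stable, with the same
  constant, under composition with 1-Lipschitz projections.\<close>

definition weak_conv_lipschitz ::
    "'w measure \<Rightarrow> (nat \<Rightarrow> 'w \<Rightarrow> 'v::metric_space) \<Rightarrow> 'b measure \<Rightarrow> ('b \<Rightarrow> 'v) \<Rightarrow> bool"
  where "weak_conv_lipschitz M X N Y \<longleftrightarrow>
    (\<forall>(f :: 'v \<Rightarrow> real) L. L-lipschitz_on UNIV f \<and> bounded (range f) \<longrightarrow>
      (\<lambda>n. \<integral>\<omega>. f (X n \<omega>) \<partial>M) \<longlonglongrightarrow> (\<integral>\<omega>. f (Y \<omega>) \<partial>N))"

lemma lipschitz_on_imp_borel_measurable:
  "L-lipschitz_on UNIV f \<Longrightarrow> f \<in> borel_measurable borel"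
  by (intro borel_measurable_continuous_onI lipschitz_on_continuous_on)

lemma lipschitz_onI_real:
  fixes f :: "'v::metric_space \<Rightarrow> real"
  assumes "\<And>x y. f x \<le> f y + L * dist x y" and "0 \<le> L"
  shows "L-lipschitz_on UNIV f"
proof (rule lipschitz_onI)
  fix x y
  show "dist (f x) (f y) \<le> L * dist x y"
    using assms(1)[of x y] assms(1)[of y x] by (auto simp: dist_real_def dist_commute)
qed fact

lemma lipschitz_on_realD:
  fixes f :: "'v::metric_space \<Rightarrow> real"
  assumes "L-lipschitz_on UNIV f"
  shows "\<bar>f x - f y\<bar> \<le> L * dist x y"
  using lipschitz_onD[OF assms, of x y] by (simp add: dist_real_def)

section \<open>Lipschitz envelopes of a bounded continuous function on \<open>S\<close>\<close>

context
  fixes S :: "'v::metric_space set" and f :: "'v \<Rightarrow> real" and B :: real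
  assumes ne: "S \<noteq> {}" and cont: "continuous_on S f" and B: "\<And>x. x \<in> S \<Longrightarrow> \<bar>f x\<bar> \<le> B"
begin

text \<open>The infimal convolution of \<open>f\<close> with \<open>k\<close> times the distance, a
  standard Lipschitz minorant; the cap at \<open>B\<close> keeps it bounded far away from
  \<open>S\<close>.\<close>

definition lower_lipschitz :: "nat \<Rightarrow> 'v \<Rightarrow> real"
  where "lower_lipschitz k x = min B (INF y\<in>S. f y + real k * dist x y)"

lemma lower_lipschitz_bdd: "bdd_below ((\<lambda>y. f y + real k * dist x y) ` S)"
proof (rule bdd_belowI2)
  fix y assume "y \<in> S"
  then show "- B \<le> f y + real k * dist x y"
    using B[of y] by (smt (verit) mult_nonneg_nonneg of_nat_0_le_iff zero_le_dist)
qed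

lemma lower_lipschitz_abs_le: "\<bar>lower_lipschitz k x\<bar> \<le> B"
proof -
  have "- B \<le> (INF y\<in>S. f y + real k * dist x y)"
  proof (rule cINF_greatest[OF ne])
    fix y assume "y \<in> S"
    then show "- B \<le> f y + real k * dist x y"
      using B[of y] by (smt (verit) mult_nonneg_nonneg of_nat_0_le_iff zero_le_dist)
  qed
  moreover have "0 \<le> B"
    using B ne by force
  ultimately show ?thesis
    by (auto simp: lower_lipschitz_def)
qed

lemma lower_lipschitz_le: "x \<in> S \<Longrightarrow> lower_lipschitz k x \<le> f x"
  using cINF_lower[OF lower_lipschitz_bdd, of x k x] by (auto simp: lower_lipschitz_def)

lemma lower_lipschitz_lipschitz: "(real k)-lipschitz_on UNIV (lower_lipschitz k)"
proof (rule lipschitz_onI_real)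
  fix x y
  have "(INF z\<in>S. f z + real k * dist x z) - real k * dist x y \<le> (INF z\<in>S. f z + real k * dist y z)"
  proof (rule cINF_greatest[OF ne])
    fix z assume "z \<in> S"
    then have "(INF z\<in>S. f z + real k * dist x z) \<le> f z + real k * dist x z"
      by (rule cINF_lower[OF lower_lipschitz_bdd])
    also have "\<dots> \<le> f z + real k * (dist x y + dist y z)"
      by (intro add_left_mono mult_left_mono dist_triangle) auto
    finally show "(INF z\<in>S. f z + real k * dist x z) - real k * dist x y \<le> f z + real k * dist y z"
      by (simp add: algebra_simps)
  qed
  moreover have "0 \<le> real k * dist x y" by simp
  ultimately show "lower_lipschitz k x \<le> lower_lipschitz k y + real k * dist x y"
    unfolding lower_lipschitz_def by linarith
qed simp

lemma lower_lipschitz_tendsto: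
  assumes x: "x \<in> S"
  shows "(\<lambda>k. lower_lipschitz k x) \<longlonglongrightarrow> f x"
proof (rule LIMSEQ_I)
  fix e :: real assume e: "0 < e"
  obtain d where d: "0 < d" "\<And>y. y \<in> S \<Longrightarrow> dist y x < d \<Longrightarrow> dist (f y) (f x) < e / 2"
    using cont x e unfolding continuous_on_iff by (meson half_gt_zero)
  \<comment> \<open>From this slope on, moving by \<open>d\<close> costs at least
    \<open>2 * B\<close>, the largest possible oscillation of \<open>f\<close>, so only points near
    \<open>x\<close> can lower the infimum.\<close>
  obtain K :: nat where K: "2 * B / d \<le> K"
    using real_arch_simple by blast
  have "norm (lower_lipschitz k x - f x) < e" if k: "K \<le> k" for k
  proof -
    have "f x - e / 2 \<le> (INF y\<in>S. f y + real k * dist x y)"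
    proof (rule cINF_greatest[OF ne])
      fix y assume y: "y \<in> S"
      show "f x - e / 2 \<le> f y + real k * dist x y"
      proof (cases "dist y x < d")
        case True
        then have "f x - e / 2 \<le> f y"
          using d(2)[OF y True] unfolding dist_real_def by linarith
        also have "f y \<le> f y + real k * dist x y" by simp
        finally show ?thesis .
      next
        case False
        have "2 * B / d \<le> real k"
          using K k by linarith
        then have "2 * B \<le> real k * d"
          using d(1) by (simp add: field_simps)
        also have "\<dots> \<le> real k * dist x y"
          using False by (intro mult_left_mono) (auto simp: dist_commute)
        finally show ?thesis
          using B[OF x] B[OF y] e by linarith
      qed
    qed
    then show ?thesis
      using lower_lipschitz_le[OF x, of k] B[OF x] e by (auto simp: lower_lipschitz_def)
  qed
  then show "\<exists>K. \<forall>k\<ge>K. norm (lower_lipschitz k x - f x) < e" by blast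
qed

end

text \<open>One half of a portmanteau theorem: \<open>f\<close> is replaced by a Lipschitz minorant
  whose expectation under the limit is within \<open>e\<close>. Using it for \<open>f\<close> and
  for \<open>- f\<close> yields convergence.\<close>

lemma liminf_weak_conv_lipschitz:
  fixes S :: "'v::metric_space set" and f :: "'v \<Rightarrow> real"
  assumes M: "prob_space M" and N: "prob_space N"
    and X: "\<And>n. X n \<in> measurable M (restrict_space borel S)"
    and Y: "Y \<in> measurable N (restrict_space borel S)"
    and conv: "weak_conv_lipschitz M X N Y"
    and f: "continuous_on S f" "\<And>x. x \<in> S \<Longrightarrow> \<bar>f x\<bar> \<le> B" and e: "0 < e"
  shows "eventually (\<lambda>n. (\<integral>\<omega>. f (Y \<omega>) \<partial>N) - e < (\<integral>\<omega>. f (X n \<omega>) \<partial>M)) sequentially"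
proof -
  interpret M: prob_space M by fact
  interpret N: prob_space N by fact
  have XS: "X n \<omega> \<in> S" if "\<omega> \<in> space M" for n \<omega>
    using measurable_space[OF X that] by (simp add: space_restrict_space)
  have YS: "Y \<omega> \<in> S" if "\<omega> \<in> space N" for \<omega>
    using measurable_space[OF Y that] by (simp add: space_restrict_space)
  have ne: "S \<noteq> {}"
    using N.not_empty YS by auto
  have fm: "f \<in> borel_measurable (restrict_space borel S)"
    by (rule borel_measurable_continuous_on_restrict[OF f(1)])
  have fX: "(\<lambda>\<omega>. f (X n \<omega>)) \<in> borel_measurable M" for n
    by (rule measurable_compose[OF X fm])
  have fY: "(\<lambda>\<omega>. f (Y \<omega>)) \<in> borel_measurable N"
    by (rule measurable_compose[OF Y fm])
  define l where "l = lower_lipschitz S f B"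
  have l: "(real k)-lipschitz_on UNIV (l k)" "\<bar>l k x\<bar> \<le> B" for k x
    unfolding l_def
    using lower_lipschitz_lipschitz[OF ne f] lower_lipschitz_abs_le[OF ne f] by auto
  have lm: "l k \<in> borel_measurable borel" for k
    by (rule lipschitz_on_imp_borel_measurable[OF l(1)])
  have Xb: "X n \<in> borel_measurable M" and Yb: "Y \<in> borel_measurable N" for n
    using X Y by (auto simp: measurable_restrict_space2_iff)
  have lX: "(\<lambda>\<omega>. l k (X n \<omega>)) \<in> borel_measurable M"
    and lY: "(\<lambda>\<omega>. l k (Y \<omega>)) \<in> borel_measurable N" for n k
    using Xb Yb lm by (auto intro: measurable_compose)
  have "(\<lambda>k. \<integral>\<omega>. l k (Y \<omega>) \<partial>N) \<longlonglongrightarrow> (\<integral>\<omega>. f (Y \<omega>) \<partial>N)"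
  proof (rule integral_dominated_convergence[where w = "\<lambda>_. B"])
    show "AE \<omega> in N. (\<lambda>k. l k (Y \<omega>)) \<longlonglongrightarrow> f (Y \<omega>)"
      by (rule AE_I2) (use YS in \<open>auto simp: l_def intro!: lower_lipschitz_tendsto[OF ne f]\<close>)
  qed (use fY lY l(2) in auto)
  then have "eventually (\<lambda>k. (\<integral>\<omega>. f (Y \<omega>) \<partial>N) - e < (\<integral>\<omega>. l k (Y \<omega>) \<partial>N)) sequentially"
    using e by (intro order_tendstoD) auto
  then obtain k where k: "(\<integral>\<omega>. f (Y \<omega>) \<partial>N) - e < (\<integral>\<omega>. l k (Y \<omega>) \<partial>N)"
    unfolding eventually_sequentially by blast
  have "bounded (range (l k))"
    by (rule boundedI[of _ B]) (use l(2) in auto)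
  then have "(\<lambda>n. \<integral>\<omega>. l k (X n \<omega>) \<partial>M) \<longlonglongrightarrow> (\<integral>\<omega>. l k (Y \<omega>) \<partial>N)"
    using conv l(1) unfolding weak_conv_lipschitz_def by blast
  then have "eventually (\<lambda>n. (\<integral>\<omega>. f (Y \<omega>) \<partial>N) - e < (\<integral>\<omega>. l k (X n \<omega>) \<partial>M)) sequentially"
    using k by (rule order_tendstoD)
  moreover have "(\<integral>\<omega>. l k (X n \<omega>) \<partial>M) \<le> (\<integral>\<omega>. f (X n \<omega>) \<partial>M)" for n
  proof (rule integral_mono)
    show "integrable M (\<lambda>\<omega>. l k (X n \<omega>))"
      by (rule M.integrable_const_bound[of _ B]) (use l lX in auto)
    show "integrable M (\<lambda>\<omega>. f (X n \<omega>))"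
      by (rule M.integrable_const_bound[of _ B]) (use f(2) XS fX in auto)
    show "l k (X n \<omega>) \<le> f (X n \<omega>)" if "\<omega> \<in> space M" for \<omega>
      using lower_lipschitz_le[OF ne f] XS[OF that] by (auto simp: l_def)
  qed
  ultimately show ?thesis
    by (auto elim!: eventually_mono intro: less_le_trans)
qed

lemma converges_in_distributionI:
  fixes S :: "'v::metric_space set"
  assumes "prob_space M" "prob_space N"
    and X: "\<And>n. X n \<in> measurable M (restrict_space borel S)"
    and Y: "Y \<in> measurable N (restrict_space borel S)"
    and conv: "weak_conv_lipschitz M X N Y"
  shows "converges_in_distribution S M X N Y"
  unfolding converges_in_distribution_def
proof (intro conjI allI impI X Y)
  fix f :: "'v \<Rightarrow> real" assume f: "continuous_on S f \<and> bounded (f ` S)"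
  then obtain B where B: "\<And>x. x \<in> S \<Longrightarrow> \<bar>f x\<bar> \<le> B"
    by (auto simp: bounded_iff)
  note * = liminf_weak_conv_lipschitz[OF assms]
  show "(\<lambda>n. \<integral>\<omega>. f (X n \<omega>) \<partial>M) \<longlonglongrightarrow> (\<integral>\<omega>. f (Y \<omega>) \<partial>N)"
  proof (rule tendstoI)
    fix e :: real assume e: "0 < e"
    have "eventually (\<lambda>n. (\<integral>\<omega>. f (Y \<omega>) \<partial>N) - e < (\<integral>\<omega>. f (X n \<omega>) \<partial>M)) sequentially"
      by (rule *) (use f B e in auto)
    moreover have "eventually (\<lambda>n. (\<integral>\<omega>. - f (Y \<omega>) \<partial>N) - e < (\<integral>\<omega>. - f (X n \<omega>) \<partial>M)) sequentially"
      by (rule *) (use f B e in \<open>auto intro: continuous_intros\<close>)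
    ultimately show "eventually (\<lambda>n. dist (\<integral>\<omega>. f (X n \<omega>) \<partial>M) (\<integral>\<omega>. f (Y \<omega>) \<partial>N) < e) sequentially"
      by eventually_elim (simp add: dist_real_def abs_less_iff)
  qed
qed

text \<open>A continuous mapping theorem with varying maps. The tail supremum \<open>u m\<close> of
  the error between \<open>g n\<close> and \<open>h\<close> is bounded, Lipschitz and tends to 0
  pointwise. Dominated convergence makes its expectation under \<open>Y\<close> small, and as a test
  function it transfers this to \<open>X n\<close>, without any tightness argument.\<close>

lemma weak_conv_lipschitz_map:
  fixes g :: "nat \<Rightarrow> 'v::metric_space \<Rightarrow> 'u::metric_space"
  assumes M: "prob_space M" and N: "prob_space N"
    and X [measurable]: "\<And>n. X n \<in> borel_measurable M" and Y [measurable]: "Y \<in> borel_measurable N"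
    and conv: "weak_conv_lipschitz M X N Y"
    and g: "\<And>n x y. dist (g n x) (g n y) \<le> dist x y"
    and lim: "\<And>x. (\<lambda>n. g n x) \<longlonglongrightarrow> h x"
  shows "weak_conv_lipschitz M (\<lambda>n \<omega>. g n (X n \<omega>)) N (\<lambda>\<omega>. h (Y \<omega>))"
  unfolding weak_conv_lipschitz_def
proof (intro allI impI)
  interpret M: prob_space M by fact
  interpret N: prob_space N by fact
  fix f :: "'u \<Rightarrow> real" and L
  assume "L-lipschitz_on UNIV f \<and> bounded (range f)"
  then obtain B where f: "L-lipschitz_on UNIV f" and B: "\<And>x. \<bar>f x\<bar> \<le> B"
    by (auto simp: bounded_iff)
  have L: "0 \<le> L"
    using f by (rule lipschitz_on_nonneg)
  have h: "dist (h x) (h y) \<le> dist x y" for x y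
    by (rule LIMSEQ_le_const2[OF tendsto_dist[OF lim lim]]) (use g in auto)
  have fg: "\<bar>f (g n x) - f (g n y)\<bar> \<le> L * dist x y" for n x y
    by (rule order_trans[OF lipschitz_on_realD[OF f]]) (intro mult_left_mono g L)
  have fh: "\<bar>f (h x) - f (h y)\<bar> \<le> L * dist x y" for x y
    by (rule order_trans[OF lipschitz_on_realD[OF f]]) (intro mult_left_mono h L)
  have lip_fg: "L-lipschitz_on UNIV (\<lambda>x. f (g n x))" for n
    by (rule lipschitz_onI) (use fg L in \<open>auto simp: dist_real_def\<close>)
  have lip_fh: "L-lipschitz_on UNIV (\<lambda>x. f (h x))"
    by (rule lipschitz_onI) (use fh L in \<open>auto simp: dist_real_def\<close>)
  note [measurable] = lip_fg[THEN lipschitz_on_imp_borel_measurable]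
    lip_fh[THEN lipschitz_on_imp_borel_measurable]
  define D where "D = (\<lambda>n x. \<bar>f (g n x) - f (h x)\<bar>)"
  define u where "u = (\<lambda>m x. SUP n\<in>{m..}. D n x)"
  have D: "0 \<le> D n x" "D n x \<le> 2 * B" "D n x \<le> D n y + (2 * L) * dist x y" for n x y
    using B[of "g n x"] B[of "h x"] fg[of n x y] fh[of x y] by (auto simp: D_def)
  have bdd: "bdd_above ((\<lambda>n. D n x) ` {m..})" for m :: nat and x
    by (rule bdd_aboveI2[of _ _ "2 * B"]) (rule D)
  have Du: "D n x \<le> u m x" if "m \<le> n" for m n x
    unfolding u_def by (rule cSUP_upper[OF _ bdd]) (use that in auto)
  have u: "0 \<le> u m x" "u m x \<le> 2 * B" for m x
    using Du[of m m x] D[of m x] by (auto simp: u_def intro!: cSUP_least D)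
  have lip_u: "(2 * L)-lipschitz_on UNIV (u m)" for m
  proof (rule lipschitz_onI_real)
    fix x y
    show "u m x \<le> u m y + 2 * L * dist x y"
      unfolding u_def[THEN fun_cong, THEN fun_cong, of m x]
    proof (rule cSUP_least)
      fix n assume "n \<in> {m..}"
      then show "D n x \<le> u m y + 2 * L * dist x y"
        using D(3)[of n x y] Du[of m n y] by auto
    qed auto
  qed (use L in auto)
  note [measurable] = lip_u[THEN lipschitz_on_imp_borel_measurable]
  have u_lim: "(\<lambda>m. u m x) \<longlonglongrightarrow> 0" for x
  proof (rule LIMSEQ_I)
    fix e :: real assume e: "0 < e"
    have "isCont f (h x)"
      using lipschitz_on_continuous_on[OF f] by (simp add: continuous_on_eq_continuous_at)
    then have "(\<lambda>n. f (g n x)) \<longlonglongrightarrow> f (h x)"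
      by (rule isCont_tendsto_compose[OF _ lim])
    then obtain K where K: "\<And>n. n \<ge> K \<Longrightarrow> D n x < e / 2"
      using LIMSEQ_D[of _ _ "e/2"] e by (fastforce simp: D_def)
    have "u m x \<le> e / 2" if "m \<ge> K" for m
      unfolding u_def by (rule cSUP_least) (use K that in \<open>auto intro: less_imp_le\<close>)
    then show "\<exists>K. \<forall>m\<ge>K. norm (u m x - 0) < e"
      using e u(1) by (intro exI[of _ K]) (force simp: abs_of_nonneg intro: le_less_trans)
  qed
  have D_lim: "(\<lambda>n. \<integral>\<omega>. D n (X n \<omega>) \<partial>M) \<longlonglongrightarrow> 0"
  proof (rule LIMSEQ_I)
    fix e :: real assume e: "0 < e"
    have "(\<lambda>m. \<integral>\<omega>. u m (Y \<omega>) \<partial>N) \<longlonglongrightarrow> (\<integral>\<omega>. 0 \<partial>N)"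
      by (rule integral_dominated_convergence[where w = "\<lambda>_. 2 * B"]) (use u u_lim in auto)
    then have "eventually (\<lambda>m. (\<integral>\<omega>. u m (Y \<omega>) \<partial>N) < e) sequentially"
      using e by (intro order_tendstoD) auto
    then obtain m where m: "(\<integral>\<omega>. u m (Y \<omega>) \<partial>N) < e"
      unfolding eventually_sequentially by blast
    have "bounded (range (u m))"
      by (rule boundedI[of _ "2 * B"]) (use u in auto)
    then have "(\<lambda>n. \<integral>\<omega>. u m (X n \<omega>) \<partial>M) \<longlonglongrightarrow> (\<integral>\<omega>. u m (Y \<omega>) \<partial>N)"
      using conv lip_u unfolding weak_conv_lipschitz_def by blast
    then have "eventually (\<lambda>n. (\<integral>\<omega>. u m (X n \<omega>) \<partial>M) < e) sequentially"
      using m by (rule order_tendstoD)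
    then obtain K where K: "\<And>n. n \<ge> K \<Longrightarrow> (\<integral>\<omega>. u m (X n \<omega>) \<partial>M) < e"
      unfolding eventually_sequentially by blast
    have "norm ((\<integral>\<omega>. D n (X n \<omega>) \<partial>M) - 0) < e" if n: "n \<ge> max K m" for n
    proof -
      have "(\<integral>\<omega>. D n (X n \<omega>) \<partial>M) \<le> (\<integral>\<omega>. u m (X n \<omega>) \<partial>M)"
      proof (rule integral_mono)
        show "integrable M (\<lambda>\<omega>. D n (X n \<omega>))"
          by (rule M.integrable_const_bound[of _ "2 * B"]) (use D in \<open>auto simp: D_def\<close>)
        show "integrable M (\<lambda>\<omega>. u m (X n \<omega>))"
          by (rule M.integrable_const_bound[of _ "2 * B"]) (use u in auto)
      qed (use Du n in auto)
      moreover have "0 \<le> (\<integral>\<omega>. D n (X n \<omega>) \<partial>M)"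
        by (rule Bochner_Integration.integral_nonneg) (use D in auto)
      ultimately show ?thesis
        using K[of n] n by auto
    qed
    then show "\<exists>K. \<forall>n\<ge>K. norm ((\<integral>\<omega>. D n (X n \<omega>) \<partial>M) - 0) < e" by blast
  qed
  have D_bound: "norm ((\<integral>\<omega>. f (g n (X n \<omega>)) \<partial>M) - (\<integral>\<omega>. f (h (X n \<omega>)) \<partial>M))
      \<le> (\<integral>\<omega>. D n (X n \<omega>) \<partial>M)" for n
  proof -
    have "(\<integral>\<omega>. f (g n (X n \<omega>)) \<partial>M) - (\<integral>\<omega>. f (h (X n \<omega>)) \<partial>M)
        = (\<integral>\<omega>. f (g n (X n \<omega>)) - f (h (X n \<omega>)) \<partial>M)"
      by (rule Bochner_Integration.integral_diff[symmetric];
          rule M.integrable_const_bound[of _ B]) (use B in auto)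
    then show ?thesis
      using integral_norm_bound[of M "\<lambda>\<omega>. f (g n (X n \<omega>)) - f (h (X n \<omega>))"] by (simp add: D_def)
  qed
  have diff_lim: "(\<lambda>n. (\<integral>\<omega>. f (g n (X n \<omega>)) \<partial>M) - (\<integral>\<omega>. f (h (X n \<omega>)) \<partial>M)) \<longlonglongrightarrow> 0"
    by (rule Lim_null_comparison[OF always_eventually[OF allI] D_lim]) (rule D_bound)
  have "bounded (range (\<lambda>x. f (h x)))"
    by (rule boundedI[of _ B]) (use B in auto)
  then have "(\<lambda>n. \<integral>\<omega>. f (h (X n \<omega>)) \<partial>M) \<longlonglongrightarrow> (\<integral>\<omega>. f (h (Y \<omega>)) \<partial>N)"
    using conv lip_fh unfolding weak_conv_lipschitz_def by blast
  from tendsto_add[OF diff_lim this]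
  show "(\<lambda>n. \<integral>\<omega>. f (g n (X n \<omega>)) \<partial>M) \<longlonglongrightarrow> (\<integral>\<omega>. f (h (Y \<omega>)) \<partial>N)"
    by simp
qed

section \<open>Finite-dimensional distributions determine weak convergence\<close>

text \<open>The point-separating algebra for Stone--Weierstrass, generated inductively so that a
  property can be carried through sums and products.\<close>

inductive_set coordinate_polynomials :: "('a l2 \<Rightarrow> real) set" where
  const: "(\<lambda>_. c) \<in> coordinate_polynomials"
| coord: "(\<lambda>u. l2_fun u x) \<in> coordinate_polynomials"
| add: "f \<in> coordinate_polynomials \<Longrightarrow> g \<in> coordinate_polynomials \<Longrightarrow>
    (\<lambda>u. f u + g u) \<in> coordinate_polynomials"
| mult: "f \<in> coordinate_polynomials \<Longrightarrow> g \<in> coordinate_polynomials \<Longrightarrow>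
    (\<lambda>u. f u * g u) \<in> coordinate_polynomials"

lemma continuous_on_coordinate_polynomials:
  "f \<in> coordinate_polynomials \<Longrightarrow> continuous_on S f"
  by (induction rule: coordinate_polynomials.induct)
    (rule continuous_on_const continuous_on_l2_fun[OF continuous_on_id]
      continuous_on_add continuous_on_mult; assumption)+

lemma coordinate_polynomials_approx:
  assumes "compact S" "continuous_on S f" "0 < e"
  shows "\<exists>q\<in>coordinate_polynomials. \<forall>u\<in>S. \<bar>f u - q u\<bar> < e"
proof -
  interpret function_ring_on coordinate_polynomials S
  proof
    fix u v :: "'a l2" assume "u \<noteq> v"
    then obtain x where "l2_fun u x \<noteq> l2_fun v x"
      using l2_eqI[of u v] by auto
    then show "\<exists>f\<in>coordinate_polynomials. f u \<noteq> f v"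
      by (intro bexI[of _ "\<lambda>u. l2_fun u x"] coordinate_polynomials.coord)
  qed (auto intro: continuous_on_coordinate_polynomials coordinate_polynomials.intros assms)
  show ?thesis
    using Stone_Weierstrass_basic[OF assms(2,3)] .
qed

text \<open>The wrapping map. Polynomials in its coordinates are trigonometric polynomials in
  \<open>v\<close>, and arcsine inverts it on a cube whose half side times \<open>a\<close> is at
  most \<open>pi / 2\<close>.\<close>

definition l2_sin :: "'a set \<Rightarrow> real \<Rightarrow> 'a l2 \<Rightarrow> 'a l2"
  where "l2_sin D a v = (\<Sum>x\<in>D. sin (a * l2_fun v x) *\<^sub>R l2_basis x)"

lemma measurable_cos_inner [measurable]:
  fixes h :: "'a::countable l2"
  shows "(\<lambda>v. cos (h \<bullet> v + c)) \<in> borel_measurable borel"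
  by (intro borel_measurable_continuous_onI continuous_intros)

text \<open>A Chebyshev-type estimate with two uses: the error of wrapping outside a large cube, and
  the error of dropping the coordinates \<open>E\<close>.\<close>

lemma integral_diff_le_moments:
  fixes V :: "'w \<Rightarrow> 'a l2"
  assumes P: "prob_space P" and i: "integrable P F" "integrable P H"
    and bound: "\<And>\<omega>. \<bar>F \<omega> - H \<omega>\<bar> \<le> c1 + c2 * (\<Sum>x\<in>E. (l2_fun (V \<omega>) x)\<^sup>2)" and c2: "0 \<le> c2"
    and m: "\<And>x. x \<in> E \<Longrightarrow> integrable P (\<lambda>\<omega>. (l2_fun (V \<omega>) x)\<^sup>2)"
      "\<And>x. x \<in> E \<Longrightarrow> (\<integral>\<omega>. (l2_fun (V \<omega>) x)\<^sup>2 \<partial>P) \<le> q x"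
  shows "\<bar>(\<integral>\<omega>. F \<omega> \<partial>P) - (\<integral>\<omega>. H \<omega> \<partial>P)\<bar> \<le> c1 + c2 * sum q E"
proof -
  interpret P: prob_space P by fact
  have "\<bar>(\<integral>\<omega>. F \<omega> \<partial>P) - (\<integral>\<omega>. H \<omega> \<partial>P)\<bar> \<le> (\<integral>\<omega>. \<bar>F \<omega> - H \<omega>\<bar> \<partial>P)"
    using integral_norm_bound[of P "\<lambda>\<omega>. F \<omega> - H \<omega>"] i by simp
  also have "\<dots> \<le> (\<integral>\<omega>. c1 + c2 * (\<Sum>x\<in>E. (l2_fun (V \<omega>) x)\<^sup>2) \<partial>P)"
    using i m by (intro integral_mono bound) auto
  also have "\<dots> = c1 + c2 * (\<Sum>x\<in>E. (\<integral>\<omega>. (l2_fun (V \<omega>) x)\<^sup>2 \<partial>P))"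
    using m by (simp add: P.prob_space)
  also have "\<dots> \<le> c1 + c2 * sum q E"
    using m c2 by (intro add_left_mono mult_left_mono sum_mono) auto
  finally show ?thesis .
qed

section \<open>Convergence for functions of finitely many coordinates\<close>

context
  fixes M :: "'w measure" and N :: "'b measure"
    and X :: "nat \<Rightarrow> 'w \<Rightarrow> 'a::countable l2" and Y :: "'b \<Rightarrow> 'a l2" and D :: "'a set"
  assumes M: "prob_space M" and N: "prob_space N"
    and X [measurable]: "\<And>n. X n \<in> borel_measurable M" and Y [measurable]: "Y \<in> borel_measurable N"
    and D: "finite D"
    and conv: "\<And>h c. h \<in> l2_on D \<Longrightarrow>
      (\<lambda>n. \<integral>\<omega>. cos (h \<bullet> X n \<omega> + c) \<partial>M) \<longlonglongrightarrow> (\<integral>\<omega>. cos (h \<bullet> Y \<omega> + c) \<partial>N)"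
begin

interpretation M: prob_space M by (rule M)
interpretation N: prob_space N by (rule N)

text \<open>The extra cosine of arbitrary frequency makes the property strong enough to survive
  products. The free phase \<open>c\<close> covers sines as well, so only one kind of function has
  to be tracked.\<close>

definition cos_stable :: "('a l2 \<Rightarrow> real) \<Rightarrow> bool"
  where "cos_stable \<phi> \<longleftrightarrow> \<phi> \<in> borel_measurable borel \<and> bounded (range \<phi>) \<and>
    (\<forall>h\<in>l2_on D. \<forall>c. (\<lambda>n. \<integral>\<omega>. \<phi> (X n \<omega>) * cos (h \<bullet> X n \<omega> + c) \<partial>M)
      \<longlonglongrightarrow> (\<integral>\<omega>. \<phi> (Y \<omega>) * cos (h \<bullet> Y \<omega> + c) \<partial>N))"

lemma cos_stable_integrable:
  assumes "cos_stable \<phi>"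
  shows "integrable M (\<lambda>\<omega>. \<phi> (X n \<omega>) * cos (h \<bullet> X n \<omega> + c))"
    and "integrable N (\<lambda>\<omega>. \<phi> (Y \<omega>) * cos (h \<bullet> Y \<omega> + c))"
proof -
  have [measurable]: "\<phi> \<in> borel_measurable borel"
    using assms by (simp add: cos_stable_def)
  obtain B where B: "\<And>x. \<bar>\<phi> x\<bar> \<le> B"
    using assms by (auto simp: cos_stable_def bounded_iff)
  have *: "norm (\<phi> v * cos z) \<le> B" for v z
    using mult_mono[OF B[of v] abs_cos_le_one[of z]] B[of v] by (simp add: abs_mult)
  show "integrable M (\<lambda>\<omega>. \<phi> (X n \<omega>) * cos (h \<bullet> X n \<omega> + c))"
    by (rule M.integrable_const_bound[of _ B]) (use * in auto)
  show "integrable N (\<lambda>\<omega>. \<phi> (Y \<omega>) * cos (h \<bullet> Y \<omega> + c))"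
    by (rule N.integrable_const_bound[of _ B]) (use * in auto)
qed

lemma cos_stable_add:
  assumes f: "cos_stable f" and g: "cos_stable g"
  shows "cos_stable (\<lambda>v. f v + g v)"
  unfolding cos_stable_def
proof (intro conjI ballI allI)
  show "(\<lambda>v. f v + g v) \<in> borel_measurable borel"
    using f g by (auto simp: cos_stable_def)
  show "bounded (range (\<lambda>v. f v + g v))"
    using f g by (intro bounded_plus_comp) (auto simp: cos_stable_def)
  fix h :: "'a l2" and c assume "h \<in> l2_on D"
  then have "(\<lambda>n. (\<integral>\<omega>. f (X n \<omega>) * cos (h \<bullet> X n \<omega> + c) \<partial>M) + (\<integral>\<omega>. g (X n \<omega>) * cos (h \<bullet> X n \<omega> + c) \<partial>M))
      \<longlonglongrightarrow> (\<integral>\<omega>. f (Y \<omega>) * cos (h \<bullet> Y \<omega> + c) \<partial>N) + (\<integral>\<omega>. g (Y \<omega>) * cos (h \<bullet> Y \<omega> + c) \<partial>N)"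
    using f g by (intro tendsto_add) (auto simp: cos_stable_def)
  then show "(\<lambda>n. \<integral>\<omega>. (f (X n \<omega>) + g (X n \<omega>)) * cos (h \<bullet> X n \<omega> + c) \<partial>M)
      \<longlonglongrightarrow> (\<integral>\<omega>. (f (Y \<omega>) + g (Y \<omega>)) * cos (h \<bullet> Y \<omega> + c) \<partial>N)"
    using cos_stable_integrable[OF f] cos_stable_integrable[OF g] by (simp add: distrib_right)
qed

lemma cos_stable_cmult:
  assumes f: "cos_stable f"
  shows "cos_stable (\<lambda>v. a * f v)"
proof -
  have "bounded (range (\<lambda>v. a * f v))"
    using f bounded_scaling[of "range f" a] by (auto simp: cos_stable_def image_image)
  moreover have "(\<lambda>n. a * (\<integral>\<omega>. f (X n \<omega>) * cos (h \<bullet> X n \<omega> + c) \<partial>M))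
      \<longlonglongrightarrow> a * (\<integral>\<omega>. f (Y \<omega>) * cos (h \<bullet> Y \<omega> + c) \<partial>N)" if "h \<in> l2_on D" for h c
    using f that by (intro tendsto_mult_left) (auto simp: cos_stable_def)
  moreover have "(\<lambda>v. a * f v) \<in> borel_measurable borel"
    using f by (auto simp: cos_stable_def)
  ultimately show ?thesis
    by (simp add: cos_stable_def mult.assoc)
qed

text \<open>The product-to-sum formula absorbs the new factor into the frequencies
  \<open>h + k\<close> and \<open>h - k\<close>, which stay in \<open>l2_on D\<close>.\<close>

lemma cos_stable_mult_cos:
  assumes f: "cos_stable f" and k: "k \<in> l2_on D"
  shows "cos_stable (\<lambda>v. cos (k \<bullet> v + d) * f v)"
  unfolding cos_stable_def
proof (intro conjI ballI allI)
  show "(\<lambda>v. cos (k \<bullet> v + d) * f v) \<in> borel_measurable borel"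
    using f by (auto simp: cos_stable_def)
  obtain B where B: "\<And>x. \<bar>f x\<bar> \<le> B"
    using f by (auto simp: cos_stable_def bounded_iff)
  show "bounded (range (\<lambda>v. cos (k \<bullet> v + d) * f v))"
  proof (rule boundedI)
    fix y assume "y \<in> range (\<lambda>v. cos (k \<bullet> v + d) * f v)"
    then obtain v where y: "y = cos (k \<bullet> v + d) * f v" by blast
    show "norm y \<le> 1 * B"
      unfolding y real_norm_def abs_mult by (intro mult_mono B) auto
  qed
  fix h :: "'a l2" and c assume h: "h \<in> l2_on D"
  have eq: "cos (k \<bullet> v + d) * f v * cos (h \<bullet> v + c)
      = (1/2) * (f v * cos ((h + k) \<bullet> v + (c + d))) + (1/2) * (f v * cos ((h - k) \<bullet> v + (c - d)))" for v
  proof -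
    have "cos (k \<bullet> v + d) * cos (h \<bullet> v + c)
      = (cos ((h \<bullet> v + c) - (k \<bullet> v + d)) + cos ((h \<bullet> v + c) + (k \<bullet> v + d))) / 2"
      by (simp add: cos_add cos_diff)
    then have "cos (k \<bullet> v + d) * cos (h \<bullet> v + c)
      = (cos ((h - k) \<bullet> v + (c - d)) + cos ((h + k) \<bullet> v + (c + d))) / 2"
      by (simp add: inner_add_left inner_diff_left algebra_simps)
    then have "f v * (cos (k \<bullet> v + d) * cos (h \<bullet> v + c))
      = f v * ((cos ((h - k) \<bullet> v + (c - d)) + cos ((h + k) \<bullet> v + (c + d))) / 2)"
      by (rule arg_cong)
    then show ?thesis
      by (simp add: distrib_left add_divide_distrib mult_ac add_ac)
  qed
  have hk: "h + k \<in> l2_on D" "h - k \<in> l2_on D"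
    using h k by (auto simp: l2_on_def)
  have "(\<lambda>n. (1/2) * (\<integral>\<omega>. f (X n \<omega>) * cos ((h + k) \<bullet> X n \<omega> + (c + d)) \<partial>M)
        + (1/2) * (\<integral>\<omega>. f (X n \<omega>) * cos ((h - k) \<bullet> X n \<omega> + (c - d)) \<partial>M))
      \<longlonglongrightarrow> (1/2) * (\<integral>\<omega>. f (Y \<omega>) * cos ((h + k) \<bullet> Y \<omega> + (c + d)) \<partial>N)
        + (1/2) * (\<integral>\<omega>. f (Y \<omega>) * cos ((h - k) \<bullet> Y \<omega> + (c - d)) \<partial>N)"
    using f hk by (intro tendsto_add tendsto_mult_left) (auto simp: cos_stable_def)
  then show "(\<lambda>n. \<integral>\<omega>. cos (k \<bullet> X n \<omega> + d) * f (X n \<omega>) * cos (h \<bullet> X n \<omega> + c) \<partial>M)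
      \<longlonglongrightarrow> (\<integral>\<omega>. cos (k \<bullet> Y \<omega> + d) * f (Y \<omega>) * cos (h \<bullet> Y \<omega> + c) \<partial>N)"
    unfolding eq
    using cos_stable_integrable[OF f]
    by (subst (1 2) Bochner_Integration.integral_add) auto
qed

text \<open>A coordinate of \<open>l2_sin\<close> is a cosine with phase \<open>- pi / 2\<close>.
  Generalising over \<open>f\<close> lets a product be handled by multiplying in one factor after
  the other.\<close>

lemma cos_stable_polynomial:
  assumes "q \<in> coordinate_polynomials" "cos_stable f"
  shows "cos_stable (\<lambda>v. q (l2_sin D a v) * f v)"
  using assms
proof (induction arbitrary: f)
  case (const c)
  then show ?case by (rule cos_stable_cmult)
next
  case (coord x)
  show ?case
  proof (cases "x \<in> D")
    case True
    have "a *\<^sub>R l2_basis x \<in> l2_on D"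
      using True by (auto simp: l2_on_def)
    from cos_stable_mult_cos[OF coord this, of "- (pi / 2)"]
    have "cos_stable (\<lambda>v. cos (a * l2_fun v x - pi / 2) * f v)"
      by (simp add: inner_commute[of "l2_basis x"])
    moreover have "cos (z - pi / 2) = sin z" for z :: real
      by (simp add: cos_diff)
    ultimately show ?thesis
      using True by (simp add: l2_sin_def l2_fun_sum_basis[OF D])
  next
    case False
    then show ?thesis
      using cos_stable_cmult[OF coord, of 0] by (simp add: l2_sin_def l2_fun_sum_basis[OF D])
  qed
next
  case (add p q)
  from cos_stable_add[OF add.IH(1)[OF add.prems] add.IH(2)[OF add.prems]]
  show ?case by (simp add: distrib_right)
next
  case (mult p q)
  from mult.IH(1)[OF mult.IH(2)[OF mult.prems]]
  show ?case by (simp add: mult.assoc)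
qed

text \<open>\<open>g\<close> is compared with a trigonometric polynomial: on a large cube by
  Stone--Weierstrass after wrapping, off the cube by boundedness and the second moments, uniformly
  in \<open>n\<close>.\<close>

lemma tendsto_integral_l2_restrict:
  assumes mX: "\<And>n x. x \<in> D \<Longrightarrow> integrable M (\<lambda>\<omega>. (l2_fun (X n \<omega>) x)\<^sup>2)"
      "\<And>n x. x \<in> D \<Longrightarrow> (\<integral>\<omega>. (l2_fun (X n \<omega>) x)\<^sup>2 \<partial>M) \<le> 1"
    and mY: "\<And>x. x \<in> D \<Longrightarrow> integrable N (\<lambda>\<omega>. (l2_fun (Y \<omega>) x)\<^sup>2)"
      "\<And>x. x \<in> D \<Longrightarrow> (\<integral>\<omega>. (l2_fun (Y \<omega>) x)\<^sup>2 \<partial>N) \<le> 1"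
    and g: "continuous_on UNIV g" and B: "\<And>x. \<bar>g x :: real\<bar> \<le> B"
  shows "(\<lambda>n. \<integral>\<omega>. g (l2_restrict D (X n \<omega>)) \<partial>M) \<longlonglongrightarrow> (\<integral>\<omega>. g (l2_restrict D (Y \<omega>)) \<partial>N)"
proof (rule LIMSEQ_I)
  fix e :: real assume e: "0 < e"
  have B0: "0 \<le> B" using B[of 0] by simp
  \<comment> \<open>Solves \<open>2 * B * card D / T^2 \<le> e / 8\<close>; the summand 1 keeps
    \<open>T\<close> positive when \<open>B\<close> or \<open>card D\<close> is 0.\<close>
  define T where "T = 1 + sqrt (16 * B * card D / e)"
  have T: "1 \<le> T" and T2: "2 * B * card D / T\<^sup>2 \<le> e / 8"
  proof -
    show "1 \<le> T" using B0 e by (simp add: T_def)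
    have "16 * B * card D / e = (sqrt (16 * B * card D / e))\<^sup>2"
      using B0 e by simp
    also have "\<dots> \<le> T\<^sup>2"
      unfolding T_def using B0 e by (intro power_mono) auto
    finally have "16 * B * card D \<le> T\<^sup>2 * e"
      using e by (simp add: field_simps)
    then show "2 * B * card D / T\<^sup>2 \<le> e / 8"
      using \<open>1 \<le> T\<close> by (simp add: field_simps)
  qed
  \<comment> \<open>Sends [-T, T] to [-pi/2, pi/2], the interval on which arcsine inverts
    sine.\<close>
  define a where "a = pi / (2 * T)"
  have a: "0 < a" "a * T = pi / 2"
    using T by (auto simp: a_def)
  define S where "S = {f \<in> l2_on D. \<forall>x. \<bar>l2_fun f x\<bar> \<le> 1}"
  \<comment> \<open>\<open>k\<close> reads \<open>g\<close> through the inverse of the wrapping: on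
    the cube of half side \<open>T\<close> it satisfies
    \<open>k (l2_sin D a v) = g (l2_restrict D v)\<close>.\<close>
  define k where "k = (\<lambda>u. g (\<Sum>x\<in>D. (arcsin (l2_fun u x) / a) *\<^sub>R l2_basis x))"
  have "continuous_on S k"
    unfolding k_def
  proof (rule continuous_on_compose2[OF g])
    have "continuous_on S (\<lambda>u. arcsin (l2_fun u x))" for x
    proof (rule continuous_on_compose2[OF continuous_on_arcsin'])
      show "(\<lambda>u. l2_fun u x) ` S \<subseteq> {-1..1}"
        by (auto simp: S_def abs_le_iff)
    qed (intro continuous_on_l2_fun continuous_on_id)
    then have "continuous_on S (\<lambda>u. arcsin (l2_fun u x) / a)" for x
      by (rule continuous_on_divide) (use a in auto)
    then show "continuous_on S (\<lambda>u. \<Sum>x\<in>D. (arcsin (l2_fun u x) / a) *\<^sub>R l2_basis x)"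
      by (intro continuous_on_sum continuous_on_scaleR continuous_on_const)
  qed simp
  then obtain q where q: "q \<in> coordinate_polynomials" "\<And>u. u \<in> S \<Longrightarrow> \<bar>k u - q u\<bar> < e / 8"
    using coordinate_polynomials_approx[of S k "e/8"] compact_l2_cube[OF D] e
    by (auto simp: S_def)
  have sinS: "l2_sin D a v \<in> S" for v
    by (auto simp: S_def l2_on_def l2_sin_def l2_fun_sum_basis[OF D])
  have "cos_stable (\<lambda>_. 1)"
    using conv by (auto simp: cos_stable_def)
  then have stable: "cos_stable (\<lambda>v. q (l2_sin D a v))"
    using cos_stable_polynomial[OF q(1), of "\<lambda>_. 1" a] by simp
  \<comment> \<open>The left side is 0 on the cube; off it some coordinate exceeds \<open>T\<close>,
    and the right side is at least the trivial bound \<open>2 * B\<close>.\<close>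
  have gk: "\<bar>g (l2_restrict D v) - k (l2_sin D a v)\<bar> \<le> 2 * B * (\<Sum>x\<in>D. (l2_fun v x)\<^sup>2) / T\<^sup>2" for v
  proof (cases "\<forall>x\<in>D. \<bar>l2_fun v x\<bar> \<le> T")
    case True
    have "arcsin (sin (a * l2_fun v x)) / a = l2_fun v x" if "x \<in> D" for x
    proof -
      have "\<bar>a * l2_fun v x\<bar> \<le> pi / 2"
        using mult_left_mono[of "\<bar>l2_fun v x\<bar>" T a] a True that by (simp add: abs_mult)
      then have "arcsin (sin (a * l2_fun v x)) = a * l2_fun v x"
        by (intro arcsin_sin) auto
      then show ?thesis using a by simp
    qed
    then have "k (l2_sin D a v) = g (l2_restrict D v)"
      unfolding k_def l2_restrict_eq_sum[OF D] by (simp add: l2_sin_def l2_fun_sum_basis[OF D])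
    then show ?thesis
      using B0 by (simp add: sum_nonneg)
  next
    case False
    then obtain x where x: "x \<in> D" "T < \<bar>l2_fun v x\<bar>" by auto
    have "T\<^sup>2 \<le> (l2_fun v x)\<^sup>2"
      using power_mono[of T "\<bar>l2_fun v x\<bar>" 2] x T by simp
    also have "\<dots> \<le> (\<Sum>x\<in>D. (l2_fun v x)\<^sup>2)"
      using x D by (intro member_le_sum) auto
    finally have "1 \<le> (\<Sum>x\<in>D. (l2_fun v x)\<^sup>2) / T\<^sup>2"
      using T by simp
    then have "2 * B * 1 \<le> 2 * B * ((\<Sum>x\<in>D. (l2_fun v x)\<^sup>2) / T\<^sup>2)"
      using B0 by (intro mult_left_mono) auto
    moreover have "\<bar>g (l2_restrict D v) - k (l2_sin D a v)\<bar> \<le> 2 * B"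
      using B[of "l2_restrict D v"] B[of "\<Sum>x\<in>D. (arcsin (l2_fun (l2_sin D a v) x) / a) *\<^sub>R l2_basis x"]
      unfolding k_def by linarith
    ultimately show ?thesis by simp
  qed
  have gq: "\<bar>g (l2_restrict D v) - q (l2_sin D a v)\<bar>
      \<le> e / 8 + 2 * B / T\<^sup>2 * (\<Sum>x\<in>D. (l2_fun v x)\<^sup>2)" for v
    using gk[of v] q(2)[OF sinS, of v] unfolding times_divide_eq_left by linarith
  have [measurable]: "g \<in> borel_measurable borel"
    by (rule borel_measurable_continuous_onI[OF g])
  have [measurable]: "(\<lambda>v. q (l2_sin D a v)) \<in> borel_measurable borel"
    using stable unfolding cos_stable_def by (rule conjunct1)
  obtain Bq where Bq: "\<And>v. \<bar>q (l2_sin D a v)\<bar> \<le> Bq"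
    using stable by (auto simp: cos_stable_def bounded_iff)
  have T2': "e / 8 + 2 * B / T\<^sup>2 * (\<Sum>x\<in>D. 1) \<le> e / 4"
    using T2 by simp
  have closeX: "\<bar>(\<integral>\<omega>. g (l2_restrict D (X n \<omega>)) \<partial>M) - (\<integral>\<omega>. q (l2_sin D a (X n \<omega>)) \<partial>M)\<bar> \<le> e / 4" for n
  proof (rule order_trans[OF integral_diff_le_moments T2'])
    show "integrable M (\<lambda>\<omega>. g (l2_restrict D (X n \<omega>)))"
      by (rule M.integrable_const_bound[of _ B]) (use B in auto)
    show "integrable M (\<lambda>\<omega>. q (l2_sin D a (X n \<omega>)))"
      by (rule M.integrable_const_bound[of _ Bq]) (use Bq in auto)
  qed (use gq mX M B0 in auto)
  have closeY: "\<bar>(\<integral>\<omega>. g (l2_restrict D (Y \<omega>)) \<partial>N) - (\<integral>\<omega>. q (l2_sin D a (Y \<omega>)) \<partial>N)\<bar> \<le> e / 4"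
  proof (rule order_trans[OF integral_diff_le_moments T2'])
    show "integrable N (\<lambda>\<omega>. g (l2_restrict D (Y \<omega>)))"
      by (rule N.integrable_const_bound[of _ B]) (use B in auto)
    show "integrable N (\<lambda>\<omega>. q (l2_sin D a (Y \<omega>)))"
      by (rule N.integrable_const_bound[of _ Bq]) (use Bq in auto)
  qed (use gq mY N B0 in auto)
  have zero: "0 \<in> l2_on D"
    by (simp add: l2_on_def)
  \<comment> \<open>Frequency 0 and phase 0 reduce the cosine in \<open>cos_stable\<close> to the
    constant 1.\<close>
  have "(\<lambda>n. \<integral>\<omega>. q (l2_sin D a (X n \<omega>)) * cos (0 \<bullet> X n \<omega> + 0) \<partial>M)
      \<longlonglongrightarrow> (\<integral>\<omega>. q (l2_sin D a (Y \<omega>)) * cos (0 \<bullet> Y \<omega> + 0) \<partial>N)"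
    using stable[unfolded cos_stable_def, THEN conjunct2, THEN conjunct2, rule_format, OF zero] .
  from LIMSEQ_D[OF this, of "e / 4"] e obtain K where K: "\<And>n. n \<ge> K \<Longrightarrow>
      norm ((\<integral>\<omega>. q (l2_sin D a (X n \<omega>)) \<partial>M) - (\<integral>\<omega>. q (l2_sin D a (Y \<omega>)) \<partial>N)) < e / 4"
    by auto
  have "norm ((\<integral>\<omega>. g (l2_restrict D (X n \<omega>)) \<partial>M) - (\<integral>\<omega>. g (l2_restrict D (Y \<omega>)) \<partial>N)) < e" if "n \<ge> K" for n
    using K[OF that] closeX[of n] closeY e unfolding real_norm_def by linarith
  then show "\<exists>K. \<forall>n\<ge>K. norm ((\<integral>\<omega>. g (l2_restrict D (X n \<omega>)) \<partial>M) - (\<integral>\<omega>. g (l2_restrict D (Y \<omega>)) \<partial>N)) < e"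
    by blast
qed

end

lemma nonneg_summable_tail:
  fixes q :: "'a::countable \<Rightarrow> real"
  assumes q: "\<And>x. 0 \<le> q x" "\<And>E. finite E \<Longrightarrow> sum q E \<le> 1" and e: "0 < e"
  shows "\<exists>k0. \<forall>k\<ge>k0. \<forall>E. finite E \<and> E \<inter> initial_part k = {} \<longrightarrow> sum q E < e"
proof -
  have "q summable_on UNIV"
    by (rule nonneg_bdd_above_summable_on) (use q in \<open>auto intro!: bdd_aboveI2[of _ _ 1]\<close>)
  then have "(q has_sum infsum q UNIV) UNIV"
    by (rule has_sum_infsum)
  then have "eventually (\<lambda>D. dist (sum q D) (infsum q UNIV) < e) (finite_subsets_at_top UNIV)"
    unfolding has_sum_def using e by (rule tendstoD)
  then obtain D where D: "finite D" "dist (sum q D) (infsum q UNIV) < e"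
    unfolding eventually_finite_subsets_at_top by blast
  obtain k0 where k0: "\<And>k. k \<ge> k0 \<Longrightarrow> D \<subseteq> initial_part k"
    using finite_subset_initial_part[OF D(1)] unfolding eventually_sequentially by blast
  have "sum q E < e" if "k \<ge> k0" "finite E" "E \<inter> initial_part k = {}" for k E
  proof -
    have "sum q D + sum q E = sum q (D \<union> E)"
      using D(1) that k0[OF that(1)] by (intro sum.union_disjoint[symmetric]) auto
    also have "\<dots> \<le> infsum q UNIV"
      by (rule finite_sum_le_infsum) (use \<open>q summable_on UNIV\<close> D(1) that q in auto)
    finally show ?thesis
      using D(2) by (simp add: dist_real_def)
  qed
  then show ?thesis by blast
qed

text \<open>Domination of all second moments by one summable \<open>q\<close> takes the place of
  tightness: the coordinates outside an initial part contribute little, uniformly in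
  \<open>n\<close>.\<close>

lemma weak_conv_lipschitzI_cos:
  fixes X :: "nat \<Rightarrow> 'w \<Rightarrow> 'a::countable l2" and Y :: "'b \<Rightarrow> 'a l2"
  assumes M: "prob_space M" and N: "prob_space N"
    and X [measurable]: "\<And>n. X n \<in> borel_measurable M" and Y [measurable]: "Y \<in> borel_measurable N"
    and conv: "\<And>D h c. finite D \<Longrightarrow> h \<in> l2_on D \<Longrightarrow>
      (\<lambda>n. \<integral>\<omega>. cos (h \<bullet> X n \<omega> + c) \<partial>M) \<longlonglongrightarrow> (\<integral>\<omega>. cos (h \<bullet> Y \<omega> + c) \<partial>N)"
    and q: "\<And>x. 0 \<le> q x" "\<And>E. finite E \<Longrightarrow> sum q E \<le> 1"
    and mX: "\<And>n x. integrable M (\<lambda>\<omega>. (l2_fun (X n \<omega>) x)\<^sup>2)"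
      "\<And>n x. (\<integral>\<omega>. (l2_fun (X n \<omega>) x)\<^sup>2 \<partial>M) \<le> q x"
    and mY: "\<And>x. integrable N (\<lambda>\<omega>. (l2_fun (Y \<omega>) x)\<^sup>2)"
      "\<And>x. (\<integral>\<omega>. (l2_fun (Y \<omega>) x)\<^sup>2 \<partial>N) \<le> q x"
  shows "weak_conv_lipschitz M X N Y"
  unfolding weak_conv_lipschitz_def
proof (intro allI impI)
  interpret M: prob_space M by fact
  interpret N: prob_space N by fact
  fix f :: "'a l2 \<Rightarrow> real" and L
  assume "L-lipschitz_on UNIV f \<and> bounded (range f)"
  then obtain B where f: "L-lipschitz_on UNIV f" and B: "\<And>x. \<bar>f x\<bar> \<le> B"
    by (auto simp: bounded_iff)
  have q1: "q x \<le> 1" for x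
    using q(2)[of "{x}"] by simp
  have fc: "continuous_on UNIV f"
    by (rule lipschitz_on_continuous_on[OF f])
  note [measurable] = lipschitz_on_imp_borel_measurable[OF f]
  let ?R = "\<lambda>k. l2_restrict (initial_part k) :: 'a l2 \<Rightarrow> 'a l2"
  have fR: "(\<lambda>k. f (?R k v)) \<longlonglongrightarrow> f v" for v
    using continuous_on_tendsto_compose[OF fc tendsto_l2_restrict_initial_part] by simp
  show "(\<lambda>n. \<integral>\<omega>. f (X n \<omega>) \<partial>M) \<longlonglongrightarrow> (\<integral>\<omega>. f (Y \<omega>) \<partial>N)"
  proof (rule LIMSEQ_I)
    fix e :: real assume e: "0 < e"
    \<comment> \<open>Makes \<open>L\<^sup>2 / e * \<eta>\<close> at most \<open>e / 16\<close> in
      the tail estimate; adding 1 to the denominator covers \<open>L = 0\<close>.\<close>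
    define \<eta> where "\<eta> = e\<^sup>2 / (16 * (L\<^sup>2 + 1))"
    have "0 < L\<^sup>2 + 1" by (simp add: add_nonneg_pos)
    then have \<eta>: "0 < \<eta>" "L\<^sup>2 * \<eta> \<le> e\<^sup>2 / 16"
      using e by (auto simp: \<eta>_def field_simps intro!: mult_nonneg_nonneg)
    obtain k0 where k0: "\<And>k E. k \<ge> k0 \<Longrightarrow> finite E \<Longrightarrow> E \<inter> initial_part k = {} \<Longrightarrow> sum q E < \<eta>"
      using nonneg_summable_tail[OF q \<eta>(1)] by blast
    have "(\<lambda>k. \<integral>\<omega>. f (?R k (Y \<omega>)) \<partial>N) \<longlonglongrightarrow> (\<integral>\<omega>. f (Y \<omega>) \<partial>N)"
      by (rule integral_dominated_convergence[where w = "\<lambda>_. B"]) (use B fR in auto)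
    then have "eventually (\<lambda>k. norm ((\<integral>\<omega>. f (?R k (Y \<omega>)) \<partial>N) - (\<integral>\<omega>. f (Y \<omega>) \<partial>N)) < e / 4) sequentially"
      using e tendstoD[of _ _ _ "e/4"] by (fastforce simp: dist_norm)
    then have "eventually (\<lambda>k. k \<ge> k0 \<and> norm ((\<integral>\<omega>. f (?R k (Y \<omega>)) \<partial>N) - (\<integral>\<omega>. f (Y \<omega>) \<partial>N)) < e / 4) sequentially"
      using eventually_ge_at_top[of k0] by eventually_elim auto
    then obtain k where k: "k \<ge> k0"
        "norm ((\<integral>\<omega>. f (?R k (Y \<omega>)) \<partial>N) - (\<integral>\<omega>. f (Y \<omega>) \<partial>N)) < e / 4"
      unfolding eventually_sequentially by blast
    \<comment> \<open>Moments are summed over finite sets only, so the tail is cut at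
      \<open>l\<close> first and \<open>l\<close> is then sent to infinity.\<close>
    have tail: "\<bar>(\<integral>\<omega>. f (X n \<omega>) \<partial>M) - (\<integral>\<omega>. f (?R k (X n \<omega>)) \<partial>M)\<bar> \<le> e / 2" for n
    proof (rule LIMSEQ_le_const2)
      have "(\<lambda>l. \<integral>\<omega>. f (?R l (X n \<omega>)) \<partial>M) \<longlonglongrightarrow> (\<integral>\<omega>. f (X n \<omega>) \<partial>M)"
        by (rule integral_dominated_convergence[where w = "\<lambda>_. B"]) (use B fR in auto)
      then show "(\<lambda>l. \<bar>(\<integral>\<omega>. f (?R l (X n \<omega>)) \<partial>M) - (\<integral>\<omega>. f (?R k (X n \<omega>)) \<partial>M)\<bar>)
          \<longlonglongrightarrow> \<bar>(\<integral>\<omega>. f (X n \<omega>) \<partial>M) - (\<integral>\<omega>. f (?R k (X n \<omega>)) \<partial>M)\<bar>"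
        by (intro tendsto_intros)
      have "\<bar>(\<integral>\<omega>. f (?R l (X n \<omega>)) \<partial>M) - (\<integral>\<omega>. f (?R k (X n \<omega>)) \<partial>M)\<bar> \<le> e / 2" if l: "l \<ge> k" for l
      proof -
        define E where "E = initial_part l - (initial_part k :: 'a set)"
        have E: "finite E" "E \<inter> initial_part k = {}"
          by (auto simp: E_def)
        have RE: "?R l v - ?R k v = l2_restrict E v" for v
          by (rule l2_eqI) (use l in \<open>auto simp: E_def initial_part_def\<close>)
        \<comment> \<open>AM-GM: \<open>L t \<le> e / 4 + (L t)\<^sup>2 / e\<close>\<close>
        have bound: "\<bar>f (?R l v) - f (?R k v)\<bar> \<le> e / 4 + L\<^sup>2 / e * (\<Sum>x\<in>E. (l2_fun v x)\<^sup>2)" for v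
        proof -
          let ?t = "norm (l2_restrict E v)"
          have "\<bar>f (?R l v) - f (?R k v)\<bar> \<le> L * ?t"
            using lipschitz_on_realD[OF f, of "?R l v" "?R k v"] by (simp add: dist_norm RE)
          also have "L * ?t \<le> e / 4 + L\<^sup>2 / e * ?t\<^sup>2"
          proof -
            have "0 \<le> (L * ?t - e / 2)\<^sup>2 / e"
              using e by simp
            also have "\<dots> = e / 4 + L\<^sup>2 / e * ?t\<^sup>2 - L * ?t"
              using e by (simp add: power2_eq_square field_simps)
            finally show ?thesis by simp
          qed
          finally show ?thesis
            by (simp add: norm_l2_restrict_finite[OF E(1)])
        qed
        have i: "integrable M (\<lambda>\<omega>. f (?R j (X n \<omega>)))" for j
          by (rule M.integrable_const_bound[of _ B]) (use B in auto)
        have "\<bar>(\<integral>\<omega>. f (?R l (X n \<omega>)) \<partial>M) - (\<integral>\<omega>. f (?R k (X n \<omega>)) \<partial>M)\<bar>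
            \<le> e / 4 + L\<^sup>2 / e * sum q E"
          by (rule integral_diff_le_moments[OF M i i bound _ mX(1) mX(2)]) (use e in auto)
        also have "\<dots> \<le> e / 4 + L\<^sup>2 / e * \<eta>"
          using k0[OF k(1) E] e by (intro add_left_mono mult_left_mono) auto
        also have "\<dots> \<le> e / 4 + e / 16"
          using \<eta>(2) e by (simp add: field_simps power2_eq_square)
        also have "\<dots> \<le> e / 2"
          using e by simp
        finally show ?thesis .
      qed
      then show "\<exists>K. \<forall>l\<ge>K. \<bar>(\<integral>\<omega>. f (?R l (X n \<omega>)) \<partial>M) - (\<integral>\<omega>. f (?R k (X n \<omega>)) \<partial>M)\<bar> \<le> e / 2"
        by blast
    qed
    have "(\<lambda>n. \<integral>\<omega>. f (?R k (X n \<omega>)) \<partial>M) \<longlonglongrightarrow> (\<integral>\<omega>. f (?R k (Y \<omega>)) \<partial>N)"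
      by (rule tendsto_integral_l2_restrict[OF M N X Y finite_initial_part
            conv[OF finite_initial_part] mX(1) order_trans[OF mX(2) q1]
            mY(1) order_trans[OF mY(2) q1] fc B])
    from LIMSEQ_D[OF this, of "e / 4"] e obtain K where K: "\<And>n. n \<ge> K \<Longrightarrow>
        norm ((\<integral>\<omega>. f (?R k (X n \<omega>)) \<partial>M) - (\<integral>\<omega>. f (?R k (Y \<omega>)) \<partial>N)) < e / 4"
      by auto
    have "norm ((\<integral>\<omega>. f (X n \<omega>) \<partial>M) - (\<integral>\<omega>. f (Y \<omega>) \<partial>N)) < e" if "n \<ge> K" for n
      using K[OF that] tail[of n] k(2) unfolding real_norm_def by linarith
    then show "\<exists>K. \<forall>n\<ge>K. norm ((\<integral>\<omega>. f (X n \<omega>) \<partial>M) - (\<integral>\<omega>. f (Y \<omega>) \<partial>N)) < e"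
      by blast
  qed
qed

section \<open>Centred normal laws\<close>

text \<open>Parametrised by the variance. As an image of the standard law it includes the point mass
  at 0, which has no density.\<close>

definition centred_normal :: "real \<Rightarrow> real measure"
  where "centred_normal s = distr std_normal_distribution borel (\<lambda>z. sqrt s * z)"

lemma real_distribution_centred_normal: "real_distribution (centred_normal s)"
proof -
  interpret real_distribution std_normal_distribution
    by (rule real_dist_normal_dist)
  show ?thesis
    unfolding centred_normal_def by (rule real_distribution_distr) simp
qed

lemma centred_normal_0: "centred_normal 0 = return borel 0"
proof -
  interpret real_distribution std_normal_distribution
    by (rule real_dist_normal_dist)
  show ?thesis
    using distr_const[of 0 borel] by (simp add: centred_normal_def)
qed

lemma centred_normal_pos:
  assumes "0 < \<sigma>"
  shows "centred_normal (\<sigma>\<^sup>2) = density lborel (\<lambda>x. ennreal (normal_density 0 \<sigma> x))"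
proof -
  interpret real_distribution std_normal_distribution
    by (rule real_dist_normal_dist)
  have "distr std_normal_distribution lborel (\<lambda>x. x) = std_normal_distribution"
    by (rule distr_id2) simp
  then have "distributed std_normal_distribution lborel (\<lambda>x. x) (normal_density 0 1)"
    by (simp add: distributed_def)
  from normal_density_affine[OF this, of \<sigma> 0] assms
  have "distributed std_normal_distribution lborel (\<lambda>x. \<sigma> * x) (normal_density 0 \<sigma>)"
    by simp
  then have "distr std_normal_distribution lborel (\<lambda>x. \<sigma> * x) = density lborel (normal_density 0 \<sigma>)"
    by (rule distributed_distr_eq_density)
  then show ?thesis
    using assms by (simp add: centred_normal_def cong: distr_cong)
qed

lemma gaussian_law_centred_normal:
  assumes "0 \<le> s"
  shows "gaussian_law (centred_normal s)"
proof (cases "s = 0")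
  case True
  then show ?thesis
    by (auto simp: gaussian_law_def centred_normal_0)
next
  case False
  then have "0 < sqrt s" "(sqrt s)\<^sup>2 = s"
    using assms by auto
  then show ?thesis
    using centred_normal_pos[of "sqrt s"] unfolding gaussian_law_def by metis
qed

lemma centred_normal_moments:
  assumes "0 \<le> s"
  shows "integrable (centred_normal s) (\<lambda>x. x)" "(\<integral>x. x \<partial>centred_normal s) = 0"
    "integrable (centred_normal s) (\<lambda>x. x\<^sup>2)" "(\<integral>x. x\<^sup>2 \<partial>centred_normal s) = s"
proof -
  have 1: "integrable std_normal_distribution (\<lambda>x. x)" "integrable std_normal_distribution (\<lambda>x. x\<^sup>2)"
    using integrable_std_normal_distribution_moment[of 1]
      integrable_std_normal_distribution_moment[of 2] by simp_all
  have 2: "(\<integral>x. x \<partial>std_normal_distribution) = 0"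
    using integral_std_normal_distribution_moment_odd[of 1] by simp
  have 3: "(\<integral>x. x\<^sup>2 \<partial>std_normal_distribution) = 1"
    using std_normal_distribution_even_moments(1)[of 1] by simp
  have m: "(\<lambda>z. sqrt s * z) \<in> measurable std_normal_distribution borel"
    by measurable
  have borel_measurable_ident: "(\<lambda>x::real. x) \<in> borel_measurable borel"
    by measurable
  show "integrable (centred_normal s) (\<lambda>x. x)"
    unfolding centred_normal_def integrable_distr_eq[OF m borel_measurable_ident]
    by (rule integrable_mult_right) (rule 1)
  show "(\<integral>x. x \<partial>centred_normal s) = 0"
    unfolding centred_normal_def integral_distr[OF m borel_measurable_ident]
    by (simp only: integral_mult_right_zero 2 mult_zero_right)
  have sq: "(\<lambda>x::real. x\<^sup>2) \<in> borel_measurable borel"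
    by measurable
  have eq: "(sqrt s * z)\<^sup>2 = s * z\<^sup>2" for z
    using assms by (simp add: power_mult_distrib)
  show "integrable (centred_normal s) (\<lambda>x. x\<^sup>2)"
    unfolding centred_normal_def integrable_distr_eq[OF m sq] eq
    by (rule integrable_mult_right) (rule 1)
  show "(\<integral>x. x\<^sup>2 \<partial>centred_normal s) = s"
    unfolding centred_normal_def integral_distr[OF m sq] eq
    by (simp only: integral_mult_right_zero 3 mult_1_right)
qed

text \<open>Makes the marginals of any admissible limit process explicit from its mean and
  covariance alone.\<close>

lemma gaussian_law_eq_centred_normal:
  assumes \<mu>: "gaussian_law \<mu>" and mean: "(\<integral>x. x \<partial>\<mu>) = 0" and second: "(\<integral>x. x\<^sup>2 \<partial>\<mu>) = s"
  shows "\<mu> = centred_normal s"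
  using \<mu> unfolding gaussian_law_def
proof (elim disjE exE conjE)
  fix m :: real assume m: "\<mu> = return borel m"
  then have "m = 0" "s = m\<^sup>2"
    using mean second by (simp_all add: integral_return)
  then show ?thesis
    by (simp add: m centred_normal_0)
next
  fix m \<sigma> :: real assume \<sigma>: "0 < \<sigma>" and d: "\<mu> = density lborel (\<lambda>x. ennreal (normal_density m \<sigma> x))"
  have "(\<integral>x. x \<partial>\<mu>) = m"
    unfolding d using integral_normal_moment_nz_1[OF \<sigma>, of m] by (subst integral_density) auto
  then have m: "m = 0" using mean by simp
  have eq: "\<mu> = centred_normal (\<sigma>\<^sup>2)"
    using d centred_normal_pos[OF \<sigma>] m by simp
  then have "s = \<sigma>\<^sup>2"
    using second centred_normal_moments(4)[of "\<sigma>\<^sup>2"] by simp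
  then show ?thesis using eq by simp
qed

lemma char_centred_normal: "0 \<le> s \<Longrightarrow> char (centred_normal s) t = exp (- (s * t\<^sup>2) / 2)"
proof -
  assume s: "0 \<le> s"
  have "char (centred_normal s) t = char std_normal_distribution (t * sqrt s)"
    unfolding centred_normal_def char_def by (subst integral_distr) (auto simp: mult.assoc)
  also have "\<dots> = exp (- (t * sqrt s)\<^sup>2 / 2)"
    by (simp add: char_std_normal_distribution)
  also have "(t * sqrt s)\<^sup>2 = s * t\<^sup>2"
    using s by (simp add: power_mult_distrib mult.commute)
  finally show ?thesis .
qed

section \<open>The multinomial covariance operator\<close>

lemma inner_l2_on_finite:
  assumes "finite D" "h \<in> l2_on D"
  shows "h \<bullet> v = (\<Sum>x\<in>D. l2_fun h x * l2_fun v x)"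
proof -
  have "h \<bullet> v = (\<Sum>\<^sub>\<infinity>x\<in>D. l2_fun h x * l2_fun v x)"
    unfolding inner_l2_def by (rule infsum_cong_neutral) (use assms in \<open>auto simp: l2_on_def\<close>)
  then show ?thesis using assms by simp
qed

text \<open>The covariance of the indicator vector of a single draw: multiplication by
  \<open>q\<close> minus the rank one operator generated by \<open>q\<close>.\<close>

definition multinomial_cov :: "('a \<Rightarrow> real) \<Rightarrow> 'a l2 \<Rightarrow> 'a l2"
  where "multinomial_cov q h = Abs_l2 (\<lambda>x. q x * l2_fun h x) - (Abs_l2 q \<bullet> h) *\<^sub>R Abs_l2 q"

context
  fixes q :: "'a \<Rightarrow> real"
  assumes q: "\<And>x. 0 \<le> q x" "\<And>E. finite E \<Longrightarrow> sum q E \<le> 1"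
begin

lemma subprobability_le_1: "q x \<le> 1"
  using q(2)[of "{x}"] by simp

lemma subprobability_square_summable: "(\<lambda>x. (q x)\<^sup>2) summable_on A"
proof (rule square_summable_onI)
  fix D assume D: "finite D" "D \<subseteq> A"
  have "(\<Sum>x\<in>D. (q x)\<^sup>2) \<le> (\<Sum>x\<in>D. q x)"
    by (rule sum_mono) (use q(1) subprobability_le_1 in \<open>simp add: power2_eq_square mult_left_le\<close>)
  also have "\<dots> \<le> 1" by (rule q(2)[OF D(1)])
  finally show "(\<Sum>x\<in>D. (q x)\<^sup>2) \<le> 1" .
qed

lemma l2_fun_Abs_subprobability [simp]: "l2_fun (Abs_l2 q) = q"
  by (rule l2_fun_Abs[OF subprobability_square_summable])

lemma l2_fun_Abs_subprobability_mult [simp]: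
  "l2_fun (Abs_l2 (\<lambda>x. q x * l2_fun h x)) = (\<lambda>x. q x * l2_fun h x)"
proof (rule l2_fun_Abs, rule square_summable_onI)
  fix D :: "'a set" assume D: "finite D"
  have "(\<Sum>x\<in>D. (q x * l2_fun h x)\<^sup>2) \<le> (\<Sum>x\<in>D. (l2_fun h x)\<^sup>2)"
  proof (rule sum_mono)
    fix x
    show "(q x * l2_fun h x)\<^sup>2 \<le> (l2_fun h x)\<^sup>2"
      unfolding power_mult_distrib
      using power_mono[OF subprobability_le_1 q(1), of x 2] by (intro mult_left_le_one_le) auto
  qed
  also have "\<dots> \<le> (norm h)\<^sup>2"
    by (rule sum_square_le_norm_l2[OF D])
  finally show "(\<Sum>x\<in>D. (q x * l2_fun h x)\<^sup>2) \<le> (norm h)\<^sup>2" .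
qed

lemma l2_fun_multinomial_cov:
  "l2_fun (multinomial_cov q h) x = q x * l2_fun h x - (Abs_l2 q \<bullet> h) * q x"
  by (simp add: multinomial_cov_def)

lemma bounded_linear_multinomial_cov: "bounded_linear (multinomial_cov q)"
proof -
  have *: "bounded_linear (\<lambda>h. Abs_l2 (\<lambda>x. q x * l2_fun h x))"
  proof (rule bounded_linear_intro[where K = 1])
    fix h :: "'a l2"
    have "\<bar>q x * l2_fun h x\<bar> \<le> \<bar>l2_fun h x\<bar>" for x
      using subprobability_le_1 q(1) by (simp add: abs_mult mult_left_le_one_le)
    then show "norm (Abs_l2 (\<lambda>x. q x * l2_fun h x)) \<le> norm h * 1"
      by (simp add: norm_l2_mono)
  next
    fix h k :: "'a l2" and c :: real
    show "Abs_l2 (\<lambda>x. q x * l2_fun (h + k) x)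
        = Abs_l2 (\<lambda>x. q x * l2_fun h x) + Abs_l2 (\<lambda>x. q x * l2_fun k x)"
      by (rule l2_eqI, subst l2_fun_add, subst (1 2 3) l2_fun_Abs_subprobability_mult)
        (simp add: algebra_simps)
    show "Abs_l2 (\<lambda>x. q x * l2_fun (c *\<^sub>R h) x) = c *\<^sub>R Abs_l2 (\<lambda>x. q x * l2_fun h x)"
      by (rule l2_eqI, subst l2_fun_scaleR, subst (1 2) l2_fun_Abs_subprobability_mult) simp
  qed
  have "bounded_linear (\<lambda>h. (Abs_l2 q \<bullet> h) *\<^sub>R Abs_l2 q)"
    by (rule bounded_linear_scaleR_const[OF bounded_linear_inner_right])
  from bounded_linear_sub[OF * this] show ?thesis
    by (simp add: multinomial_cov_def[abs_def])
qed

lemma multinomial_cov_basis: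
  "multinomial_cov q (l2_basis i) \<bullet> l2_basis j = q i * (if i = j then 1 else 0) - q i * q j"
  by (auto simp: l2_fun_multinomial_cov)

lemma multinomial_cov_finite:
  assumes "finite D" "h \<in> l2_on D"
  shows "multinomial_cov q h \<bullet> h = (\<Sum>x\<in>D. q x * (l2_fun h x)\<^sup>2) - (\<Sum>x\<in>D. q x * l2_fun h x)\<^sup>2"
proof -
  have 1: "Abs_l2 q \<bullet> h = (\<Sum>x\<in>D. q x * l2_fun h x)"
    using inner_l2_on_finite[OF assms, of "Abs_l2 q"] by (simp add: inner_commute mult.commute)
  have "multinomial_cov q h \<bullet> h = (\<Sum>x\<in>D. l2_fun h x * (q x * l2_fun h x - (Abs_l2 q \<bullet> h) * q x))"
    using inner_l2_on_finite[OF assms, of "multinomial_cov q h"]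
    by (simp add: inner_commute l2_fun_multinomial_cov)
  also have "\<dots> = (\<Sum>x\<in>D. q x * (l2_fun h x)\<^sup>2) - (Abs_l2 q \<bullet> h) * (\<Sum>x\<in>D. q x * l2_fun h x)"
    by (simp add: sum_subtractf sum_distrib_left algebra_simps power2_eq_square)
  finally show ?thesis
    by (simp add: 1 power2_eq_square)
qed

end

section \<open>Fluctuations of the empirical distribution\<close>

text \<open>The cross term factorises by independence and vanishes because the variables are
  centred. Integrability is part of the induction since the next step needs it.\<close>

lemma (in prob_space) expectation_square_sum_indep:
  fixes X :: "nat \<Rightarrow> 'a \<Rightarrow> real"
  assumes indep: "indep_vars (\<lambda>_. borel) X UNIV"
    and i: "\<And>i. integrable M (X i)" "\<And>i. integrable M (\<lambda>\<omega>. (X i \<omega>)\<^sup>2)"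
    and mean: "\<And>i. expectation (X i) = 0"
  shows "integrable M (\<lambda>\<omega>. (\<Sum>i<n. X i \<omega>)\<^sup>2) \<and>
    expectation (\<lambda>\<omega>. (\<Sum>i<n. X i \<omega>)\<^sup>2) = (\<Sum>i<n. expectation (\<lambda>\<omega>. (X i \<omega>)\<^sup>2))"
proof (induction n)
  case (Suc n)
  let ?S = "\<lambda>\<omega>. \<Sum>i<n. X i \<omega>"
  have "indep_var borel (X n) borel ?S"
    by (rule indep_vars_sum) (auto intro: indep_vars_subset[OF indep])
  then have prod: "integrable M (\<lambda>\<omega>. X n \<omega> * ?S \<omega>)"
      "expectation (\<lambda>\<omega>. X n \<omega> * ?S \<omega>) = expectation (X n) * expectation ?S"
    by (rule indep_var_integrable indep_var_lebesgue_integral; use i in simp)+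
  have eq: "(\<Sum>i<Suc n. X i \<omega>)\<^sup>2 = (?S \<omega>)\<^sup>2 + 2 * (X n \<omega> * ?S \<omega>) + (X n \<omega>)\<^sup>2" for \<omega>
    by (simp add: power2_sum algebra_simps)
  show ?case
    unfolding eq using Suc i prod mean by (auto intro!: Bochner_Integration.integrable_add)
qed simp

text \<open>Common point masses encode identical distribution: on a countable set they determine the
  law, which \<open>distr_comp_Z\<close> exploits.\<close>

locale iid_sample = prob_space M for M :: "'w measure" +
  fixes Z :: "nat \<Rightarrow> 'w \<Rightarrow> 'a::countable" and A :: "'a set" and p :: "'a \<Rightarrow> real"
  assumes indep: "indep_vars (\<lambda>_. count_space A) Z {1..}"
    and pmf: "\<And>j x. j \<ge> 1 \<Longrightarrow> x \<in> A \<Longrightarrow> measure M {\<omega> \<in> space M. Z j \<omega> = x} = p x"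
begin

text \<open>\<open>p\<close> is arbitrary outside \<open>A\<close>; its extension by zero is a mass
  function on the whole type.\<close>

definition q :: "'a \<Rightarrow> real"
  where "q x = (if x \<in> A then p x else 0)"

lemma measurable_Z: "Z (Suc j) \<in> measurable M (count_space A)"
  using indep by (auto simp: indep_vars_def)

lemma Z_in: "\<omega> \<in> space M \<Longrightarrow> Z (Suc j) \<omega> \<in> A"
  using measurable_space[OF measurable_Z, of \<omega> j] by simp

lemma measurable_comp_Z: "(\<lambda>\<omega>. g (Z (Suc j) \<omega>)) \<in> borel_measurable M"
  by (rule measurable_compose[OF measurable_Z]) simp

lemma sets_Z_eq [measurable]: "{\<omega> \<in> space M. Z (Suc j) \<omega> = x} \<in> events"
proof -
  have "(\<lambda>\<omega>. if Z (Suc j) \<omega> = x then 1 else 0 :: real) \<in> borel_measurable M"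
    by (rule measurable_comp_Z)
  from measurable_sets[OF this, of "{1}"] show ?thesis
    by (auto simp: vimage_def Int_def conj_commute split: if_splits cong: conj_cong)
qed

lemma prob_Z_eq: "prob {\<omega> \<in> space M. Z (Suc j) \<omega> = x} = q x"
proof (cases "x \<in> A")
  case False
  then have "{\<omega> \<in> space M. Z (Suc j) \<omega> = x} = {}"
    using Z_in by auto
  then show ?thesis using False by (simp only: q_def measure_empty if_False)
qed (simp add: q_def pmf)

lemma q_nonneg: "0 \<le> q x"
  using prob_Z_eq[of 0 x, symmetric] by simp

lemma expectation_finite:
  assumes D: "finite D" and g: "\<And>x. x \<notin> D \<Longrightarrow> g x = 0"
  shows "integrable M (\<lambda>\<omega>. g (Z (Suc j) \<omega>))"
    and "expectation (\<lambda>\<omega>. g (Z (Suc j) \<omega>)) = (\<Sum>x\<in>D. q x * g x)"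
proof -
  have eq: "g (Z (Suc j) \<omega>) = (\<Sum>x\<in>D. g x * indicator {\<omega> \<in> space M. Z (Suc j) \<omega> = x} \<omega>)"
    if "\<omega> \<in> space M" for \<omega>
  proof -
    have "(\<Sum>x\<in>D. g x * indicator {\<omega> \<in> space M. Z (Suc j) \<omega> = x} \<omega>)
        = (\<Sum>x\<in>D. if x = Z (Suc j) \<omega> then g x else 0)"
      using that by (intro sum.cong) auto
    then show ?thesis using D g by (simp add: sum.delta)
  qed
  have i: "integrable M (\<lambda>\<omega>. \<Sum>x\<in>D. g x * indicator {\<omega> \<in> space M. Z (Suc j) \<omega> = x} \<omega>)"
    by (intro Bochner_Integration.integrable_sum integrable_mult_right integrable_real_indicator
        sets_Z_eq) (simp add: emeasure_eq_measure)
  then show "integrable M (\<lambda>\<omega>. g (Z (Suc j) \<omega>))"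
    using eq by (subst Bochner_Integration.integrable_cong[OF refl eq])
  have "expectation (\<lambda>\<omega>. g (Z (Suc j) \<omega>))
      = expectation (\<lambda>\<omega>. \<Sum>x\<in>D. g x * indicator {\<omega> \<in> space M. Z (Suc j) \<omega> = x} \<omega>)"
    by (rule Bochner_Integration.integral_cong[OF refl eq])
  also have "\<dots> = (\<Sum>x\<in>D. g x * prob {\<omega> \<in> space M. Z (Suc j) \<omega> = x})"
    by (subst Bochner_Integration.integral_sum) (simp_all add: emeasure_eq_measure)
  finally show "expectation (\<lambda>\<omega>. g (Z (Suc j) \<omega>)) = (\<Sum>x\<in>D. q x * g x)"
    by (simp add: prob_Z_eq mult.commute)
qed

lemma sum_q_le: "finite E \<Longrightarrow> sum q E \<le> 1"
proof -
  assume E: "finite E"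
  have "sum q E = expectation (\<lambda>\<omega>. (\<lambda>x. if x \<in> E then 1 else 0) (Z (Suc 0) \<omega>))"
    using expectation_finite(2)[OF E, of "\<lambda>x. if x \<in> E then 1 else 0" 0] by simp
  also have "\<dots> \<le> expectation (\<lambda>\<omega>. 1)"
    using expectation_finite(1)[OF E, of "\<lambda>x. if x \<in> E then 1 else 0" 0]
    by (intro integral_mono) auto
  finally show ?thesis by (simp add: prob_space)
qed

lemmas q = q_nonneg sum_q_le

lemma distr_comp_Z: "distr M borel (\<lambda>\<omega>. g (Z (Suc j) \<omega>)) = distr M borel (\<lambda>\<omega>. g (Z (Suc 0) \<omega>))"
proof -
  have "distr M (count_space A) (Z (Suc j)) = distr M (count_space A) (Z (Suc 0))"
  proof (rule measure_eqI_countable[where A = A])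
    fix a assume "a \<in> A"
    have "emeasure (distr M (count_space A) (Z (Suc i))) {a} = ennreal (q a)" for i
      using \<open>a \<in> A\<close> by (subst emeasure_distr[OF measurable_Z])
        (auto simp: emeasure_eq_measure prob_Z_eq[of i, symmetric] vimage_def Int_def conj_commute)
    then show "emeasure (distr M (count_space A) (Z (Suc j))) {a}
        = emeasure (distr M (count_space A) (Z (Suc 0))) {a}" by simp
  qed auto
  moreover have "distr M borel (\<lambda>\<omega>. g (Z (Suc i) \<omega>))
      = distr (distr M (count_space A) (Z (Suc i))) borel g" for i
    by (subst distr_distr[OF _ measurable_Z]) (auto simp: comp_def)
  ultimately show ?thesis by simp
qed

text \<open>Samples are numbered from 1, the central limit theorem takes sequences numbered from 0,
  so independence is reindexed along \<open>Suc\<close>.\<close>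

lemma indep_comp_Z: "indep_vars (\<lambda>_. borel) (\<lambda>i \<omega>. g (Z (Suc i) \<omega>)) (UNIV :: nat set)"
proof -
  have "indep_vars (\<lambda>_. count_space A) (\<lambda>i. Z (Suc i)) UNIV"
    unfolding indep_vars_def2 indep_sets_def
  proof (intro conjI ballI allI impI)
    fix J :: "nat set" and F assume J: "J \<noteq> {}" "finite J"
      and F: "F \<in> (\<Pi> j\<in>J. {Z (Suc j) -` B \<inter> space M |B. B \<in> sets (count_space A)})"
    have F': "(\<lambda>j. F (j - 1)) \<in> (\<Pi> j\<in>Suc ` J. {Z j -` B \<inter> space M |B. B \<in> sets (count_space A)})"
    proof (rule Pi_I)
      fix i assume "i \<in> Suc ` J"
      then obtain j where j: "j \<in> J" "i = Suc j" by blast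
      show "F (i - 1) \<in> {Z i -` B \<inter> space M |B. B \<in> sets (count_space A)}"
        using Pi_mem[OF F j(1)] by (simp only: j(2) diff_Suc_1)
    qed
    have "Suc ` J \<subseteq> {1..}" "Suc ` J \<noteq> {}" "finite (Suc ` J)"
      using J by auto
    then have "prob (\<Inter>j\<in>Suc ` J. F (j - 1)) = (\<Prod>j\<in>Suc ` J. prob (F (j - 1)))"
      using indep F' unfolding indep_vars_def2 indep_sets_def by blast
    then show "prob (\<Inter>j\<in>J. F j) = (\<Prod>j\<in>J. prob (F j))"
      by (simp add: image_image prod.reindex)
  qed (auto intro: measurable_Z measurable_sets[OF measurable_Z])
  from indep_vars_compose2[OF this, of "\<lambda>_. g" "\<lambda>_. borel"]
  show ?thesis by simp
qed

section \<open>The empirical fluctuation as a random element of \<open>l2\<close>\<close>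

lemma to_l2_p: "to_l2 A p = Abs_l2 q"
  by (simp add: to_l2_def q_def[abs_def])

lemma l2_fun_to_l2_p: "l2_fun (to_l2 A p) = q"
  unfolding to_l2_p by (rule l2_fun_Abs_subprobability[OF q])

lemma empirical_square_summable: "(\<lambda>x. (empirical_pmf Z n \<omega> x)\<^sup>2) summable_on B"
proof -
  have zero: "empirical_pmf Z n \<omega> x = 0" if "x \<notin> (\<lambda>j. Z j \<omega>) ` {1..n}" for x
  proof -
    have "(\<Sum>j=1..n. if Z j \<omega> = x then 1 else 0 :: real) = (\<Sum>j=1..n. 0)"
      by (rule sum.cong) (use that in auto)
    then show ?thesis by (simp add: empirical_pmf_def)
  qed
  have "(\<lambda>x. (empirical_pmf Z n \<omega> x)\<^sup>2) summable_on (B \<inter> (\<lambda>j. Z j \<omega>) ` {1..n})"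
    by (rule summable_on_finite) simp
  then show ?thesis
    by (subst summable_on_cong_neutral[where T = "B \<inter> (\<lambda>j. Z j \<omega>) ` {1..n}"
          and g = "\<lambda>x. (empirical_pmf Z n \<omega> x)\<^sup>2"]) (auto simp: zero)
qed

definition empirical_l2 :: "nat \<Rightarrow> 'w \<Rightarrow> 'a l2"
  where "empirical_l2 n \<omega> = to_l2 A (empirical_pmf Z n \<omega>)"

definition fluctuation :: "nat \<Rightarrow> 'w \<Rightarrow> 'a l2"
  where "fluctuation n \<omega> = sqrt (real n) *\<^sub>R (empirical_l2 n \<omega> - to_l2 A p)"

lemma l2_fun_empirical:
  "l2_fun (empirical_l2 n \<omega>) x = (if x \<in> A then empirical_pmf Z n \<omega> x else 0)"
  unfolding empirical_l2_def by (simp add: l2_fun_to_l2[OF empirical_square_summable])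

lemma fluctuation_in_l2_on: "fluctuation n \<omega> \<in> l2_on A"
  by (simp add: l2_on_def fluctuation_def l2_fun_empirical l2_fun_to_l2_p q_def)

text \<open>Off \<open>space M\<close> a sample may take values outside \<open>A\<close>, where the
  fluctuation is cut to 0; hence the restriction on \<omega>.\<close>

lemma l2_fun_fluctuation:
  assumes "\<omega> \<in> space M"
  shows "l2_fun (fluctuation n \<omega>) x
    = (\<Sum>i<n. (if Z (Suc i) \<omega> = x then 1 else 0) - q x) / sqrt (real n)"
proof (cases "x \<in> A")
  case True
  have emp: "empirical_pmf Z n \<omega> x = (\<Sum>i<n. if Z (Suc i) \<omega> = x then 1 else 0) / real n"
    by (simp add: empirical_pmf_def sum.atLeast1_atMost_eq)
  \<comment> \<open>For \<open>n = 0\<close> both sides are 0, because division by zero yields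
    0.\<close>
  have "sqrt (real n) * (c / real n - q x) = (c - real n * q x) / sqrt (real n)" for c
  proof (cases "n = 0")
    case False
    then show ?thesis
      by (simp add: field_simps flip: power2_eq_square)
  qed simp
  then show ?thesis
    using True by (simp add: fluctuation_def l2_fun_empirical l2_fun_to_l2_p emp sum_subtractf)
next
  case False
  then have "Z (Suc i) \<omega> \<noteq> x" for i
    using Z_in[OF assms] by auto
  then show ?thesis
    using False fluctuation_in_l2_on[of n \<omega>] by (simp add: q_def l2_on_def)
qed

text \<open>Finitely supported functionals of the fluctuation are normalised sums of centred i.i.d.
  real variables, the form required by the one-dimensional central limit theorem.\<close>

lemma inner_fluctuation:
  assumes D: "finite D" "h \<in> l2_on D" and \<omega>: "\<omega> \<in> space M"
  shows "h \<bullet> fluctuation n \<omega>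
    = (\<Sum>i<n. l2_fun h (Z (Suc i) \<omega>) - (\<Sum>x\<in>D. q x * l2_fun h x)) / sqrt (real n)"
proof -
  have h: "(\<Sum>x\<in>D. l2_fun h x * (if z = x then 1 else 0)) = l2_fun h z" for z
    using D by (auto simp: if_distrib l2_on_def cong: if_cong)
  have "h \<bullet> fluctuation n \<omega>
      = (\<Sum>x\<in>D. l2_fun h x * (\<Sum>i<n. (if Z (Suc i) \<omega> = x then 1 else 0) - q x)) / sqrt (real n)"
    by (simp only: inner_l2_on_finite[OF D] l2_fun_fluctuation[OF \<omega>] times_divide_eq_right
        sum_divide_distrib[symmetric])
  also have "(\<Sum>x\<in>D. l2_fun h x * (\<Sum>i<n. (if Z (Suc i) \<omega> = x then 1 else 0) - q x))
      = (\<Sum>i<n. \<Sum>x\<in>D. l2_fun h x * ((if Z (Suc i) \<omega> = x then 1 else 0) - q x))"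
    unfolding sum_distrib_left by (rule sum.swap)
  also have "\<dots> = (\<Sum>i<n. l2_fun h (Z (Suc i) \<omega>) - (\<Sum>x\<in>D. q x * l2_fun h x))"
    by (simp add: right_diff_distrib sum_subtractf h mult.commute[of "q _"])
  finally show ?thesis .
qed

lemma measurable_fluctuation [measurable]: "fluctuation n \<in> borel_measurable M"
proof (rule measurable_l2I)
  fix x
  have "(\<lambda>\<omega>. (\<Sum>i<n. (if Z (Suc i) \<omega> = x then 1 else 0) - q x) / sqrt (real n)) \<in> borel_measurable M"
    by (intro borel_measurable_divide borel_measurable_sum borel_measurable_const measurable_comp_Z
        borel_measurable_diff)
  then show "(\<lambda>\<omega>. l2_fun (fluctuation n \<omega>) x) \<in> borel_measurable M"
    by (subst measurable_cong[OF l2_fun_fluctuation])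
qed

text \<open>The summands are centred indicators of variance \<open>q x - (q x)\<^sup>2\<close>; by
  independence the variances add up, and the normalisation cancels their number.\<close>

lemma fluctuation_second_moment:
  "integrable M (\<lambda>\<omega>. (l2_fun (fluctuation n \<omega>) x)\<^sup>2)"
  "expectation (\<lambda>\<omega>. (l2_fun (fluctuation n \<omega>) x)\<^sup>2) \<le> q x"
proof -
  define g where "g = (\<lambda>z. (if z = x then 1 else 0) - q x)"
  have g1: "integrable M (\<lambda>\<omega>. (if Z (Suc i) \<omega> = x then 1 else 0 :: real))"
      "expectation (\<lambda>\<omega>. if Z (Suc i) \<omega> = x then 1 else 0) = q x" for i
    using expectation_finite[of "{x}" "\<lambda>z. if z = x then 1 else 0" i] by auto
  have g_i: "integrable M (\<lambda>\<omega>. g (Z (Suc i) \<omega>))" for i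
    unfolding g_def using g1 by simp
  have g_mean: "expectation (\<lambda>\<omega>. g (Z (Suc i) \<omega>)) = 0" for i
    unfolding g_def using g1 by (simp add: prob_space)
  have sq: "(g z)\<^sup>2 = (1 - 2 * q x) * (if z = x then 1 else 0) + (q x)\<^sup>2" for z
    by (simp add: g_def power2_eq_square algebra_simps)
  have g_i2: "integrable M (\<lambda>\<omega>. (g (Z (Suc i) \<omega>))\<^sup>2)" for i
    unfolding sq using g1 by simp
  have g_var: "expectation (\<lambda>\<omega>. (g (Z (Suc i) \<omega>))\<^sup>2) \<le> q x" for i
  proof -
    have "expectation (\<lambda>\<omega>. (g (Z (Suc i) \<omega>))\<^sup>2) = (1 - 2 * q x) * q x + (q x)\<^sup>2"
      unfolding sq using g1 by (simp add: prob_space)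
    also have "\<dots> = q x - (q x)\<^sup>2"
      by (simp add: power2_eq_square algebra_simps)
    finally show ?thesis by simp
  qed
  note * = expectation_square_sum_indep[OF indep_comp_Z[of g] g_i g_i2 g_mean, of n]
  have eq: "(l2_fun (fluctuation n \<omega>) x)\<^sup>2 = (\<Sum>i<n. g (Z (Suc i) \<omega>))\<^sup>2 / real n" if "\<omega> \<in> space M" for \<omega>
    by (simp add: l2_fun_fluctuation[OF that] g_def power_divide)
  show "integrable M (\<lambda>\<omega>. (l2_fun (fluctuation n \<omega>) x)\<^sup>2)"
    using * by (subst Bochner_Integration.integrable_cong[OF refl eq]) auto
  have "expectation (\<lambda>\<omega>. (l2_fun (fluctuation n \<omega>) x)\<^sup>2)
      = (\<Sum>i<n. expectation (\<lambda>\<omega>. (g (Z (Suc i) \<omega>))\<^sup>2)) / real n"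
    using * by (subst Bochner_Integration.integral_cong[OF refl eq]) auto
  also have "\<dots> \<le> (\<Sum>i<n. q x) / real n"
    by (intro divide_right_mono sum_mono g_var) simp
  also have "\<dots> \<le> q x"
    using q_nonneg by simp
  finally show "expectation (\<lambda>\<omega>. (l2_fun (fluctuation n \<omega>) x)\<^sup>2) \<le> q x" .
qed

lemma cos_fluctuation_tendsto:
  assumes D: "finite D" "h \<in> l2_on D"
  shows "(\<lambda>n. expectation (\<lambda>\<omega>. cos (h \<bullet> fluctuation n \<omega> + c)))
    \<longlonglongrightarrow> (\<integral>z. cos (z + c) \<partial>centred_normal (multinomial_cov q h \<bullet> h))"
proof -
  define m where "m = (\<Sum>x\<in>D. q x * l2_fun h x)"
  define s where "s = multinomial_cov q h \<bullet> h"
  define X where "X = (\<lambda>i \<omega>. l2_fun h (Z (Suc i) \<omega>))"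
  have s: "s = (\<Sum>x\<in>D. q x * (l2_fun h x)\<^sup>2) - m\<^sup>2"
    unfolding s_def m_def by (rule multinomial_cov_finite[OF q D])
  have zero: "l2_fun h x = 0" if "x \<notin> D" for x
    using D(2) that by (simp add: l2_on_def)
  have X1: "integrable M (X i)" "expectation (X i) = m" for i
    using expectation_finite[OF D(1), of "l2_fun h" i] zero by (auto simp: X_def m_def)
  have X2: "integrable M (\<lambda>\<omega>. (X i \<omega>)\<^sup>2)" "expectation (\<lambda>\<omega>. (X i \<omega>)\<^sup>2) = s + m\<^sup>2" for i
    using expectation_finite[OF D(1), of "\<lambda>x. (l2_fun h x)\<^sup>2" i] zero by (auto simp: X_def s)
  have var: "variance (X i) = s" for i
    using variance_eq[OF X1(1) X2(1), of i] by (simp add: X1 X2)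
  have XW: "h \<bullet> fluctuation n \<omega> = (\<Sum>i<n. X i \<omega> - m) / sqrt (real n)" if "\<omega> \<in> space M" for n \<omega>
    using inner_fluctuation[OF D that] by (simp add: X_def m_def)
  have Xm [measurable]: "X i \<in> borel_measurable M" for i
    unfolding X_def by (rule measurable_comp_Z)
  have "0 \<le> s"
    using variance_positive[of "X 0"] by (simp add: var)
  have cosm: "(\<lambda>z::real. cos (a * z + c)) \<in> borel_measurable borel" for a
    by measurable
  interpret std: real_distribution std_normal_distribution
    by (rule real_dist_normal_dist)
  have lim: "(\<integral>z. cos (z + c) \<partial>centred_normal s) = (\<integral>z. cos (sqrt s * z + c) \<partial>std_normal_distribution)"
  proof -
    have m: "(\<lambda>z. sqrt s * z) \<in> measurable std_normal_distribution borel" by measurable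
    have c: "(\<lambda>z::real. cos (z + c)) \<in> borel_measurable borel" by measurable
    show ?thesis
      unfolding centred_normal_def by (rule integral_distr[OF m c])
  qed
  show ?thesis
    unfolding s_def[symmetric] lim
  proof (cases "s = 0")
    \<comment> \<open>The central limit theorem requires positive variance. Here each centred
      summand vanishes almost surely, so the functional and its limit are both degenerate at
      0.\<close>
    case True
    have "AE \<omega> in M. X i \<omega> - m = 0" for i
    proof -
      have i2: "integrable M (\<lambda>\<omega>. (X i \<omega> - m)\<^sup>2)"
        using X1 X2 by (simp add: power2_diff)
      have "expectation (\<lambda>\<omega>. (X i \<omega> - m)\<^sup>2) = 0"
        using var[of i] by (simp add: X1 True)
      then have "AE \<omega> in M. (X i \<omega> - m)\<^sup>2 = 0"
        using integral_nonneg_eq_0_iff_AE[OF i2] by simp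
      then show ?thesis by simp
    qed
    then have "AE \<omega> in M. \<forall>i. X i \<omega> - m = 0"
      by (simp add: AE_all_countable)
    then have "AE \<omega> in M. cos (h \<bullet> fluctuation n \<omega> + c) = cos c" for n
      by (rule AE_mp) (rule AE_I2, use XW in simp)
    then have "expectation (\<lambda>\<omega>. cos (h \<bullet> fluctuation n \<omega> + c)) = expectation (\<lambda>\<omega>. cos c)" for n
      by (intro integral_cong_AE) auto
    then show "(\<lambda>n. expectation (\<lambda>\<omega>. cos (h \<bullet> fluctuation n \<omega> + c)))
        \<longlonglongrightarrow> (\<integral>z. cos (sqrt s * z + c) \<partial>std_normal_distribution)"
      using std.prob_space by (simp add: True prob_space)
  next
    case False
    define \<sigma> where "\<sigma> = sqrt s"
    have \<sigma>: "0 < \<sigma>" "\<sigma>\<^sup>2 = s"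
      using False \<open>0 \<le> s\<close> by (auto simp: \<sigma>_def)
    define T where "T = (\<lambda>n \<omega>. (\<Sum>i<n. X i \<omega> - m) / sqrt (real n * \<sigma>\<^sup>2))"
    have Tm [measurable]: "T n \<in> borel_measurable M" for n
      unfolding T_def by measurable
    have "weak_conv_m (\<lambda>n. distr M borel (T n)) std_normal_distribution"
      unfolding T_def
    proof (rule central_limit_theorem[where \<mu> = "distr M borel (X 0)"])
      show "indep_vars (\<lambda>_. borel) X UNIV"
        unfolding X_def by (rule indep_comp_Z)
      show "distr M borel (X n) = distr M borel (X 0)" for n
        unfolding X_def by (rule distr_comp_Z)
    qed (use X1 X2 var \<sigma> in auto)
    then have "(\<lambda>n. \<integral>z. cos (\<sigma> * z + c) \<partial>distr M borel (T n))
        \<longlonglongrightarrow> (\<integral>z. cos (\<sigma> * z + c) \<partial>std_normal_distribution)"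
      by (intro weak_conv_imp_integral_bdd_continuous_conv[where B = 1]
          real_distribution_distr Tm) (auto simp: real_dist_normal_dist)
    moreover have "(\<integral>z. cos (\<sigma> * z + c) \<partial>distr M borel (T n))
        = expectation (\<lambda>\<omega>. cos (h \<bullet> fluctuation n \<omega> + c))" for n
    proof -
      have "(\<integral>z. cos (\<sigma> * z + c) \<partial>distr M borel (T n)) = expectation (\<lambda>\<omega>. cos (\<sigma> * T n \<omega> + c))"
        by (rule integral_distr[OF Tm cosm])
      also have "\<dots> = expectation (\<lambda>\<omega>. cos (h \<bullet> fluctuation n \<omega> + c))"
      proof (rule Bochner_Integration.integral_cong[OF refl])
        fix \<omega> assume "\<omega> \<in> space M"
        then show "cos (\<sigma> * T n \<omega> + c) = cos (h \<bullet> fluctuation n \<omega> + c)"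
          using \<sigma>(1) by (simp add: XW T_def real_sqrt_mult)
      qed
      finally show ?thesis .
    qed
    ultimately show "(\<lambda>n. expectation (\<lambda>\<omega>. cos (h \<bullet> fluctuation n \<omega> + c)))
        \<longlonglongrightarrow> (\<integral>z. cos (sqrt s * z + c) \<partial>std_normal_distribution)"
      by (simp add: \<sigma>_def)
  qed
qed

end

section \<open>Existence of the Gaussian limit\<close>

lemma ex_std_normal_sequence:
  obtains \<Omega> :: "(nat \<Rightarrow> real) measure" and \<xi>
  where "prob_space \<Omega>" "prob_space.indep_vars \<Omega> (\<lambda>_. borel) \<xi> UNIV"
    "\<And>i::nat. distr \<Omega> borel (\<xi> i) = std_normal_distribution"
proof
  let ?\<Omega> = "\<Pi>\<^sub>M i\<in>(UNIV :: nat set). std_normal_distribution"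
  interpret std: real_distribution std_normal_distribution
    by (rule real_dist_normal_dist)
  show \<Omega>: "prob_space ?\<Omega>"
    by (rule prob_space_PiM) (rule std.prob_space_axioms)
  then interpret \<Omega>: prob_space ?\<Omega> .
  have comp: "distr ?\<Omega> borel (\<lambda>\<omega>. \<omega> i) = std_normal_distribution" for i :: nat
  proof -
    have "distr ?\<Omega> borel (\<lambda>\<omega>. \<omega> i) = distr ?\<Omega> std_normal_distribution (\<lambda>\<omega>. \<omega> i)"
      by (rule distr_cong) auto
    also have "\<dots> = std_normal_distribution"
      by (rule distr_PiM_component[of UNIV "\<lambda>_. std_normal_distribution"])
        (auto intro: std.prob_space_axioms)
    finally show ?thesis .
  qed
  then show "distr ?\<Omega> borel ((\<lambda>i \<omega>. \<omega> i) i) = std_normal_distribution" for i :: nat .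
  have sets: "sets ?\<Omega> = sets (\<Pi>\<^sub>M i\<in>(UNIV :: nat set). (borel :: real measure))"
    by (rule sets_PiM_cong) auto
  have m: "(\<lambda>\<omega>. \<omega> i) \<in> borel_measurable ?\<Omega>" for i :: nat
    using measurable_component_singleton[of i UNIV "\<lambda>_. std_normal_distribution"]
    by (simp cong: measurable_cong_sets)
  show "\<Omega>.indep_vars (\<lambda>_. borel) (\<lambda>i \<omega>. \<omega> i) UNIV"
    by (subst \<Omega>.indep_vars_iff_distr_eq_PiM'[OF UNIV_not_empty m])
      (simp only: comp restrict_UNIV distr_id2[OF sets[symmetric]])
qed

text \<open>The Cholesky factor of the matrix with entries \<open>r i * \<delta>(i, j) - r i * r j\<close>.\<close>

definition tail_mass :: "(nat \<Rightarrow> real) \<Rightarrow> nat \<Rightarrow> real"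
  where "tail_mass r k = 1 - (\<Sum>j<k. r j)"

definition cholesky :: "(nat \<Rightarrow> real) \<Rightarrow> nat \<Rightarrow> nat \<Rightarrow> real"
  where "cholesky r k j =
    (if j = k then sqrt (r k * tail_mass r (Suc k) / tail_mass r k)
     else if k < j then - r j * sqrt (r k / (tail_mass r k * tail_mass r (Suc k))) else 0)"

context
  fixes r :: "nat \<Rightarrow> real"
  assumes r: "\<And>k. 0 \<le> r k" "\<And>n. (\<Sum>k<n. r k) \<le> 1"
begin

lemma tail_mass_Suc: "tail_mass r (Suc k) = tail_mass r k - r k"
  by (simp add: tail_mass_def)

lemma tail_mass_nonneg: "0 \<le> tail_mass r k"
  using r(2)[of k] by (simp add: tail_mass_def)

lemma tail_mass_antimono: "i \<le> j \<Longrightarrow> tail_mass r j \<le> tail_mass r i"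
proof (induction rule: dec_induct)
  case (step n)
  then show ?case using r(1)[of n] by (simp add: tail_mass_Suc)
qed simp

lemma le_tail_mass: "i \<le> j \<Longrightarrow> r j \<le> tail_mass r i"
  using tail_mass_antimono[of i j] tail_mass_nonneg[of "Suc j"] by (simp add: tail_mass_Suc)

lemma cholesky_zero: "r j = 0 \<Longrightarrow> cholesky r k j = 0"
  by (auto simp: cholesky_def)

text \<open>With t k = \<open>tail_mass r k\<close>, the terms below \<open>i\<close> telescope
  because r k / (t k * t (k+1)) = 1 / t (k+1) - 1 / t k, and t 0 = 1. The term \<open>k = i\<close>
  supplies what is missing from the covariance entry.\<close>

lemma cholesky_product_le:
  assumes "i \<le> j"
  shows "(\<Sum>k\<le>i. cholesky r k i * cholesky r k j) = (if i = j then r i else 0) - r i * r j"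
proof (cases "r i = 0")
  case True
  then show ?thesis by (auto simp: cholesky_zero)
next
  case False
  then have "0 < r i" using r(1)[of i] by simp
  then have t: "0 < tail_mass r k" if "k \<le> i" for k
    using le_tail_mass[OF that] by linarith
  have "cholesky r k i * cholesky r k j
      = r i * r j * (1 / tail_mass r (Suc k) - 1 / tail_mass r k)" if "k < i" for k
  proof -
    have t': "0 < tail_mass r k" "0 < tail_mass r (Suc k)"
      using t[of k] t[of "Suc k"] that by auto
    have "cholesky r k i = - r i * sqrt (r k / (tail_mass r k * tail_mass r (Suc k)))"
      "cholesky r k j = - r j * sqrt (r k / (tail_mass r k * tail_mass r (Suc k)))"
      using that assms by (simp_all add: cholesky_def)
    then have "cholesky r k i * cholesky r k j
        = r i * r j * (sqrt (r k / (tail_mass r k * tail_mass r (Suc k))))\<^sup>2"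
      by algebra
    also have "(sqrt (r k / (tail_mass r k * tail_mass r (Suc k))))\<^sup>2
        = r k / (tail_mass r k * tail_mass r (Suc k))"
      using r(1)[of k] t' by simp
    also have "\<dots> = 1 / tail_mass r (Suc k) - 1 / tail_mass r k"
      using t' by (simp add: tail_mass_Suc field_simps)
    finally show ?thesis .
  qed
  then have "(\<Sum>k<i. cholesky r k i * cholesky r k j)
      = r i * r j * (\<Sum>k<i. 1 / tail_mass r (Suc k) - 1 / tail_mass r k)"
    by (simp add: sum_distrib_left)
  also have "(\<Sum>k<i. 1 / tail_mass r (Suc k) - 1 / tail_mass r k) = 1 / tail_mass r i - 1"
    by (subst sum_lessThan_telescope) (simp add: tail_mass_def)
  finally have low: "(\<Sum>k<i. cholesky r k i * cholesky r k j) = r i * r j * (1 / tail_mass r i - 1)" .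
  have diag: "cholesky r i i * cholesky r i j
      = (if i = j then r i - (r i)\<^sup>2 / tail_mass r i else - (r i * r j / tail_mass r i))"
  proof (cases "i = j")
    case True
    have "cholesky r i i * cholesky r i i = r i * tail_mass r (Suc i) / tail_mass r i"
      using r(1)[of i] t[of i] tail_mass_nonneg[of "Suc i"] by (simp add: cholesky_def)
    also have "\<dots> = r i - (r i)\<^sup>2 / tail_mass r i"
      using t[of i] by (simp add: tail_mass_Suc field_simps power2_eq_square)
    finally show ?thesis using True by simp
  next
    case False
    show ?thesis
    proof (cases "tail_mass r (Suc i) = 0")
      \<comment> \<open>The mass is exhausted after \<open>i\<close>, so \<open>r j = 0\<close>, and
        the division by zero in the entry is harmless.\<close>
      case True
      then have "r j = 0"
        using le_tail_mass[of "Suc i" j] r(1)[of j] False assms by simp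
      then show ?thesis using False by (simp add: cholesky_zero)
    next
      case nz: False
      have product: "x * y = - c * z" if "x = a" "y = - c * b" "z = a * b" for x y z a b c :: real
        using that by simp
      have c: "cholesky r i i = sqrt (r i * tail_mass r (Suc i) / tail_mass r i)"
        "cholesky r i j = - r j * sqrt (r i / (tail_mass r i * tail_mass r (Suc i)))"
        using False assms by (simp_all add: cholesky_def)
      have "cholesky r i i * cholesky r i j = - r j *
          sqrt ((r i * tail_mass r (Suc i) / tail_mass r i) * (r i / (tail_mass r i * tail_mass r (Suc i))))"
        by (rule product[OF c real_sqrt_mult])
      also have "(r i * tail_mass r (Suc i) / tail_mass r i) * (r i / (tail_mass r i * tail_mass r (Suc i)))
          = (r i / tail_mass r i)\<^sup>2"
        using nz by (simp add: power2_eq_square)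
      also have "sqrt ((r i / tail_mass r i)\<^sup>2) = r i / tail_mass r i"
        using r(1)[of i] t[of i] by simp
      finally show ?thesis using False by (simp add: mult.commute)
    qed
  qed
  have "(\<Sum>k\<le>i. cholesky r k i * cholesky r k j)
      = r i * r j * (1 / tail_mass r i - 1) + cholesky r i i * cholesky r i j"
    by (simp add: lessThan_Suc_atMost[symmetric] low)
  also have "\<dots> = (if i = j then r i else 0) - r i * r j"
    unfolding diag by (auto simp: algebra_simps power2_eq_square)
  finally show ?thesis .
qed

lemma cholesky_product:
  assumes "i < n" "j < n"
  shows "(\<Sum>k<n. cholesky r k i * cholesky r k j) = (if i = j then r i else 0) - r i * r j"
proof -
  have *: "(\<Sum>k<n. cholesky r k i * cholesky r k j) = (if i = j then r i else 0) - r i * r j"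
    if "i \<le> j" "j < n" for i j
  proof -
    have "(\<Sum>k<n. cholesky r k i * cholesky r k j) = (\<Sum>k\<le>i. cholesky r k i * cholesky r k j)"
      by (rule sum.mono_neutral_right) (use that in \<open>auto simp: cholesky_def\<close>)
    then show ?thesis using cholesky_product_le[OF that(1)] by simp
  qed
  show ?thesis
    using *[of i j] *[of j i] assms by (cases "i \<le> j") (auto simp: mult.commute)
qed

lemma cholesky_quadratic_form:
  "(\<Sum>k<n. (\<Sum>j<n. c j * cholesky r k j)\<^sup>2) = (\<Sum>j<n. r j * (c j)\<^sup>2) - (\<Sum>j<n. r j * c j)\<^sup>2"
proof -
  have "(\<Sum>k<n. (\<Sum>j<n. c j * cholesky r k j)\<^sup>2)
      = (\<Sum>k<n. \<Sum>i<n. \<Sum>j<n. c i * c j * (cholesky r k i * cholesky r k j))"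
    by (simp add: power2_eq_square sum_product mult_ac)
  also have "\<dots> = (\<Sum>i<n. \<Sum>k<n. \<Sum>j<n. c i * c j * (cholesky r k i * cholesky r k j))"
    by (rule sum.swap)
  also have "\<dots> = (\<Sum>i<n. \<Sum>j<n. \<Sum>k<n. c i * c j * (cholesky r k i * cholesky r k j))"
    by (intro sum.cong refl sum.swap)
  also have "\<dots> = (\<Sum>i<n. \<Sum>j<n. c i * c j * ((if i = j then r i else 0) - r i * r j))"
    unfolding sum_distrib_left[symmetric]
    by (intro sum.cong refl arg_cong2[where f = "(*)"] cholesky_product) auto
  also have "\<dots> = (\<Sum>i<n. \<Sum>j<n. if i = j then r i * (c i)\<^sup>2 else 0)
      - (\<Sum>i<n. \<Sum>j<n. (r i * c i) * (r j * c j))"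
    unfolding sum_subtractf[symmetric]
    by (intro sum.cong refl) (auto simp: algebra_simps power2_eq_square)
  also have "\<dots> = (\<Sum>j<n. r j * (c j)\<^sup>2) - (\<Sum>j<n. r j * c j)\<^sup>2"
    by (simp add: sum_product[symmetric] power2_eq_square)
  finally show ?thesis .
qed

end

text \<open>Characteristic functions treat vanishing weights \<open>b k\<close>, whose summands have
  no density, together with the others.\<close>

lemma (in prob_space) distr_sum_std_normal:
  fixes \<xi> :: "nat \<Rightarrow> 'a \<Rightarrow> real"
  assumes indep: "indep_vars (\<lambda>_. borel) \<xi> UNIV"
    and std: "\<And>i. distr M borel (\<xi> i) = std_normal_distribution"
  shows "distr M borel (\<lambda>\<omega>. \<Sum>k<n. b k * \<xi> k \<omega>) = centred_normal (\<Sum>k<n. (b k)\<^sup>2)"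
proof (rule Levy_uniqueness)
  have m [measurable]: "\<xi> k \<in> borel_measurable M" for k
    using indep by (auto simp: indep_vars_def)
  show "real_distribution (distr M borel (\<lambda>\<omega>. \<Sum>k<n. b k * \<xi> k \<omega>))"
    by (rule real_distribution_distr) measurable
  show "real_distribution (centred_normal (\<Sum>k<n. (b k)\<^sup>2))"
    by (rule real_distribution_centred_normal)
  have indep': "indep_vars (\<lambda>_. borel) (\<lambda>k \<omega>. b k * \<xi> k \<omega>) {..<n}"
    by (rule indep_vars_compose2[OF indep_vars_subset[OF indep]]) auto
  have comp: "char (distr M borel (\<lambda>\<omega>. b k * \<xi> k \<omega>)) t = exp (- ((b k)\<^sup>2 * t\<^sup>2) / 2)" for k t
  proof -
    have "char (distr M borel (\<lambda>\<omega>. b k * \<xi> k \<omega>)) t = char (distr M borel (\<xi> k)) (t * b k)"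
      unfolding char_def by (subst (1 2) integral_distr) (auto simp: mult.assoc)
    then show ?thesis
      by (simp add: std char_std_normal_distribution power_mult_distrib mult.commute)
  qed
  show "char (distr M borel (\<lambda>\<omega>. \<Sum>k<n. b k * \<xi> k \<omega>)) = char (centred_normal (\<Sum>k<n. (b k)\<^sup>2))"
  proof
    fix t
    have "char (distr M borel (\<lambda>\<omega>. \<Sum>k<n. b k * \<xi> k \<omega>)) t
        = (\<Prod>k<n. complex_of_real (exp (- ((b k)\<^sup>2 * t\<^sup>2) / 2)))"
      using char_distr_sum[OF indep', of t] by (simp add: comp)
    also have "\<dots> = exp (- ((\<Sum>k<n. (b k)\<^sup>2) * t\<^sup>2) / 2)"
      by (simp add: exp_sum[symmetric] sum_negf sum_divide_distrib sum_distrib_right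
          flip: of_real_prod)
    also have "\<dots> = char (centred_normal (\<Sum>k<n. (b k)\<^sup>2)) t"
      by (rule char_centred_normal[symmetric]) (simp add: sum_nonneg)
    finally show "char (distr M borel (\<lambda>\<omega>. \<Sum>k<n. b k * \<xi> k \<omega>)) t
        = char (centred_normal (\<Sum>k<n. (b k)\<^sup>2)) t" .
  qed
qed

text \<open>Transfers sums to the naturals, where the triangular factor lives. The encoding need not
  be surjective, and numbers that encode nothing contribute 0.\<close>

lemma sum_initial_part:
  fixes f :: "'a::countable \<Rightarrow> real"
  shows "sum f (initial_part k) = (\<Sum>j<k. if j \<in> range (to_nat :: 'a \<Rightarrow> nat) then f (from_nat j) else 0)"
proof -
  have "(\<Sum>j<k. if j \<in> range (to_nat :: 'a \<Rightarrow> nat) then f (from_nat j) else 0)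
      = (\<Sum>j\<in>to_nat ` (initial_part k :: 'a set). f (from_nat j))"
    by (rule sum.mono_neutral_cong_right) (auto simp: initial_part_def)
  also have "\<dots> = sum f (initial_part k)"
    by (subst sum.reindex) (auto simp: inj_on_def)
  finally show ?thesis by simp
qed

text \<open>The coordinates \<open>G j\<close> are finite combinations of the normals by
  triangularity. Their squares have summable expectations, so the path is almost surely square
  summable; on the exceptional event \<open>Y\<close> is set to 0. Laws are computed for finitely
  supported functionals and then passed to the limit.\<close>

lemma ex_gaussian_l2:
  fixes q :: "'a::countable \<Rightarrow> real"
  assumes q: "\<And>x. 0 \<le> q x" "\<And>E. finite E \<Longrightarrow> sum q E \<le> 1" and q0: "\<And>x. x \<notin> A \<Longrightarrow> q x = 0"
  obtains \<Omega> :: "(nat \<Rightarrow> real) measure" and Y where "prob_space \<Omega>" "Y \<in> borel_measurable \<Omega>"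
    "\<And>\<omega>. Y \<omega> \<in> l2_on A"
    "\<And>h. 0 \<le> multinomial_cov q h \<bullet> h"
    "\<And>h. distr \<Omega> borel (\<lambda>\<omega>. Y \<omega> \<bullet> h) = centred_normal (multinomial_cov q h \<bullet> h)"
proof -
  obtain \<Omega> :: "(nat \<Rightarrow> real) measure" and \<xi> where \<Omega>: "prob_space \<Omega>"
    and indep: "prob_space.indep_vars \<Omega> (\<lambda>_. borel) \<xi> (UNIV :: nat set)"
    and std: "\<And>i. distr \<Omega> borel (\<xi> i) = std_normal_distribution"
    using ex_std_normal_sequence by blast
  interpret \<Omega>: prob_space \<Omega> by (rule \<Omega>)
  have \<xi> [measurable]: "\<xi> k \<in> borel_measurable \<Omega>" for k
    using indep by (auto simp: \<Omega>.indep_vars_def)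
  define up :: "('a \<Rightarrow> real) \<Rightarrow> nat \<Rightarrow> real"
    where "up = (\<lambda>f j. if j \<in> range (to_nat :: 'a \<Rightarrow> nat) then f (from_nat j) else 0)"
  have sum_up: "sum f (initial_part k) = (\<Sum>j<k. up f j)" for f k
    unfolding up_def by (rule sum_initial_part)
  define r where "r = up q"
  have r: "0 \<le> r k" "(\<Sum>k<n. r k) \<le> 1" for k n
  proof -
    show "0 \<le> r k"
      using q(1) by (simp add: r_def up_def)
    show "(\<Sum>k<n. r k) \<le> 1"
      unfolding r_def sum_up[symmetric] by (rule q(2)) simp
  qed
  define G where "G = (\<lambda>j \<omega>. \<Sum>k\<le>j. cholesky r k j * \<xi> k \<omega>)"
  have Gm [measurable]: "G j \<in> borel_measurable \<Omega>" for j
    unfolding G_def by measurable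
  have G_eq: "G j \<omega> = (\<Sum>k<n. cholesky r k j * \<xi> k \<omega>)" if "j < n" for j n \<omega>
    unfolding G_def by (rule sum.mono_neutral_left) (use that in \<open>auto simp: cholesky_def\<close>)
  \<comment> \<open>Holds for every \<omega> and not only almost surely, since the whole column of
    the factor is 0; this puts \<open>Y \<omega>\<close> into \<open>l2_on A\<close>
    everywhere.\<close>
  have G0: "G j \<omega> = 0" if "r j = 0" for j \<omega>
    unfolding G_def by (simp add: cholesky_zero[OF r that])
  have law: "distr \<Omega> borel (\<lambda>\<omega>. \<Sum>j<n. c j * G j \<omega>)
      = centred_normal ((\<Sum>j<n. r j * (c j)\<^sup>2) - (\<Sum>j<n. r j * c j)\<^sup>2)" for c n
  proof -
    have "(\<Sum>j<n. c j * G j \<omega>) = (\<Sum>k<n. (\<Sum>j<n. c j * cholesky r k j) * \<xi> k \<omega>)" for \<omega>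
    proof -
      have "(\<Sum>j<n. c j * G j \<omega>) = (\<Sum>j<n. \<Sum>k<n. c j * cholesky r k j * \<xi> k \<omega>)"
        by (rule sum.cong) (auto simp: G_eq sum_distrib_left mult.assoc)
      also have "\<dots> = (\<Sum>k<n. \<Sum>j<n. c j * cholesky r k j * \<xi> k \<omega>)"
        by (rule sum.swap)
      finally show ?thesis by (simp add: sum_distrib_right)
    qed
    then show ?thesis
      using \<Omega>.distr_sum_std_normal[OF indep std, where n = n
          and b = "\<lambda>k. \<Sum>j<n. c j * cholesky r k j"]
      by (simp only: cholesky_quadratic_form[OF r])
  qed
  have nn: "0 \<le> (\<Sum>j<n. r j * (c j)\<^sup>2) - (\<Sum>j<n. r j * c j)\<^sup>2" for c n
  proof -
    have "0 \<le> (\<Sum>k<n. (\<Sum>j<n. c j * cholesky r k j)\<^sup>2)"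
      by (simp add: sum_nonneg)
    then show ?thesis
      by (simp only: cholesky_quadratic_form[OF r])
  qed
  \<comment> \<open>Stated with the nonnegative integral so that it can be summed over
    \<open>j\<close> before any integrability of the sum is known.\<close>
  have second: "(\<integral>\<^sup>+\<omega>. ennreal ((G j \<omega>)\<^sup>2) \<partial>\<Omega>) \<le> ennreal (r j)" for j
  proof -
    let ?c = "\<lambda>i. if i = j then 1 else 0 :: real"
    let ?s = "(\<Sum>i<Suc j. r i * (?c i)\<^sup>2) - (\<Sum>i<Suc j. r i * ?c i)\<^sup>2"
    have s: "?s = r j - (r j)\<^sup>2"
      by (simp add: if_distrib cong: if_cong)
    have eq: "distr \<Omega> borel (G j) = centred_normal ?s"
    proof -
      have "distr \<Omega> borel (\<lambda>\<omega>. \<Sum>i<Suc j. ?c i * G i \<omega>) = centred_normal ?s"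
        by (rule law)
      moreover have "(\<Sum>i<Suc j. ?c i * G i \<omega>) = G j \<omega>" for \<omega>
        by (simp add: if_distrib cong: if_cong)
      ultimately show ?thesis by (simp only:)
    qed
    have s_nn: "0 \<le> ?s"
      by (rule nn)
    have "(\<integral>\<^sup>+\<omega>. ennreal ((G j \<omega>)\<^sup>2) \<partial>\<Omega>) = (\<integral>\<^sup>+x. ennreal (x\<^sup>2) \<partial>distr \<Omega> borel (G j))"
      by (rule nn_integral_distr[symmetric]) auto
    also have "\<dots> = ennreal ?s"
      unfolding eq using centred_normal_moments(3,4)[OF s_nn]
      by (subst nn_integral_eq_integral) auto
    also have "\<dots> \<le> ennreal (r j)"
      unfolding s by (rule ennreal_leI) simp
    finally show ?thesis .
  qed
  have fin: "AE \<omega> in \<Omega>. (\<Sum>j. ennreal ((G j \<omega>)\<^sup>2)) \<noteq> \<infinity>"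
  proof (rule nn_integral_noteq_infinite)
    have "(\<integral>\<^sup>+\<omega>. (\<Sum>j. ennreal ((G j \<omega>)\<^sup>2)) \<partial>\<Omega>) = (\<Sum>j. \<integral>\<^sup>+\<omega>. ennreal ((G j \<omega>)\<^sup>2) \<partial>\<Omega>)"
      by (rule nn_integral_suminf) measurable
    also have "\<dots> \<le> (\<Sum>j. ennreal (r j))"
      by (rule suminf_le[OF second]) auto
    also have "\<dots> < \<infinity>"
    proof -
      have "summable r"
        by (rule summableI_nonneg_bounded[of _ 1]) (use r in auto)
      then show ?thesis
        unfolding infinity_ennreal_def less_top[symmetric]
        by (rule ennreal_suminf_neq_top[OF _ r(1)])
    qed
    finally show "(\<integral>\<^sup>+\<omega>. (\<Sum>j. ennreal ((G j \<omega>)\<^sup>2)) \<partial>\<Omega>) \<noteq> \<infinity>" by simp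
  qed measurable
  define good where "good = (\<lambda>\<omega>. (\<Sum>j. ennreal ((G j \<omega>)\<^sup>2)) \<noteq> \<infinity>)"
  have [measurable]: "Measurable.pred \<Omega> good"
    unfolding good_def by measurable
  define Y :: "(nat \<Rightarrow> real) \<Rightarrow> 'a l2"
    where "Y = (\<lambda>\<omega>. Abs_l2 (\<lambda>x. if good \<omega> then G (to_nat x) \<omega> else 0))"
  have Y: "l2_fun (Y \<omega>) x = (if good \<omega> then G (to_nat x) \<omega> else 0)" for \<omega> x
  proof -
    have "(\<lambda>x::'a. (if good \<omega> then G (to_nat x) \<omega> else 0)\<^sup>2) summable_on UNIV"
    proof (cases "good \<omega>")
      case True
      then have sm: "summable (\<lambda>j. (G j \<omega>)\<^sup>2)"
        by (intro summable_suminf_not_top) (auto simp: good_def)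
      have "(\<lambda>x::'a. (G (to_nat x) \<omega>)\<^sup>2) summable_on UNIV"
      proof (rule square_summable_onI)
        fix D :: "'a set" assume "finite D"
        have "(\<Sum>x\<in>D. (G (to_nat x) \<omega>)\<^sup>2) = (\<Sum>j\<in>to_nat ` D. (G j \<omega>)\<^sup>2)"
          by (subst sum.reindex) (auto simp: inj_on_def)
        also have "\<dots> \<le> (\<Sum>j. (G j \<omega>)\<^sup>2)"
          by (rule sum_le_suminf[OF sm]) (use \<open>finite D\<close> in auto)
        finally show "(\<Sum>x\<in>D. (G (to_nat x) \<omega>)\<^sup>2) \<le> (\<Sum>j. (G j \<omega>)\<^sup>2)" .
      qed
      then show ?thesis using True by simp
    qed simp
    from l2_fun_Abs[OF this] show ?thesis by (simp add: Y_def)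
  qed
  have Ym [measurable]: "Y \<in> borel_measurable \<Omega>"
    by (rule measurable_l2I) (simp add: Y)
  have YA: "Y \<omega> \<in> l2_on A" for \<omega>
    by (auto simp: l2_on_def Y q0 r_def up_def intro!: G0)
  define s where "s = (\<lambda>h :: 'a l2. multinomial_cov q h \<bullet> h)"
  define H where "H = (\<lambda>k. l2_restrict (initial_part k) :: 'a l2 \<Rightarrow> 'a l2)"
  have sH: "s (H k h) = (\<Sum>j<k. r j * (up (l2_fun h) j)\<^sup>2) - (\<Sum>j<k. r j * up (l2_fun h) j)\<^sup>2" for k h
  proof -
    have "H k h \<in> l2_on (initial_part k)"
      by (simp add: H_def l2_restrict_in_l2_on)
    note multinomial_cov_finite[OF q finite_initial_part this]
    moreover have "(\<Sum>x\<in>initial_part k. q x * (l2_fun (H k h) x)\<^sup>2) = (\<Sum>j<k. r j * (up (l2_fun h) j)\<^sup>2)"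
    proof -
      have "(\<Sum>x\<in>initial_part k. q x * (l2_fun (H k h) x)\<^sup>2) = (\<Sum>x\<in>initial_part k. q x * (l2_fun h x)\<^sup>2)"
        by (rule sum.cong) (auto simp: H_def)
      also have "\<dots> = (\<Sum>j<k. r j * (up (l2_fun h) j)\<^sup>2)"
        unfolding sum_up by (rule sum.cong) (auto simp: up_def r_def)
      finally show ?thesis .
    qed
    moreover have "(\<Sum>x\<in>initial_part k. q x * l2_fun (H k h) x) = (\<Sum>j<k. r j * up (l2_fun h) j)"
    proof -
      have "(\<Sum>x\<in>initial_part k. q x * l2_fun (H k h) x) = (\<Sum>x\<in>initial_part k. q x * l2_fun h x)"
        by (rule sum.cong) (auto simp: H_def)
      also have "\<dots> = (\<Sum>j<k. r j * up (l2_fun h) j)"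
        unfolding sum_up by (rule sum.cong) (auto simp: up_def r_def)
      finally show ?thesis .
    qed
    ultimately show ?thesis by (simp add: s_def)
  qed
  have H_lim: "(\<lambda>k. H k h) \<longlonglongrightarrow> h" for h
    unfolding H_def by (rule tendsto_l2_restrict_initial_part)
  have s_lim: "(\<lambda>k. s (H k h)) \<longlonglongrightarrow> s h" for h
    unfolding s_def
    by (intro tendsto_inner bounded_linear.tendsto[OF bounded_linear_multinomial_cov[OF q]] H_lim)
  have s_nn: "0 \<le> s h" for h
  proof (rule LIMSEQ_le_const[OF s_lim])
    have "0 \<le> s (H k h)" for k
      unfolding sH by (rule nn)
    then show "\<exists>K. \<forall>k\<ge>K. 0 \<le> s (H k h)" by blast
  qed
  have law_H: "distr \<Omega> borel (\<lambda>\<omega>. Y \<omega> \<bullet> H k h) = centred_normal (s (H k h))" for k h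
  proof -
    have eq: "AE \<omega> in \<Omega>. Y \<omega> \<bullet> H k h = (\<Sum>j<k. up (l2_fun h) j * G j \<omega>)"
      using fin unfolding good_def[symmetric]
    proof (rule AE_mp, intro AE_I2 impI)
      fix \<omega> assume good: "good \<omega>"
      have "Y \<omega> \<bullet> H k h = (\<Sum>x\<in>initial_part k. l2_fun (H k h) x * l2_fun (Y \<omega>) x)"
        unfolding inner_commute[of "Y \<omega>"]
        by (rule inner_l2_on_finite) (auto simp: H_def l2_restrict_in_l2_on)
      also have "\<dots> = (\<Sum>x\<in>initial_part k. l2_fun h x * G (to_nat x) \<omega>)"
        by (rule sum.cong) (auto simp: H_def Y good)
      also have "\<dots> = (\<Sum>j<k. up (l2_fun h) j * G j \<omega>)"
        unfolding sum_up by (rule sum.cong) (auto simp: up_def)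
      finally show "Y \<omega> \<bullet> H k h = (\<Sum>j<k. up (l2_fun h) j * G j \<omega>)" .
    qed
    have "distr \<Omega> borel (\<lambda>\<omega>. Y \<omega> \<bullet> H k h) = distr \<Omega> borel (\<lambda>\<omega>. \<Sum>j<k. up (l2_fun h) j * G j \<omega>)"
      by (rule distr_cong_AE[OF refl refl eq]) measurable
    then show ?thesis
      by (simp add: law sH)
  qed
  \<comment> \<open>For general \<open>h\<close>, characteristic functions are followed along the
    truncations \<open>H k h\<close>: dominated convergence on one side, continuity of the
    covariance form on the other.\<close>
  have "distr \<Omega> borel (\<lambda>\<omega>. Y \<omega> \<bullet> h) = centred_normal (s h)" for h
  proof (rule Levy_uniqueness)
    show "real_distribution (distr \<Omega> borel (\<lambda>\<omega>. Y \<omega> \<bullet> h))"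
      by (rule \<Omega>.real_distribution_distr) measurable
    show "real_distribution (centred_normal (s h))"
      by (rule real_distribution_centred_normal)
    show "char (distr \<Omega> borel (\<lambda>\<omega>. Y \<omega> \<bullet> h)) = char (centred_normal (s h))"
    proof
      fix t
      have char: "char (distr \<Omega> borel (\<lambda>\<omega>. Y \<omega> \<bullet> g)) t = (CLINT \<omega>|\<Omega>. iexp (t * (Y \<omega> \<bullet> g)))" for g
        unfolding char_def by (rule integral_distr) measurable
      have lim1: "(\<lambda>k. CLINT \<omega>|\<Omega>. iexp (t * (Y \<omega> \<bullet> H k h))) \<longlonglongrightarrow> (CLINT \<omega>|\<Omega>. iexp (t * (Y \<omega> \<bullet> h)))"
      proof (rule integral_dominated_convergence[where w = "\<lambda>_. 1"])
        show "AE \<omega> in \<Omega>. (\<lambda>k. iexp (t * (Y \<omega> \<bullet> H k h))) \<longlonglongrightarrow> iexp (t * (Y \<omega> \<bullet> h))"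
          by (intro AE_I2 tendsto_intros H_lim)
      qed auto
      have lim2: "(\<lambda>k. complex_of_real (exp (- (s (H k h) * t\<^sup>2) / 2)))
          \<longlonglongrightarrow> complex_of_real (exp (- (s h * t\<^sup>2) / 2))"
        by (intro tendsto_intros s_lim) auto
      have eq: "(CLINT \<omega>|\<Omega>. iexp (t * (Y \<omega> \<bullet> H k h))) = complex_of_real (exp (- (s (H k h) * t\<^sup>2) / 2))" for k
        unfolding char[symmetric] law_H by (rule char_centred_normal[OF s_nn])
      have "(CLINT \<omega>|\<Omega>. iexp (t * (Y \<omega> \<bullet> h))) = complex_of_real (exp (- (s h * t\<^sup>2) / 2))"
        using LIMSEQ_unique[OF lim1[unfolded eq] lim2] .
      then show "char (distr \<Omega> borel (\<lambda>\<omega>. Y \<omega> \<bullet> h)) t = char (centred_normal (s h)) t"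
        by (simp add: char char_centred_normal[OF s_nn])
    qed
  qed
  then show thesis
    using that[OF \<Omega> Ym YA] s_nn by (simp add: s_def)
qed

lemma multinomial_cov_sym:
  fixes q :: "'a \<Rightarrow> real"
  assumes q: "\<And>x. 0 \<le> q x" "\<And>E. finite E \<Longrightarrow> sum q E \<le> 1"
  shows "multinomial_cov q h \<bullet> k = multinomial_cov q k \<bullet> h"
proof -
  have eq: "l2_fun (Abs_l2 (\<lambda>x. q x * l2_fun g x)) = (\<lambda>x. q x * l2_fun g x)" for g
    by (rule l2_fun_Abs_subprobability_mult[OF q])
  have "Abs_l2 (\<lambda>x. q x * l2_fun h x) \<bullet> k = Abs_l2 (\<lambda>x. q x * l2_fun k x) \<bullet> h"
    by (simp only: inner_l2_def eq mult_ac)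
  then show ?thesis
    by (simp add: multinomial_cov_def inner_diff_left)
qed

text \<open>Passing to the image law turns the process into the identity on \<open>l2\<close>. Mixed
  covariances come from the variances by polarisation, using symmetry of
  \<open>multinomial_cov\<close>.\<close>

lemma ex_gaussian_process_multinomial_cov:
  fixes q :: "'a::countable \<Rightarrow> real"
  assumes q: "\<And>x. 0 \<le> q x" "\<And>E. finite E \<Longrightarrow> sum q E \<le> 1" and q0: "\<And>x. x \<notin> A \<Longrightarrow> q x = 0"
  shows "\<exists>N :: 'a l2 measure. gaussian_process (l2_on A) N (\<lambda>y. y) \<and> has_mean (l2_on A) N (\<lambda>y. y) 0 \<and>
    has_covariance_operator (l2_on A) N (\<lambda>y. y) (multinomial_cov q)"
proof -
  obtain \<Omega> :: "(nat \<Rightarrow> real) measure" and Y where \<Omega>: "prob_space \<Omega>"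
    and Y [measurable]: "Y \<in> borel_measurable \<Omega>"
    and YA: "\<And>\<omega>. Y \<omega> \<in> l2_on A" and nn: "\<And>h. 0 \<le> multinomial_cov q h \<bullet> h"
    and law: "\<And>h. distr \<Omega> borel (\<lambda>\<omega>. Y \<omega> \<bullet> h) = centred_normal (multinomial_cov q h \<bullet> h)"
    using ex_gaussian_l2[OF q q0] by metis
  interpret \<Omega>: prob_space \<Omega> by (rule \<Omega>)
  let ?B = "restrict_space borel (l2_on A) :: 'a l2 measure"
  have YB: "Y \<in> measurable \<Omega> ?B"
    by (rule measurable_restrict_space2) (use YA in auto)
  define N where "N = distr \<Omega> ?B Y"
  have id: "(\<lambda>y. y) \<in> measurable N ?B"
    unfolding N_def by simp
  have inner: "(\<lambda>y. y \<bullet> h) \<in> borel_measurable N" for h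
    unfolding N_def measurable_distr_eq1 by (intro measurable_restrict_space1) measurable
  have lawN: "distr N borel (\<lambda>y. y \<bullet> h) = centred_normal (multinomial_cov q h \<bullet> h)" for h
    unfolding N_def
    by (subst distr_distr) (use YB law in \<open>auto simp: comp_def intro!: measurable_restrict_space1\<close>)
  have m1: "(\<lambda>x::real. x) \<in> borel_measurable borel" and m2: "(\<lambda>x::real. x\<^sup>2) \<in> borel_measurable borel"
    by measurable
  note moments = centred_normal_moments[OF nn]
  have mean: "integrable N (\<lambda>y. y \<bullet> h)" "(\<integral>y. y \<bullet> h \<partial>N) = 0" for h
    using moments(1)[of h] moments(2)[of h]
    unfolding lawN[symmetric] integrable_distr_eq[OF inner m1] integral_distr[OF inner m1] .
  have sq: "integrable N (\<lambda>y. (y \<bullet> h)\<^sup>2)" "(\<integral>y. (y \<bullet> h)\<^sup>2 \<partial>N) = multinomial_cov q h \<bullet> h" for h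
    using integrable_distr_eq[OF inner[of h] m2] integral_distr[OF inner[of h] m2]
      moments(3)[of h] moments(4)[of h] unfolding lawN by simp_all
  have lin: "linear (multinomial_cov q)"
    using bounded_linear_multinomial_cov[OF q] by (rule bounded_linear.linear)
  have cov: "integrable N (\<lambda>y. (y \<bullet> h) * (y \<bullet> k))"
      "(\<integral>y. (y \<bullet> h) * (y \<bullet> k) \<partial>N) = multinomial_cov q h \<bullet> k" for h k
  proof -
    have eq: "(y \<bullet> h) * (y \<bullet> k) = ((y \<bullet> (h + k))\<^sup>2 - (y \<bullet> h)\<^sup>2 - (y \<bullet> k)\<^sup>2) / 2" for y
      by (simp add: inner_add_right power2_eq_square algebra_simps)
    show "integrable N (\<lambda>y. (y \<bullet> h) * (y \<bullet> k))"
      unfolding eq using sq by simp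
    have "(\<integral>y. (y \<bullet> h) * (y \<bullet> k) \<partial>N) = (multinomial_cov q (h + k) \<bullet> (h + k)
        - multinomial_cov q h \<bullet> h - multinomial_cov q k \<bullet> k) / 2"
      unfolding eq using sq by simp
    also have "\<dots> = multinomial_cov q h \<bullet> k"
      using multinomial_cov_sym[OF q, of h k]
      by (simp add: linear_add[OF lin] inner_add_left inner_add_right)
    finally show "(\<integral>y. (y \<bullet> h) * (y \<bullet> k) \<partial>N) = multinomial_cov q h \<bullet> k" .
  qed
  have "prob_space N"
    unfolding N_def by (rule \<Omega>.prob_space_distr[OF YB])
  then have "gaussian_process (l2_on A) N (\<lambda>y. y)"
    unfolding gaussian_process_def using id gaussian_law_centred_normal[OF nn] by (auto simp: lawN)
  moreover have zero: "has_mean (l2_on A) N (\<lambda>y. y) 0"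
    unfolding has_mean_def using mean by (auto simp: l2_on_def)
  moreover have "has_covariance_operator (l2_on A) N (\<lambda>y. y) (multinomial_cov q)"
    unfolding has_covariance_operator_def
    by (rule exI[of _ 0]) (use zero cov in auto)
  ultimately show ?thesis by blast
qed

section \<open>Order constraints\<close>

text \<open>One shape for three sets: slack 0 on all ordered pairs, slack 0 on pairs of equal
  \<open>p\<close>, and slack proportional to the gap of \<open>p\<close>. Closedness and convexity
  are then proved once.\<close>

definition order_constrained :: "'a set \<Rightarrow> ('a \<times> 'a) set \<Rightarrow> ('a \<Rightarrow> 'a \<Rightarrow> real) \<Rightarrow> 'a l2 set"
  where "order_constrained A R c = {f \<in> l2_on A. \<forall>(x, y)\<in>R. l2_fun f y \<le> l2_fun f x + c x y}"

lemma order_constrainedI: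
  "f \<in> l2_on A \<Longrightarrow> (\<And>x y. (x, y) \<in> R \<Longrightarrow> l2_fun f y \<le> l2_fun f x + c x y) \<Longrightarrow>
    f \<in> order_constrained A R c"
  by (auto simp: order_constrained_def)

lemma order_constrainedD:
  assumes "f \<in> order_constrained A R c"
  shows "f \<in> l2_on A" "(x, y) \<in> R \<Longrightarrow> l2_fun f y \<le> l2_fun f x + c x y"
  using assms by (auto simp: order_constrained_def)

lemma closed_order_constrained: "closed (order_constrained A R c)"
proof -
  have "order_constrained A R c = l2_on A \<inter> (\<Inter>(x, y)\<in>R. {f. l2_fun f y \<le> l2_fun f x + c x y})"
    by (auto simp: order_constrained_def)
  moreover have "closed {f. l2_fun f y \<le> l2_fun f x + c x y}" for x y
    by (intro closed_Collect_le continuous_on_l2_fun continuous_intros)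
  ultimately show ?thesis
    by (auto intro!: closed_Int closed_l2_on closed_INT)
qed

lemma convex_order_constrained: "convex (order_constrained A R c)"
proof (rule convexI)
  fix f g u v
  assume f: "f \<in> order_constrained A R c" and g: "g \<in> order_constrained A R c"
    and u: "0 \<le> u" "0 \<le> v" "u + v = (1::real)"
  show "u *\<^sub>R f + v *\<^sub>R g \<in> order_constrained A R c"
  proof (rule order_constrainedI)
    show "u *\<^sub>R f + v *\<^sub>R g \<in> l2_on A"
      using order_constrainedD(1)[OF f] order_constrainedD(1)[OF g] by (simp add: l2_on_def)
    fix x y assume xy: "(x, y) \<in> R"
    have "u * l2_fun f y + v * l2_fun g y \<le> u * (l2_fun f x + c x y) + v * (l2_fun g x + c x y)"
      by (intro add_mono mult_left_mono order_constrainedD(2)[OF f xy] order_constrainedD(2)[OF g xy] u)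
    also have "\<dots> = u * l2_fun f x + v * l2_fun g x + (u + v) * c x y"
      by (simp add: algebra_simps)
    finally show "l2_fun (u *\<^sub>R f + v *\<^sub>R g) y \<le> l2_fun (u *\<^sub>R f + v *\<^sub>R g) x + c x y"
      by (simp add: u)
  qed
qed

lemma zero_in_order_constrained:
  "(\<And>x y. (x, y) \<in> R \<Longrightarrow> 0 \<le> c x y) \<Longrightarrow> 0 \<in> order_constrained A R c"
  by (rule order_constrainedI) (auto simp: l2_on_def)

definition le_pairs :: "'a::order set \<Rightarrow> ('a \<times> 'a) set"
  where "le_pairs A = {(x, y). x \<in> A \<and> y \<in> A \<and> x \<le> y}"

abbreviation decreasing_cone :: "'a::order set \<Rightarrow> 'a l2 set"
  where "decreasing_cone A \<equiv> order_constrained A (le_pairs A) (\<lambda>_ _. 0)"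

lemma decreasing_cone_eq: "decreasing_l2 A = decreasing_cone A"
  by (auto simp: decreasing_l2_def order_constrained_def monotone_on_def le_pairs_def)

lemma decreasing_cone_eq': "{f \<in> l2_on A. monotone_on A (\<ge>) (\<le>) (l2_fun f)} = decreasing_cone A"
  by (auto simp: order_constrained_def monotone_on_def le_pairs_def)

lemmas decreasing_cone_convex_closed =
  convex_order_constrained[of _ _ "\<lambda>_ _. 0"] closed_order_constrained[of _ _ "\<lambda>_ _. 0"]

lemma decreasing_cone_nonempty: "order_constrained A R (\<lambda>_ _. 0) \<noteq> {}"
  using zero_in_order_constrained[of R "\<lambda>_ _. 0" A] by auto

lemma isotonic_regression_eq_proj_on:
  "isotonic_regression (\<ge>) B (l2_fun \<theta>) = proj_on (decreasing_cone B) (l2_restrict B \<theta>)"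
  unfolding isotonic_regression_def decreasing_cone_eq' l2_restrict_def
proof (rule arg_min_on_eq_proj_on[OF decreasing_cone_convex_closed decreasing_cone_nonempty])
  fix f assume "f \<in> decreasing_cone B"
  then have "f \<in> l2_on B" by (rule order_constrainedD)
  then show "(\<Sum>\<^sub>\<infinity>x\<in>B. (l2_fun f x - l2_fun \<theta> x)\<^sup>2) = (dist (to_l2 B (l2_fun \<theta>)) f)\<^sup>2"
    by (intro infsum_diff_square_eq_dist summable_on_subset_banach[OF l2_fun_square_summable]) auto
qed

section \<open>Comparable level sets and the splitting of the limiting projection\<close>

lemma mem_comparable_level_set: "x \<in> comparable_level_set le A p x"
  by (simp add: comparable_level_set_def comparable_component_def)

lemma comparable_level_set_subset:
  assumes "x \<in> A" "y \<in> comparable_level_set le A p x"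
  shows "y \<in> A \<and> p y = p x"
proof -
  have "(x, y) \<in> {(u, v). u \<in> level_set A p (p x) \<and> v \<in> level_set A p (p x) \<and> comparable le u v}\<^sup>*"
    using assms(2) by (simp add: comparable_level_set_def comparable_component_def)
  then show ?thesis
    by (induction rule: rtrancl_induct) (use assms(1) in \<open>auto simp: level_set_def\<close>)
qed

lemma comparable_level_set_closed:
  assumes x: "x \<in> A" and y: "y \<in> comparable_level_set le A p x"
    and z: "z \<in> A" "p z = p y" "le y z \<or> le z y"
  shows "z \<in> comparable_level_set le A p x"
proof -
  let ?E = "{(u, v). u \<in> level_set A p (p x) \<and> v \<in> level_set A p (p x) \<and> comparable le u v}"
  have "(x, y) \<in> ?E\<^sup>*"
    using y by (simp add: comparable_level_set_def comparable_component_def)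
  moreover have "(y, z) \<in> ?E"
    using comparable_level_set_subset[OF x y] z by (auto simp: level_set_def comparable_def)
  ultimately have "(x, z) \<in> ?E\<^sup>*" by (rule rtrancl_into_rtrancl)
  then show ?thesis
    by (simp add: comparable_level_set_def comparable_component_def)
qed

definition level_pairs :: "'a::order set \<Rightarrow> ('a \<Rightarrow> real) \<Rightarrow> ('a \<times> 'a) set"
  where "level_pairs A p = {(x, y). x \<in> A \<and> y \<in> A \<and> x \<le> y \<and> p x = p y}"

abbreviation level_cone :: "'a::order set \<Rightarrow> ('a \<Rightarrow> real) \<Rightarrow> 'a l2 set"
  where "level_cone A p \<equiv> order_constrained A (level_pairs A p) (\<lambda>_ _. 0)"

text \<open>No level constraint joins a component \<open>B\<close> to its complement, and squared
  norms add over the two. Replacing the global projection on \<open>B\<close> by any competitor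
  \<open>f\<close> stays in the cone, so global optimality forces optimality on each
  \<open>B\<close>.\<close>

lemma level_set_regression_eq_proj_on:
  fixes A :: "'a::order set"
  shows "level_set_regression (\<ge>) A p \<theta> = proj_on (level_cone A p) \<theta>"
proof -
  note K = decreasing_cone_convex_closed[of A "level_pairs A p"]
    decreasing_cone_nonempty[of A "level_pairs A p"]
  define k where "k = proj_on (level_cone A p) \<theta>"
  have k: "k \<in> level_cone A p"
    unfolding k_def by (rule proj_on_in[OF K])
  have comp: "isotonic_regression (\<ge>) B (l2_fun \<theta>) = l2_restrict B k"
    if x: "x \<in> A" and B: "B = comparable_level_set (\<ge>) A p x" for x B
    unfolding isotonic_regression_eq_proj_on
  proof (rule proj_on_eqI[OF decreasing_cone_convex_closed decreasing_cone_nonempty])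
    have BA: "y \<in> A" "p y = p x" if "y \<in> B" for y
      using comparable_level_set_subset[OF x] that by (auto simp: B)
    have B_iff: "u \<in> B \<longleftrightarrow> v \<in> B" if "(u, v) \<in> level_pairs A p" for u v
      using comparable_level_set_closed[OF x, of u "(\<ge>)" p v]
        comparable_level_set_closed[OF x, of v "(\<ge>)" p u] that
      by (auto simp: B level_pairs_def)
    have le_level: "(u, v) \<in> level_pairs A p" if "(u, v) \<in> le_pairs B" for u v
      using that BA by (auto simp: le_pairs_def level_pairs_def)
    show "l2_restrict B k \<in> decreasing_cone B"
    proof (rule order_constrainedI)
      fix u v assume uv: "(u, v) \<in> le_pairs B"
      then have "l2_fun k v \<le> l2_fun k u"
        using order_constrainedD(2)[OF k le_level] by simp
      then show "l2_fun (l2_restrict B k) v \<le> l2_fun (l2_restrict B k) u + 0"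
        using uv by (auto simp: le_pairs_def)
    qed (simp add: l2_restrict_in_l2_on)
    fix f assume f: "f \<in> decreasing_cone B"
    define k' where "k' = l2_restrict (- B) k + f"
    have f0: "l2_fun f y = 0" if "y \<notin> B" for y
      using order_constrainedD(1)[OF f] that by (simp add: l2_on_def)
    have "k' \<in> level_cone A p"
    proof (rule order_constrainedI)
      show "k' \<in> l2_on A"
        using order_constrainedD(1)[OF k] f0 BA by (auto simp: l2_on_def k'_def)
      fix u v assume uv: "(u, v) \<in> level_pairs A p"
      show "l2_fun k' v \<le> l2_fun k' u + 0"
      proof (cases "u \<in> B")
        case True
        then have "(u, v) \<in> le_pairs B"
          using B_iff[OF uv] uv by (auto simp: le_pairs_def level_pairs_def)
        then show ?thesis
          using order_constrainedD(2)[OF f] True B_iff[OF uv] by (simp add: k'_def)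
      next
        case False
        then show ?thesis
          using order_constrainedD(2)[OF k uv] B_iff[OF uv] by (simp add: k'_def f0)
      qed
    qed
    then have "dist \<theta> k \<le> dist \<theta> k'"
      unfolding k_def by (rule dist_proj_on_le[OF K])
    then have "(norm (\<theta> - k))\<^sup>2 \<le> (norm (\<theta> - k'))\<^sup>2"
      by (simp add: dist_norm power_mono)
    moreover have "l2_restrict B (\<theta> - k) = l2_restrict B \<theta> - l2_restrict B k"
        "l2_restrict B (\<theta> - k') = l2_restrict B \<theta> - f"
        "l2_restrict (- B) (\<theta> - k') = l2_restrict (- B) (\<theta> - k)"
      by (rule l2_eqI; simp add: k'_def f0)+
    ultimately have "(norm (l2_restrict B \<theta> - l2_restrict B k))\<^sup>2 \<le> (norm (l2_restrict B \<theta> - f))\<^sup>2"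
      using norm_l2_restrict_Compl[of "\<theta> - k" B] norm_l2_restrict_Compl[of "\<theta> - k'" B] by simp
    then show "dist (l2_restrict B \<theta>) (l2_restrict B k) \<le> dist (l2_restrict B \<theta>) f"
      unfolding dist_norm by (rule power2_le_imp_le) simp
  qed
  have "l2_fun (isotonic_regression (\<ge>) (comparable_level_set (\<ge>) A p x) (l2_fun \<theta>)) x = l2_fun k x"
    if "x \<in> A" for x
    using comp[OF that refl] mem_comparable_level_set[of x "(\<ge>)" A p] by simp
  then have "level_set_regression (\<ge>) A p \<theta> = to_l2 A (l2_fun k)"
    unfolding level_set_regression_def to_l2_def by (intro arg_cong[where f = Abs_l2]) auto
  also have "\<dots> = k"
    unfolding l2_restrict_def[symmetric]
    by (rule mem_l2_on_iff[THEN iffD1, OF order_constrainedD(1)[OF k]])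
  finally show ?thesis by (simp add: k_def)
qed

section \<open>The decreasing estimator\<close>

locale decreasing_sample = iid_sample M Z A p
  for M :: "'w measure" and Z :: "nat \<Rightarrow> 'w \<Rightarrow> 'a::{countable, order}" and A p +
  assumes decreasing: "\<And>x y. x \<in> A \<Longrightarrow> y \<in> A \<Longrightarrow> x \<le> y \<Longrightarrow> p y \<le> p x"
begin

text \<open>Given by inequalities and not as an affine image of the decreasing cone, so that it
  inherits closedness and convexity from \<open>order_constrained\<close>.\<close>

definition local_cone :: "nat \<Rightarrow> 'a l2 set"
  where "local_cone n = order_constrained A (le_pairs A) (\<lambda>x y. sqrt (real n) * (p x - p y))"

lemma local_cone_zero: "0 \<in> local_cone n"
  unfolding local_cone_def
  by (rule zero_in_order_constrained) (auto simp: le_pairs_def decreasing)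

lemma local_cone: "convex (local_cone n)" "closed (local_cone n)" "local_cone n \<noteq> {}"
  using local_cone_zero[of n] convex_order_constrained closed_order_constrained
  by (auto simp: local_cone_def)

lemma level_cone: "convex (level_cone A p)" "closed (level_cone A p)" "level_cone A p \<noteq> {}"
  by (rule decreasing_cone_convex_closed decreasing_cone_nonempty)+

lemma local_cone_subset: "local_cone n \<subseteq> level_cone A p"
proof
  fix f assume f: "f \<in> local_cone n"
  show "f \<in> level_cone A p"
  proof (rule order_constrainedI)
    show "f \<in> l2_on A"
      using f unfolding local_cone_def by (rule order_constrainedD)
    fix x y assume xy: "(x, y) \<in> level_pairs A p"
    then have "(x, y) \<in> le_pairs A" "p x = p y"
      by (auto simp: level_pairs_def le_pairs_def)
    then show "l2_fun f y \<le> l2_fun f x + 0"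
      using order_constrainedD(2)[OF f[unfolded local_cone_def], of x y] by simp
  qed
qed

lemma decreasing_estimator_eq_proj_on:
  "decreasing_estimator A Z n \<omega> = proj_on (decreasing_cone A) (empirical_l2 n \<omega>)"
  unfolding decreasing_estimator_def decreasing_cone_eq empirical_l2_def
proof (rule arg_min_on_eq_proj_on[OF decreasing_cone_convex_closed decreasing_cone_nonempty])
  fix f assume "f \<in> decreasing_cone A"
  then have "f \<in> l2_on A" by (rule order_constrainedD)
  then show "(\<Sum>\<^sub>\<infinity>x\<in>A. (l2_fun f x - empirical_pmf Z n \<omega> x)\<^sup>2)
      = (dist (to_l2 A (empirical_pmf Z n \<omega>)) f)\<^sup>2"
    by (rule infsum_diff_square_eq_dist[OF empirical_square_summable])
qed

text \<open>Translation by \<open>p\<close> followed by a positive dilation multiplies all distances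
  by the same factor, so it commutes with projecting.\<close>

lemma scaled_error_eq_proj_on:
  "sqrt (real n) *\<^sub>R (decreasing_estimator A Z n \<omega> - to_l2 A p)
    = proj_on (local_cone n) (fluctuation n \<omega>)"
proof (cases "n = 0")
  \<comment> \<open>The dilation degenerates, but fluctuation and scaled error are both 0, and 0
    lies in the cone.\<close>
  case True
  then have "proj_on (local_cone n) (fluctuation n \<omega>) = 0"
    by (intro proj_on_eqI[OF local_cone] local_cone_zero) (simp add: fluctuation_def)
  then show ?thesis using True by simp
next
  case False
  define s where "s = sqrt (real n)"
  have s: "0 < s" using False by (simp add: s_def)
  let ?P = "to_l2 A p" and ?e = "empirical_l2 n \<omega>"
  let ?f = "proj_on (decreasing_cone A) ?e"
  have P: "l2_fun ?P x = (if x \<in> A then p x else 0)" for x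
    by (simp add: l2_fun_to_l2_p q_def)
  have f: "?f \<in> decreasing_cone A"
    by (rule proj_on_in[OF decreasing_cone_convex_closed decreasing_cone_nonempty])
  have "proj_on (local_cone n) (s *\<^sub>R (?e - ?P)) = s *\<^sub>R (?f - ?P)"
  proof (rule proj_on_eqI[OF local_cone])
    show "s *\<^sub>R (?f - ?P) \<in> local_cone n"
      unfolding local_cone_def
    proof (rule order_constrainedI)
      show "s *\<^sub>R (?f - ?P) \<in> l2_on A"
        using order_constrainedD(1)[OF f] by (simp add: l2_on_def P)
      fix x y assume xy: "(x, y) \<in> le_pairs A"
      have "s * l2_fun ?f y \<le> s * l2_fun ?f x"
        using order_constrainedD(2)[OF f xy] s by simp
      then show "l2_fun (s *\<^sub>R (?f - ?P)) y \<le> l2_fun (s *\<^sub>R (?f - ?P)) x + sqrt (real n) * (p x - p y)"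
        using xy by (simp add: le_pairs_def P algebra_simps flip: s_def)
    qed
    fix h assume h: "h \<in> local_cone n"
    define g where "g = ?P + (1 / s) *\<^sub>R h"
    have hg: "h = s *\<^sub>R (g - ?P)"
      using s by (simp add: g_def)
    have "g \<in> decreasing_cone A"
    proof (rule order_constrainedI)
      show "g \<in> l2_on A"
        using order_constrainedD(1)[OF h[unfolded local_cone_def]] by (simp add: l2_on_def P g_def)
      fix x y assume xy: "(x, y) \<in> le_pairs A"
      have "l2_fun h y \<le> l2_fun h x + s * (p x - p y)"
        using order_constrainedD(2)[OF h[unfolded local_cone_def] xy] by (simp add: s_def)
      then have "l2_fun h y / s \<le> (l2_fun h x + s * (p x - p y)) / s"
        using s by (intro divide_right_mono) auto
      then show "l2_fun g y \<le> l2_fun g x + 0"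
        using xy s by (simp add: le_pairs_def P g_def add_divide_distrib)
    qed
    then have "dist ?e ?f \<le> dist ?e g"
      by (rule dist_proj_on_le[OF decreasing_cone_convex_closed decreasing_cone_nonempty])
    then have "s * norm (?e - ?f) \<le> s * norm (?e - g)"
      using s by (simp add: dist_norm)
    moreover have "dist (s *\<^sub>R (?e - ?P)) (s *\<^sub>R (k - ?P)) = s * norm (?e - k)" for k
      using s by (simp add: dist_norm flip: scaleR_diff_right)
    ultimately show "dist (s *\<^sub>R (?e - ?P)) (s *\<^sub>R (?f - ?P)) \<le> dist (s *\<^sub>R (?e - ?P)) h"
      unfolding hg by simp
  qed
  then show ?thesis
    by (simp add: decreasing_estimator_eq_proj_on fluctuation_def s_def)
qed

section \<open>Convergence of the projections onto the rescaled cones\<close>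

definition support :: "'a set"
  where "support = {x. 0 < q x}"

text \<open>More than \<open>1 / e\<close> points of mass at least \<open>e\<close> would exceed
  total mass 1.\<close>

lemma finite_superlevel:
  assumes "0 < e"
  shows "finite {x \<in> A. e \<le> p x}"
proof (rule ccontr)
  assume inf: "infinite {x \<in> A. e \<le> p x}"
  obtain m :: nat where m: "1 / e < real m"
    using reals_Archimedean2 by blast
  obtain E where E: "E \<subseteq> {x \<in> A. e \<le> p x}" "finite E" "card E = m"
    using infinite_arbitrarily_large[OF inf] by blast
  have "real m * e = (\<Sum>x\<in>E. e)" by (simp add: E)
  also have "\<dots> \<le> sum q E"
    by (rule sum_mono) (use E in \<open>auto simp: q_def\<close>)
  also have "\<dots> \<le> 1" by (rule sum_q_le[OF E(2)])
  finally show False using m assms by (simp add: field_simps)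
qed

text \<open>If \<open>p y\<close> is below \<open>e / 2\<close>, the gap exceeds
  \<open>e / 2\<close>; otherwise both points lie in a finite superlevel set, which has only
  finitely many differences.\<close>

lemma superlevel_gap:
  assumes e: "0 < e"
  shows "\<exists>\<delta>>0. \<forall>x\<in>A. \<forall>y\<in>A. e \<le> p x \<longrightarrow> p y < p x \<longrightarrow> \<delta> \<le> p x - p y"
proof -
  let ?T = "{x \<in> A. e / 2 \<le> p x}"
  let ?G = "insert (e / 2) {p x - p y |x y. x \<in> ?T \<and> y \<in> ?T \<and> p y < p x}"
  have "finite ((\<lambda>(x, y). p x - p y) ` (?T \<times> ?T))"
    using finite_superlevel[of "e/2"] e by simp
  then have "finite {p x - p y |x y. x \<in> ?T \<and> y \<in> ?T \<and> p y < p x}"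
    by (rule finite_subset[rotated]) auto
  then have fin: "finite ?G" by simp
  have "0 < Min ?G"
    using fin e by (subst Min_gr_iff) auto
  moreover have "Min ?G \<le> p x - p y" if "x \<in> A" "y \<in> A" "e \<le> p x" "p y < p x" for x y
  proof (cases "e / 2 \<le> p y")
    case True
    then have "x \<in> ?T" "y \<in> ?T" using that e by auto
    then have "p x - p y \<in> ?G" using that(4) by blast
    then show ?thesis by (rule Min_le[OF fin])
  next
    case False
    have "Min ?G \<le> e / 2" by (rule Min_le[OF fin]) simp
    then show ?thesis using False that by linarith
  qed
  ultimately show ?thesis by blast
qed

text \<open>Level pairs never join the support to its complement, so cutting the projection to the
  support stays in the cone. This cannot increase the distance to \<open>w\<close>, and uniqueness
  finishes.\<close>

lemma proj_on_level_cone_support: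
  assumes w: "w \<in> l2_on support"
  shows "proj_on (level_cone A p) w \<in> l2_on support"
proof -
  let ?k = "proj_on (level_cone A p) w"
  have k: "?k \<in> level_cone A p"
    by (rule proj_on_in[OF level_cone])
  have "?k = l2_restrict support ?k"
  proof (rule proj_on_eqI[OF level_cone])
    show "l2_restrict support ?k \<in> level_cone A p"
    proof (rule order_constrainedI)
      show "l2_restrict support ?k \<in> l2_on A"
        using order_constrainedD(1)[OF k] by (simp add: l2_on_def)
      fix x y assume xy: "(x, y) \<in> level_pairs A p"
      then have "x \<in> support \<longleftrightarrow> y \<in> support"
        by (auto simp: support_def level_pairs_def q_def)
      then show "l2_fun (l2_restrict support ?k) y \<le> l2_fun (l2_restrict support ?k) x + 0"
        using order_constrainedD(2)[OF k xy] by simp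
    qed
    fix y assume y: "y \<in> level_cone A p"
    have "dist w (l2_restrict support ?k) \<le> dist w ?k"
      using dist_l2_restrict_le[of support w ?k] w by (simp add: mem_l2_on_iff)
    also have "\<dots> \<le> dist w y"
      by (rule dist_proj_on_le[OF level_cone y])
    finally show "dist w (l2_restrict support ?k) \<le> dist w y" .
  qed
  then show ?thesis by (simp add: mem_l2_on_iff)
qed

text \<open>Pairs of equal \<open>p\<close> are kept or cut together. If \<open>p x\<close> is below
  \<open>e\<close>, then so is \<open>p y\<close>, and both values are cut. In the remaining case
  the gap has a uniform lower bound, and the slack grows like the root of \<open>n\<close>.\<close>

lemma truncation_in_local_cone:
  assumes k: "k \<in> level_cone A p" and e: "0 < e"
  shows "eventually (\<lambda>n. l2_restrict {x \<in> A. e \<le> p x} k \<in> local_cone n) sequentially"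
proof -
  obtain \<delta> where \<delta>: "0 < \<delta>"
      "\<And>x y. x \<in> A \<Longrightarrow> y \<in> A \<Longrightarrow> e \<le> p x \<Longrightarrow> p y < p x \<Longrightarrow> \<delta> \<le> p x - p y"
    using superlevel_gap[OF e] by blast
  let ?T = "{x \<in> A. e \<le> p x}"
  let ?k = "l2_restrict ?T k"
  \<comment> \<open>From \<open>n0\<close> on, the slack is at least \<open>2 * norm k\<close>,
    which bounds the difference of any two coordinates.\<close>
  obtain n0 :: nat where n0: "(2 * norm k / \<delta>)\<^sup>2 \<le> real n0"
    using real_arch_simple by blast
  have "?k \<in> local_cone n" if n: "n \<ge> n0" for n
    unfolding local_cone_def
  proof (rule order_constrainedI)
    show "?k \<in> l2_on A"
      by (rule l2_restrict_in_l2_on) auto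
    have "(2 * norm k / \<delta>)\<^sup>2 \<le> real n"
      using n0 n by linarith
    then have "2 * norm k / \<delta> \<le> sqrt (real n)"
      by (rule real_le_rsqrt)
    then have big: "2 * norm k \<le> sqrt (real n) * \<delta>"
      using \<delta>(1) by (simp add: field_simps)
    fix x y assume "(x, y) \<in> le_pairs A"
    then have xy: "x \<in> A" "y \<in> A" "x \<le> y"
      by (auto simp: le_pairs_def)
    have pxy: "p y \<le> p x"
      by (rule decreasing[OF xy])
    show "l2_fun ?k y \<le> l2_fun ?k x + sqrt (real n) * (p x - p y)"
    proof (cases "p x = p y")
      case True
      then have "(x, y) \<in> level_pairs A p"
        using xy by (simp add: level_pairs_def)
      from order_constrainedD(2)[OF k this] True xy show ?thesis by simp
    next
      case neq: False
      show ?thesis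
      proof (cases "e \<le> p x")
        case True
        have "l2_fun ?k y - l2_fun ?k x \<le> 2 * norm k"
          using abs_l2_fun_le_norm[of ?k x] abs_l2_fun_le_norm[of ?k y] norm_l2_restrict_le[of ?T k]
          by linarith
        also have "\<dots> \<le> sqrt (real n) * (p x - p y)"
          using \<delta>(2)[OF xy(1,2) True] neq pxy big
          by (smt (verit) mult_left_mono real_sqrt_ge_zero of_nat_0_le_iff)
        finally show ?thesis by simp
      next
        case False
        then show ?thesis using pxy by simp
      qed
    qed
  qed
  then show ?thesis
    by (rule eventually_sequentiallyI)
qed

lemma truncation_approx:
  assumes k: "k \<in> l2_on support" and e: "0 < e"
  shows "\<exists>c>0. norm (k - l2_restrict {x \<in> A. c \<le> p x} k) < e"
proof -
  obtain D where D: "finite D" "\<And>B. D \<subseteq> B \<Longrightarrow> norm (k - l2_restrict B k) < e"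
    using l2_restrict_approx[OF e, of k] by blast
  \<comment> \<open>Only finitely many points matter, so the least mass among them is a positive
    height; 1 is inserted in case there are none.\<close>
  let ?V = "insert 1 (p ` (D \<inter> support))"
  define c where "c = Min ?V"
  have fin: "finite ?V" using D(1) by simp
  have "0 < c"
    unfolding c_def using fin by (subst Min_gr_iff) (auto simp: support_def q_def split: if_splits)
  have c_le: "c \<le> p x" if "x \<in> D" "x \<in> support" for x
    unfolding c_def by (rule Min_le[OF fin]) (use that in auto)
  \<comment> \<open>\<open>k\<close> vanishes off the support, so adding its complement changes
    nothing but makes the set contain \<open>D\<close>.\<close>
  have "l2_restrict {x \<in> A. c \<le> p x} k = l2_restrict ({x \<in> A. c \<le> p x} \<union> - support) k"
    by (rule l2_eqI) (use k in \<open>auto simp: l2_on_def\<close>)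
  moreover have "D \<subseteq> {x \<in> A. c \<le> p x} \<union> - support"
    using c_le by (auto simp: support_def q_def split: if_splits)
  ultimately show ?thesis
    using D(2) \<open>0 < c\<close> by auto
qed

text \<open>The projection onto the smaller cone is at least as close to \<open>w\<close> as the
  truncation of \<open>k\<close>, so its distance to \<open>w\<close> is at most
  \<open>d + \<eta>\<close>. As it also lies in the larger cone, the obtuse angle at
  \<open>k\<close> bounds its distance to \<open>k\<close>.\<close>

lemma proj_on_local_cone_tendsto:
  assumes w: "w \<in> l2_on support"
  shows "(\<lambda>n. proj_on (local_cone n) w) \<longlonglongrightarrow> proj_on (level_cone A p) w"
proof (rule tendstoI)
  fix \<epsilon> :: real assume \<epsilon>: "0 < \<epsilon>"
  define k where "k = proj_on (level_cone A p) w"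
  have k: "k \<in> level_cone A p"
    unfolding k_def by (rule proj_on_in[OF level_cone])
  have ks: "k \<in> l2_on support"
    unfolding k_def by (rule proj_on_level_cone_support[OF w])
  define d where "d = dist w k"
  \<comment> \<open>Makes (d + \<eta>)^2 - d^2 = \<eta> * (2 * d + \<eta>) at most half of
    \<epsilon>^2; the cap at 1 replaces the inner \<eta> by 1.\<close>
  define \<eta> where "\<eta> = min 1 (\<epsilon>\<^sup>2 / (2 * (2 * d + 1)))"
  have d: "0 \<le> d" by (simp add: d_def)
  have \<eta>: "0 < \<eta>" "\<eta> \<le> 1" "\<eta> * (2 * d + 1) \<le> \<epsilon>\<^sup>2 / 2"
  proof -
    show "0 < \<eta>" "\<eta> \<le> 1"
      using \<epsilon> d by (auto simp: \<eta>_def)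
    have "\<eta> \<le> \<epsilon>\<^sup>2 / (2 * (2 * d + 1))" by (simp add: \<eta>_def)
    then show "\<eta> * (2 * d + 1) \<le> \<epsilon>\<^sup>2 / 2"
      using d by (simp add: field_simps)
  qed
  obtain c where c: "0 < c" "norm (k - l2_restrict {x \<in> A. c \<le> p x} k) < \<eta>"
    using truncation_approx[OF ks \<eta>(1)] by blast
  let ?kc = "l2_restrict {x \<in> A. c \<le> p x} k"
  have kc: "dist w ?kc \<le> d + \<eta>"
    using dist_triangle[of w ?kc k] c(2) by (simp add: d_def dist_norm)
  show "eventually (\<lambda>n. dist (proj_on (local_cone n) w) (proj_on (level_cone A p) w) < \<epsilon>) sequentially"
    using truncation_in_local_cone[OF k c(1)]
  proof eventually_elim
    case (elim n)
    let ?z = "proj_on (local_cone n) w"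
    have "?z \<in> level_cone A p"
      using proj_on_in[OF local_cone, of n w] local_cone_subset[of n] by blast
    then have "(dist ?z k)\<^sup>2 \<le> (dist w ?z)\<^sup>2 - d\<^sup>2"
      unfolding k_def d_def by (rule dist_proj_on_square_le[OF level_cone])
    also have "(dist w ?z)\<^sup>2 \<le> (d + \<eta>)\<^sup>2"
      using order_trans[OF dist_proj_on_le[OF local_cone elim, of w] kc] by (intro power_mono) auto
    also have "(d + \<eta>)\<^sup>2 - d\<^sup>2 = \<eta> * (2 * d + \<eta>)"
      by (simp add: power2_eq_square algebra_simps)
    also have "\<dots> \<le> \<eta> * (2 * d + 1)"
      using \<eta> by (intro mult_left_mono) auto
    also have "\<dots> < \<epsilon>\<^sup>2"
      using \<eta>(3) \<epsilon> by (smt (verit) half_gt_zero zero_less_power field_sum_of_halves)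
    finally show ?case
      using \<epsilon> unfolding k_def by (simp add: power2_less_imp_less)
  qed
qed

text \<open>Off the support the second moments are at most \<open>q x = 0\<close>, and countably
  many null sets may be united.\<close>

lemma AE_fluctuation_support: "AE \<omega> in M. l2_restrict support (fluctuation n \<omega>) = fluctuation n \<omega>"
proof -
  have "AE \<omega> in M. x \<notin> support \<longrightarrow> l2_fun (fluctuation n \<omega>) x = 0" for x
  proof (cases "x \<in> support")
    case False
    then have "q x = 0" using q_nonneg[of x] by (auto simp: support_def)
    then have "expectation (\<lambda>\<omega>. (l2_fun (fluctuation n \<omega>) x)\<^sup>2) = 0"
      using fluctuation_second_moment(2)[of n x]
      by (intro antisym) (auto intro: Bochner_Integration.integral_nonneg)
    then have "AE \<omega> in M. (l2_fun (fluctuation n \<omega>) x)\<^sup>2 = 0"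
      using integral_nonneg_eq_0_iff_AE[OF fluctuation_second_moment(1)[of n x]] by simp
    then show ?thesis by simp
  qed simp
  then have "AE \<omega> in M. \<forall>x. x \<notin> support \<longrightarrow> l2_fun (fluctuation n \<omega>) x = 0"
    by (simp add: AE_all_countable)
  then show ?thesis
    by (rule AE_mp) (auto intro!: AE_I2 l2_eqI)
qed

end

section \<open>Marginals of a given Gaussian limit and invariance under almost sure equality\<close>

lemma gaussian_process_centred:
  fixes Y :: "'b \<Rightarrow> 'v::real_inner"
  assumes gp: "gaussian_process S N Y" and mean: "has_mean S N Y 0"
    and cov: "has_covariance_operator S N Y C" and h: "h \<in> S"
  shows "integrable N (\<lambda>\<omega>. (Y \<omega> \<bullet> h)\<^sup>2)" "(\<integral>\<omega>. (Y \<omega> \<bullet> h)\<^sup>2 \<partial>N) = C h \<bullet> h"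
    "distr N borel (\<lambda>\<omega>. Y \<omega> \<bullet> h) = centred_normal (C h \<bullet> h)"
proof -
  obtain m where m: "has_mean S N Y m"
    and mc: "\<And>h. h \<in> S \<Longrightarrow> integrable N (\<lambda>\<omega>. ((Y \<omega> - m) \<bullet> h) * ((Y \<omega> - m) \<bullet> h))"
      "\<And>h. h \<in> S \<Longrightarrow> (\<integral>\<omega>. ((Y \<omega> - m) \<bullet> h) * ((Y \<omega> - m) \<bullet> h) \<partial>N) = C h \<bullet> h"
    using cov unfolding has_covariance_operator_def by blast
  \<comment> \<open>The covariance operator comes with a mean of its own; testing both means against
    \<open>m\<close> itself shows that it is 0.\<close>
  have "m \<bullet> m = (\<integral>\<omega>. Y \<omega> \<bullet> m \<partial>N)" "(\<integral>\<omega>. Y \<omega> \<bullet> m \<partial>N) = 0"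
    using m mean unfolding has_mean_def by auto
  then have m0: "m = 0" by simp
  show sq: "integrable N (\<lambda>\<omega>. (Y \<omega> \<bullet> h)\<^sup>2)" "(\<integral>\<omega>. (Y \<omega> \<bullet> h)\<^sup>2 \<partial>N) = C h \<bullet> h"
    using mc[OF h] by (simp_all add: m0 power2_eq_square)
  have "Y \<in> borel_measurable N"
    using gp unfolding gaussian_process_def by (simp add: measurable_restrict_space2_iff)
  moreover have "(\<lambda>v. v \<bullet> h) \<in> borel_measurable borel"
    by (intro borel_measurable_continuous_onI continuous_intros)
  ultimately have Yh: "(\<lambda>\<omega>. Y \<omega> \<bullet> h) \<in> borel_measurable N"
    by (rule measurable_compose)
  have m1: "(\<lambda>x::real. x) \<in> borel_measurable borel" and m2: "(\<lambda>x::real. x\<^sup>2) \<in> borel_measurable borel"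
    by measurable
  have Y0: "(\<integral>\<omega>. Y \<omega> \<bullet> h \<partial>N) = 0"
    using mean h unfolding has_mean_def by simp
  show "distr N borel (\<lambda>\<omega>. Y \<omega> \<bullet> h) = centred_normal (C h \<bullet> h)"
  proof (rule gaussian_law_eq_centred_normal)
    show "gaussian_law (distr N borel (\<lambda>\<omega>. Y \<omega> \<bullet> h))"
      using gp h unfolding gaussian_process_def by blast
    show "(\<integral>x. x \<partial>distr N borel (\<lambda>\<omega>. Y \<omega> \<bullet> h)) = 0"
      unfolding integral_distr[OF Yh m1] by (rule Y0)
    show "(\<integral>x. x\<^sup>2 \<partial>distr N borel (\<lambda>\<omega>. Y \<omega> \<bullet> h)) = C h \<bullet> h"
      unfolding integral_distr[OF Yh m2] by (rule sq(2))
  qed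
qed

lemma weak_conv_lipschitz_cong_AE:
  fixes X :: "nat \<Rightarrow> 'w \<Rightarrow> 'v::metric_space"
  assumes conv: "weak_conv_lipschitz M X N Y"
    and X: "\<And>n. X n \<in> borel_measurable M" "\<And>n. X' n \<in> borel_measurable M"
      "\<And>n. AE \<omega> in M. X n \<omega> = X' n \<omega>"
    and Y: "Y \<in> borel_measurable N" "Y' \<in> borel_measurable N" "AE \<omega> in N. Y \<omega> = Y' \<omega>"
  shows "weak_conv_lipschitz M X' N Y'"
  unfolding weak_conv_lipschitz_def
proof (intro allI impI)
  fix f :: "'v \<Rightarrow> real" and L assume f: "L-lipschitz_on UNIV f \<and> bounded (range f)"
  then have fm: "f \<in> borel_measurable borel"
    using lipschitz_on_imp_borel_measurable by blast
  have "(\<integral>\<omega>. f (X n \<omega>) \<partial>M) = (\<integral>\<omega>. f (X' n \<omega>) \<partial>M)" for n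
  proof (rule integral_cong_AE)
    show "AE \<omega> in M. f (X n \<omega>) = f (X' n \<omega>)"
      using X(3)[of n] by (rule AE_mp) (rule AE_I2, simp)
  qed (rule measurable_compose[OF X(1) fm] measurable_compose[OF X(2) fm])+
  moreover have "(\<integral>\<omega>. f (Y \<omega>) \<partial>N) = (\<integral>\<omega>. f (Y' \<omega>) \<partial>N)"
  proof (rule integral_cong_AE)
    show "AE \<omega> in N. f (Y \<omega>) = f (Y' \<omega>)"
      using Y(3) by (rule AE_mp) (rule AE_I2, simp)
  qed (rule measurable_compose[OF Y(1) fm] measurable_compose[OF Y(2) fm])+
  moreover have "(\<lambda>n. \<integral>\<omega>. f (X n \<omega>) \<partial>M) \<longlonglongrightarrow> (\<integral>\<omega>. f (Y \<omega>) \<partial>N)"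
    using conv f unfolding weak_conv_lipschitz_def by blast
  ultimately show "(\<lambda>n. \<integral>\<omega>. f (X' n \<omega>) \<partial>M) \<longlonglongrightarrow> (\<integral>\<omega>. f (Y' \<omega>) \<partial>N)"
    by simp
qed

lemma continuous_on_proj_on:
  fixes S :: "'v::{real_inner, complete_space} set"
  assumes "convex S" "closed S" "S \<noteq> {}"
  shows "continuous_on T (proj_on S)"
proof -
  have "1-lipschitz_on T (proj_on S)"
    by (rule lipschitz_onI) (use proj_on_lipschitz[OF assms] in auto)
  then show ?thesis by (rule lipschitz_on_continuous_on)
qed

section \<open>Convergence to an arbitrary Gaussian process with the prescribed moments\<close>

context decreasing_sample
begin

context
  fixes N :: "'b measure" and Y :: "'b \<Rightarrow> 'a l2"
  assumes gp: "gaussian_process (l2_on A) N Y" and mean: "has_mean (l2_on A) N Y 0"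
    and cov: "has_covariance_operator (l2_on A) N Y (multinomial_cov q)"
begin

lemma prob_space_limit: "prob_space N"
  using gp by (simp add: gaussian_process_def)

lemma limit_measurable_restrict: "Y \<in> measurable N (restrict_space borel (l2_on A))"
  using gp by (simp add: gaussian_process_def)

lemma limit_measurable: "Y \<in> borel_measurable N"
  using limit_measurable_restrict by (simp add: measurable_restrict_space2_iff)

lemma limit_in_l2_on: "\<omega> \<in> space N \<Longrightarrow> Y \<omega> \<in> l2_on A"
  using measurable_space[OF limit_measurable_restrict] by (simp add: space_restrict_space)

lemma limit_second_moment:
  "integrable N (\<lambda>\<omega>. (l2_fun (Y \<omega>) x)\<^sup>2)" "(\<integral>\<omega>. (l2_fun (Y \<omega>) x)\<^sup>2 \<partial>N) \<le> q x"
proof -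
  have "integrable N (\<lambda>\<omega>. (l2_fun (Y \<omega>) x)\<^sup>2) \<and> (\<integral>\<omega>. (l2_fun (Y \<omega>) x)\<^sup>2 \<partial>N) \<le> q x"
  proof (cases "x \<in> A")
    case True
    then have "l2_basis x \<in> l2_on A" by (auto simp: l2_on_def)
    note * = gaussian_process_centred(1,2)[OF gp mean cov this]
    have "multinomial_cov q (l2_basis x) \<bullet> l2_basis x \<le> q x"
      by (simp add: multinomial_cov_basis[OF q] del: inner_l2_basis)
    then show ?thesis using * by simp
  next
    case False
    have zero: "(l2_fun (Y \<omega>) x)\<^sup>2 = 0" if "\<omega> \<in> space N" for \<omega>
      using limit_in_l2_on[OF that] False by (simp add: l2_on_def)
    show ?thesis
      using q_nonneg[of x]
      by (subst Bochner_Integration.integrable_cong[OF refl zero],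
          simp, subst Bochner_Integration.integral_cong[OF refl zero]) auto
  qed
  then show "integrable N (\<lambda>\<omega>. (l2_fun (Y \<omega>) x)\<^sup>2)" "(\<integral>\<omega>. (l2_fun (Y \<omega>) x)\<^sup>2 \<partial>N) \<le> q x"
    by auto
qed

lemma AE_limit_support: "AE \<omega> in N. l2_restrict support (Y \<omega>) = Y \<omega>"
proof -
  have "AE \<omega> in N. x \<notin> support \<longrightarrow> l2_fun (Y \<omega>) x = 0" for x
  proof (cases "x \<in> support")
    case False
    then have "q x = 0" using q_nonneg[of x] by (auto simp: support_def)
    then have "(\<integral>\<omega>. (l2_fun (Y \<omega>) x)\<^sup>2 \<partial>N) = 0"
      using limit_second_moment(2)[of x]
      by (intro antisym) (auto intro: Bochner_Integration.integral_nonneg)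
    then have "AE \<omega> in N. (l2_fun (Y \<omega>) x)\<^sup>2 = 0"
      using integral_nonneg_eq_0_iff_AE[OF limit_second_moment(1)[of x]] by simp
    then show ?thesis by simp
  qed simp
  then have "AE \<omega> in N. \<forall>x. x \<notin> support \<longrightarrow> l2_fun (Y \<omega>) x = 0"
    by (simp add: AE_all_countable)
  then show ?thesis
    by (rule AE_mp) (auto intro!: AE_I2 l2_eqI)
qed

lemma limit_cos:
  assumes D: "finite D" "h \<in> l2_on D"
  shows "(\<integral>\<omega>. cos (h \<bullet> Y \<omega> + c) \<partial>N) = (\<integral>z. cos (z + c) \<partial>centred_normal (multinomial_cov q h \<bullet> h))"
proof -
  \<comment> \<open>Gaussianity is given only for functionals in \<open>l2_on A\<close>. Restricting
    \<open>h\<close> to \<open>A\<close> changes neither the pairing with \<open>Y\<close> nor the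
    variance.\<close>
  define g where "g = l2_restrict A h"
  have g: "g \<in> l2_on D" "g \<in> l2_on A"
    using D(2) by (auto simp: g_def l2_on_def)
  have "q x * (l2_fun g x)\<^sup>2 = q x * (l2_fun h x)\<^sup>2" "q x * l2_fun g x = q x * l2_fun h x" for x
    by (auto simp: g_def q_def)
  then have var: "multinomial_cov q g \<bullet> g = multinomial_cov q h \<bullet> h"
    by (simp only: multinomial_cov_finite[OF q D] multinomial_cov_finite[OF q D(1) g(1)])
  have inner: "h \<bullet> Y \<omega> = Y \<omega> \<bullet> g" if "\<omega> \<in> space N" for \<omega>
  proof -
    have "h \<bullet> Y \<omega> = (\<Sum>x\<in>D. l2_fun h x * l2_fun (Y \<omega>) x)"
      by (rule inner_l2_on_finite[OF D])
    also have "\<dots> = (\<Sum>x\<in>D. l2_fun g x * l2_fun (Y \<omega>) x)"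
      using limit_in_l2_on[OF that] by (intro sum.cong) (auto simp: g_def l2_on_def)
    also have "\<dots> = Y \<omega> \<bullet> g"
      using inner_l2_on_finite[OF D(1) g(1), of "Y \<omega>"] by (simp add: inner_commute)
    finally show ?thesis .
  qed
  have "(\<lambda>v. v \<bullet> g) \<in> borel_measurable borel"
    by (intro borel_measurable_continuous_onI continuous_intros)
  then have Yg: "(\<lambda>\<omega>. Y \<omega> \<bullet> g) \<in> borel_measurable N"
    by (rule measurable_compose[OF limit_measurable])
  have cosm: "(\<lambda>z::real. cos (z + c)) \<in> borel_measurable borel"
    by measurable
  have "(\<integral>\<omega>. cos (h \<bullet> Y \<omega> + c) \<partial>N) = (\<integral>\<omega>. cos (Y \<omega> \<bullet> g + c) \<partial>N)"
    by (rule Bochner_Integration.integral_cong[OF refl]) (simp add: inner)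
  also have "\<dots> = (\<integral>z. cos (z + c) \<partial>distr N borel (\<lambda>\<omega>. Y \<omega> \<bullet> g))"
    by (rule integral_distr[OF Yg cosm, symmetric])
  finally show ?thesis
    by (simp only: gaussian_process_centred(3)[OF gp mean cov g(2)] var)
qed

lemma fluctuation_weak_conv: "weak_conv_lipschitz M fluctuation N Y"
proof (rule weak_conv_lipschitzI_cos[OF prob_space_axioms prob_space_limit measurable_fluctuation
      limit_measurable _ q fluctuation_second_moment limit_second_moment])
  fix D :: "'a set" and h c assume "finite D" "h \<in> l2_on D"
  then show "(\<lambda>n. expectation (\<lambda>\<omega>. cos (h \<bullet> fluctuation n \<omega> + c))) \<longlonglongrightarrow> (\<integral>\<omega>. cos (h \<bullet> Y \<omega> + c) \<partial>N)"
    unfolding limit_cos[OF \<open>finite D\<close> \<open>h \<in> l2_on D\<close>] by (rule cos_fluctuation_tendsto)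
qed

text \<open>Pointwise convergence of the projections is known only on the support, so restriction to
  it is inserted before the mapping theorem and removed afterwards almost surely.\<close>

lemma decreasing_estimator_converges:
  "converges_in_distribution (l2_on A) M
    (\<lambda>n \<omega>. sqrt (real n) *\<^sub>R (decreasing_estimator A Z n \<omega> - to_l2 A p))
    N (\<lambda>\<omega>. level_set_regression (\<ge>) A p (Y \<omega>))"
  unfolding scaled_error_eq_proj_on level_set_regression_eq_proj_on
proof (rule converges_in_distributionI[OF prob_space_axioms prob_space_limit])
  have local_m: "proj_on (local_cone n) \<in> borel_measurable borel" for n
    by (rule borel_measurable_continuous_onI[OF continuous_on_proj_on[OF local_cone]])
  have level_m: "proj_on (level_cone A p) \<in> borel_measurable borel"
    by (rule borel_measurable_continuous_onI[OF continuous_on_proj_on[OF level_cone]])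
  have Xm: "(\<lambda>\<omega>. proj_on (local_cone n) (fluctuation n \<omega>)) \<in> borel_measurable M" for n
    by (rule measurable_compose[OF measurable_fluctuation local_m])
  have Ym: "(\<lambda>\<omega>. proj_on (level_cone A p) (Y \<omega>)) \<in> borel_measurable N"
    by (rule measurable_compose[OF limit_measurable level_m])
  have "proj_on (local_cone n) w \<in> l2_on A" for n w
    using proj_on_in[OF local_cone, of n w] unfolding local_cone_def by (rule order_constrainedD)
  then show "(\<lambda>\<omega>. proj_on (local_cone n) (fluctuation n \<omega>)) \<in> measurable M (restrict_space borel (l2_on A))" for n
    by (intro measurable_restrict_space2 Xm) auto
  have "proj_on (level_cone A p) w \<in> l2_on A" for w
    using proj_on_in[OF level_cone, of w] by (rule order_constrainedD)
  then show "(\<lambda>\<omega>. proj_on (level_cone A p) (Y \<omega>)) \<in> measurable N (restrict_space borel (l2_on A))"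
    by (intro measurable_restrict_space2 Ym) auto
  let ?R = "l2_restrict support :: 'a l2 \<Rightarrow> 'a l2"
  have "weak_conv_lipschitz M (\<lambda>n \<omega>. proj_on (local_cone n) (?R (fluctuation n \<omega>)))
      N (\<lambda>\<omega>. proj_on (level_cone A p) (?R (Y \<omega>)))"
  proof (rule weak_conv_lipschitz_map[OF prob_space_axioms prob_space_limit measurable_fluctuation
        limit_measurable fluctuation_weak_conv, of "\<lambda>n v. proj_on (local_cone n) (?R v)"
          "\<lambda>v. proj_on (level_cone A p) (?R v)"])
    show "dist (proj_on (local_cone n) (?R v)) (proj_on (local_cone n) (?R w)) \<le> dist v w" for n v w
      by (rule order_trans[OF proj_on_lipschitz[OF local_cone] dist_l2_restrict_le])
    show "(\<lambda>n. proj_on (local_cone n) (?R v)) \<longlonglongrightarrow> proj_on (level_cone A p) (?R v)" for v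
      by (rule proj_on_local_cone_tendsto) (simp add: l2_restrict_in_l2_on)
  qed
  then show "weak_conv_lipschitz M (\<lambda>n \<omega>. proj_on (local_cone n) (fluctuation n \<omega>))
      N (\<lambda>\<omega>. proj_on (level_cone A p) (Y \<omega>))"
  proof (rule weak_conv_lipschitz_cong_AE[OF _ _ Xm _ _ Ym])
    show "(\<lambda>\<omega>. proj_on (local_cone n) (?R (fluctuation n \<omega>))) \<in> borel_measurable M" for n
      by (rule measurable_compose[OF measurable_compose[OF measurable_fluctuation
              measurable_l2_restrict] local_m])
    show "(\<lambda>\<omega>. proj_on (level_cone A p) (?R (Y \<omega>))) \<in> borel_measurable N"
      by (rule measurable_compose[OF measurable_compose[OF limit_measurable
              measurable_l2_restrict] level_m])
    show "AE \<omega> in M. proj_on (local_cone n) (?R (fluctuation n \<omega>))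
        = proj_on (local_cone n) (fluctuation n \<omega>)" for n
      using AE_fluctuation_support[of n] by (rule AE_mp) (rule AE_I2, simp)
    show "AE \<omega> in N. proj_on (level_cone A p) (?R (Y \<omega>)) = proj_on (level_cone A p) (Y \<omega>)"
      using AE_limit_support by (rule AE_mp) (rule AE_I2, simp)
  qed
qed

end

end

theorem corollary2:
  fixes r :: "'d::finite \<Rightarrow> enat"
    and M :: "'w measure"
    and Z :: "nat \<Rightarrow> 'w \<Rightarrow> nat ^ 'd"
    and p :: "nat ^ 'd \<Rightarrow> real"
  assumes "prob_space M"
    and "prob_space.indep_vars M (\<lambda>_. count_space (grid r)) Z {1..}"
    and "\<forall>j\<ge>1. \<forall>x\<in>grid r. measure M {\<omega> \<in> space M. Z j \<omega> = x} = p x"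
    and "monotone_on (grid r) (\<le>) (\<ge>) p"
  shows "\<exists>C :: (nat ^ 'd) l2 \<Rightarrow> (nat ^ 'd) l2.
    bounded_linear C \<and> C ` l2_on (grid r) \<subseteq> l2_on (grid r) \<and>
    (\<forall>i\<in>grid r. \<forall>i'\<in>grid r.
      C (l2_basis i) \<bullet> l2_basis i' = p i * (if i = i' then 1 else 0) - p i * p i') \<and>
    (\<exists>N :: (nat ^ 'd) l2 measure.
      gaussian_process (l2_on (grid r)) N (\<lambda>y. y) \<and>
      has_mean (l2_on (grid r)) N (\<lambda>y. y) 0 \<and>
      has_covariance_operator (l2_on (grid r)) N (\<lambda>y. y) C) \<and>
    (\<forall>(N :: 'b measure) Y.
      gaussian_process (l2_on (grid r)) N Y \<and>
      has_mean (l2_on (grid r)) N Y 0 \<and>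
      has_covariance_operator (l2_on (grid r)) N Y C \<longrightarrow>
      converges_in_distribution (l2_on (grid r)) M
        (\<lambda>n \<omega>. sqrt (real n) *\<^sub>R (decreasing_estimator (grid r) Z n \<omega> - to_l2 (grid r) p))
        N (\<lambda>\<omega>. level_set_regression (\<ge>) (grid r) p (Y \<omega>)))"
proof -
  interpret prob_space M by fact
  interpret decreasing_sample M Z "grid r" p
    by unfold_locales (use assms in \<open>auto simp: monotone_on_def\<close>)
  have q0: "q x = 0" if "x \<notin> grid r" for x
    using that by (simp add: q_def)
  show ?thesis
  proof (intro exI[of _ "multinomial_cov q"] conjI allI impI)
    show "bounded_linear (multinomial_cov q)"
      by (rule bounded_linear_multinomial_cov[OF q])
    show "multinomial_cov q ` l2_on (grid r) \<subseteq> l2_on (grid r)"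
      by (auto simp: l2_on_def l2_fun_multinomial_cov[OF q] q0)
    show "\<forall>i\<in>grid r. \<forall>i'\<in>grid r. multinomial_cov q (l2_basis i) \<bullet> l2_basis i'
        = p i * (if i = i' then 1 else 0) - p i * p i'"
      by (simp add: multinomial_cov_basis[OF q] q_def del: inner_l2_basis)
    show "\<exists>N :: (nat ^ 'd) l2 measure. gaussian_process (l2_on (grid r)) N (\<lambda>y. y) \<and>
        has_mean (l2_on (grid r)) N (\<lambda>y. y) 0 \<and>
        has_covariance_operator (l2_on (grid r)) N (\<lambda>y. y) (multinomial_cov q)"
      by (rule ex_gaussian_process_multinomial_cov[OF q q0])
  qed (elim conjE, rule decreasing_estimator_converges)
qed

end
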